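(* Let $k\in\mathbb{Z}_{\ge 0}$. For every $0<\delta<\infty$ the quantity $E^\delta_{k/2}(u)$ is conserved under the flow of the intermediate long wave equation (ILW) $$\partial_t u-\mathcal{G}_\delta\partial_x^2u=\partial_x(u^2)\quad\text{on }\mathbb{R}\times\mathbb{T}.$$ Similarly, the quantity $E^{\rm BO}_{k/2}(u)=E^\infty_{k/2}(u)$ is conserved under the flow of the Benjamin-Ono equation (BO) $$\partial_t u-\mathcal{H}\partial_x^2u=\partial_x(u^2)\quad\text{on }\mathbb{R}\times\mathbb{T}.$$ Moreover, for every (real-valued, mean-zero) $u\in H^{k/2}(\mathbb{T})$, $$\lim_{\delta\to\infty}E^\delta_{k/2}(u)=E^{\rm BO}_{k/2}(u).$$
   Context: $\mathbb{T}=\mathbb{R}/(2\pi\mathbb{Z})$; all functions $u$ are real-valued with mean zero on $\mathbb{T}$. Conservation of a quantity means conservation along solutions that are sufficiently smooth. For $0<\delta<\infty$, $\mathcal{G}_\delta$ is the Fourier multiplier operator with multiplier $-i\big(\coth(\delta n)-\frac{1}{\delta n}\big)$ for $n\in\mathbb{Z}\setminus\{0\}$ and $0$ for $n=0$. $\mathcal{H}$ is the Hilbert transform with multiplier $-i\,\mathrm{sgn}(n)\mathbf 1_{n\ne0}$. Set $\mathcal{G}_\infty:=\mathcal{H}$ and $\infty^{-1}:=0$. For $0<\delta\le\infty$ put $\mathcal{L}_0=(\mathcal{G}_\delta-i)\partial_x+\delta^{-1}$ and define recursively (for smooth $u$) $$\chi^\delta_1=2u,\qquad \chi^\delta_n=-\sum_{j=2}^n\frac1{j!}\sum_{\substack{n_1,\dots,n_j\in\mathbb{N}\\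 n_1+\cdots+n_j=n}}\chi^\delta_{n_1}\cdots\chi^\delta_{n_j}-\mathcal{L}_0\chi^\delta_{n-1},\quad n\ge2.$$ With $b_k=\sum_{0\le\ell\le k,\ \ell\text{ even}}\binom{k+1}{\ell+1}$, define recursively for $k\in\mathbb{Z}_{\ge0}$ $$E^\delta_{k/2}(u)=\frac{(-1)^{k+1}}{4b_k}\Big[\mathrm{Re}\int_{\mathbb{T}}\chi^\delta_{k+2}\,dx-4(-1)^{k+1}\sum_{j=0}^{k-1}\frac1{\delta^{k-j}}\binom{k+2}{j+2}b_j\,E^\delta_{j/2}(u)\Big]$$ (the sum is absent for $k=0$, and vanishes when $\delta=\infty$). These quantities are of the form $E^\delta_0(u)=\frac12\|u\|_{L^2}^2$ and $E^\delta_{k/2}(u)=\frac12\sum_{0\le\ell\le k,\,\ell\text{ even}}a_{k,\ell}\sum_{n\neq 0}|n|^k|\widehat{\mathcal{G}_\delta}(n)|^{k-\ell}|\hat u(n)|^2+R^\delta_{k/2}(u)$ with $a_{k,\ell}=\frac{1}{b_k}\binom{k+1}{\ell+1}$ and $R^\delta_{k/2}$ containing only terms at least cubic in $u$. For mean-zero $u\in H^{k/2}(\mathbb{T})$, $E^\delta_{k/2}(u)$ is understood as the continuous extension from mean-zero $C^\infty(\mathbb{T})$ functions. *)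

theory Defs
  imports "HOL-Analysis.Analysis"
begin

text \<open>
  Functions on the torus \<open>\<real> / 2\<pi>\<int>\<close> are \<open>2\<pi>\<close>-periodic functions on the reals; integrals over
  the torus are Lebesgue integrals over \<open>[0, 2\<pi>]\<close> (not normalised).
\<close>

abbreviation torus :: "real measure" where
  "torus \<equiv> lebesgue_on {0..2 * pi}"

definition periodic_mean_zero :: "(real \<Rightarrow> real) \<Rightarrow> bool" where
  "periodic_mean_zero u \<longleftrightarrow>
     (\<forall>x. u (x + 2 * pi) = u x) \<and> integrable torus u \<and> integral\<^sup>L torus u = 0"

definition smooth_mean_zero :: "(real \<Rightarrow> real) set" where
  "smooth_mean_zero =
     {u. periodic_mean_zero u \<and> (\<forall>n x. (deriv ^^ n) u field_differentiable at x)}"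

definition fourier_coeff :: "(real \<Rightarrow> complex) \<Rightarrow> int \<Rightarrow> complex" where
  "fourier_coeff f n = integral\<^sup>L torus (\<lambda>x. f x * cis (- (of_int n * x))) / (2 * pi)"

definition fourier_multiplier :: "(int \<Rightarrow> complex) \<Rightarrow> (real \<Rightarrow> complex) \<Rightarrow> real \<Rightarrow> complex" where
  "fourier_multiplier m f x = (\<Sum>\<^sub>\<infinity>n\<in>UNIV. m n * fourier_coeff f n * cis (of_int n * x))"

text \<open>
  The depth parameter \<open>\<delta>\<close> ranges over \<open>(0, \<infinity>]\<close> and is an extended real.
  Note \<^term>\<open>inverse (\<infinity> :: ereal) = 0\<close>, as required for \<open>\<delta>\<^sup>-\<^sup>1\<close>.
\<close>

definition coth :: "real \<Rightarrow> real" where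
  "coth x = cosh x / sinh x"

definition hilbert_symbol :: "int \<Rightarrow> complex" where
  "hilbert_symbol n = - \<i> * of_int (sgn n)"

definition G_symbol :: "ereal \<Rightarrow> int \<Rightarrow> complex" where
  "G_symbol \<delta> n =
     (if \<delta> = \<infinity> then hilbert_symbol n
      else if n = 0 then 0
      else let d = real_of_ereal \<delta>
           in - \<i> * of_real (coth (d * of_int n) - 1 / (d * of_int n)))"

definition G :: "ereal \<Rightarrow> (real \<Rightarrow> complex) \<Rightarrow> real \<Rightarrow> complex" where
  "G \<delta> = fourier_multiplier (G_symbol \<delta>)"

definition inv_depth :: "ereal \<Rightarrow> real" where
  "inv_depth \<delta> = real_of_ereal (inverse \<delta>)"

definition Dx :: "(real \<Rightarrow> 'a::real_normed_vector) \<Rightarrow> real \<Rightarrow> 'a" where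
  "Dx f x = vector_derivative f (at x)"

definition L0 :: "ereal \<Rightarrow> (real \<Rightarrow> complex) \<Rightarrow> real \<Rightarrow> complex" where
  "L0 \<delta> f x = G \<delta> (Dx f) x - \<i> * Dx f x + of_real (inv_depth \<delta>) * f x"

definition compositions :: "nat \<Rightarrow> nat \<Rightarrow> nat list set" where
  "compositions n j = {ns. length ns = j \<and> (\<forall>m\<in>set ns. 1 \<le> m) \<and> sum_list ns = n}"

lemma compositions_less:
  assumes "ns \<in> compositions n j" and "2 \<le> j" and "m \<in> set ns"
  shows "m < n"
proof -
  obtain xs ys where ns: "ns = xs @ m # ys"
    using assms(3) by (meson split_list)
  have pos: "\<forall>i\<in>set (xs @ ys). 1 \<le> i" and len: "length (xs @ ys) \<ge> 1"
    and sum: "n = m + sum_list (xs @ ys)"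
    using assms ns by (auto simp: compositions_def)
  then obtain i where i: "i \<in> set (xs @ ys)"
    by (metis One_nat_def length_greater_0_conv less_eq_Suc_le list.set_intros(1) neq_Nil_conv)
  then have "1 \<le> i" and "i \<le> sum_list (xs @ ys)"
    using pos member_le_sum_list by blast+
  then show ?thesis using sum by linarith
qed

text \<open>The sequence starts at index 1; the value at index 0 is a dummy and is never used.\<close>

function chi :: "ereal \<Rightarrow> (real \<Rightarrow> real) \<Rightarrow> nat \<Rightarrow> real \<Rightarrow> complex" where
  "chi \<delta> u n =
     (if n = 0 then (\<lambda>x. 0)
      else if n = 1 then (\<lambda>x. 2 * of_real (u x))
      else (\<lambda>x. - (\<Sum>j=2..n. 1 / fact j * (\<Sum>ns\<in>compositions n j. \<Prod>m\<leftarrow>ns. chi \<delta> u m x))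
                - L0 \<delta> (chi \<delta> u (n - 1)) x))"
  by pat_completeness auto
termination
  by (relation "Wellfounded.measure (\<lambda>(\<delta>, u, n). n)") (auto intro: compositions_less)

declare chi.simps [simp del]

definition b :: "nat \<Rightarrow> real" where
  "b k = (\<Sum>l\<in>{l. l \<le> k \<and> even l}. of_nat ((k + 1) choose (l + 1)))"

text \<open>\<open>smooth_energy \<delta> u k\<close> is \<open>E\<^sup>\<delta>\<close> with index \<open>k/2\<close>, given by the recursion for smooth \<open>u\<close>.\<close>

fun smooth_energy :: "ereal \<Rightarrow> (real \<Rightarrow> real) \<Rightarrow> nat \<Rightarrow> real" where
  "smooth_energy \<delta> u k =
     (- 1) ^ (k + 1) / (4 * b k) *
       (Re (integral\<^sup>L torus (chi \<delta> u (k + 2)))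
        - 4 * (- 1) ^ (k + 1) *
            (\<Sum>j<k. inv_depth \<delta> ^ (k - j) * of_nat ((k + 2) choose (j + 2)) * b j
                     * smooth_energy \<delta> u j))"

declare smooth_energy.simps [simp del]

definition sobolev_terms :: "real \<Rightarrow> (real \<Rightarrow> real) \<Rightarrow> int \<Rightarrow> real" where
  "sobolev_terms s u n =
     (1 + (of_int n)\<^sup>2) powr s * (cmod (fourier_coeff (\<lambda>x. of_real (u x)) n))\<^sup>2"

definition sobolev_norm :: "real \<Rightarrow> (real \<Rightarrow> real) \<Rightarrow> real" where
  "sobolev_norm s u = sqrt (\<Sum>\<^sub>\<infinity>n\<in>UNIV. sobolev_terms s u n)"

definition sobolev_mean_zero :: "real \<Rightarrow> (real \<Rightarrow> real) set" where
  "sobolev_mean_zero s =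
     {u. periodic_mean_zero u \<and> integrable torus (\<lambda>x. (u x)\<^sup>2)
         \<and> sobolev_terms s u summable_on UNIV}"

text \<open>Smooth mean-zero functions \<open>v\<close> tending to \<open>u\<close> in the Sobolev space of order \<open>s\<close>.\<close>

definition smooth_approx :: "real \<Rightarrow> (real \<Rightarrow> real) \<Rightarrow> (real \<Rightarrow> real) filter" where
  "smooth_approx s u =
     inf (filtercomap (\<lambda>v. sobolev_norm s (\<lambda>x. v x - u x)) (nhds 0))
         (principal smooth_mean_zero)"

text \<open>
  The continuous extension of the energy of index \<open>k/2\<close> to mean-zero functions in the
  Sobolev space of order \<open>k/2\<close>. A smooth \<open>u\<close> belongs to every set of its own approximation
  filter, so at such \<open>u\<close> the limit, if it exists, is \<^term>\<open>smooth_energy \<delta> u k\<close>.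
\<close>

definition energy :: "ereal \<Rightarrow> nat \<Rightarrow> (real \<Rightarrow> real) \<Rightarrow> real" where
  "energy \<delta> k u = Lim (smooth_approx (real k / 2) u) (\<lambda>v. smooth_energy \<delta> v k)"

text \<open>\<open>C_class m u\<close>: \<open>u(t, x)\<close> is jointly \<open>m\<close> times continuously differentiable.\<close>

primrec C_class :: "nat \<Rightarrow> (real \<Rightarrow> real \<Rightarrow> real) \<Rightarrow> bool" where
  "C_class 0 u \<longleftrightarrow> continuous_on UNIV (\<lambda>(t, x). u t x)"
| "C_class (Suc m) u \<longleftrightarrow>
     continuous_on UNIV (\<lambda>(t, x). u t x) \<and>
     (\<exists>ut ux. (\<forall>t x. ((\<lambda>s. u s x) has_real_derivative ut t x) (at t)) \<and>
              (\<forall>t x. (u t has_real_derivative ux t x) (at x)) \<and>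
              C_class m ut \<and> C_class m ux)"

text \<open>
  For \<open>\<delta> < \<infinity>\<close> this is the intermediate long wave equation, for \<open>\<delta> = \<infinity>\<close> the
  Benjamin--Ono equation.
\<close>

definition solves_ILW :: "ereal \<Rightarrow> (real \<Rightarrow> real \<Rightarrow> real) \<Rightarrow> bool" where
  "solves_ILW \<delta> u \<longleftrightarrow>
     (\<forall>t. periodic_mean_zero (u t)) \<and>
     (\<forall>t x. of_real (Dx (\<lambda>s. u s x) t) - G \<delta> (\<lambda>y. of_real (Dx (Dx (u t)) y)) x
            = (of_real (Dx (\<lambda>y. (u t y)\<^sup>2) x) :: complex))"

text \<open>Conservation along all solutions that are sufficiently smooth.\<close>

definition conserved :: "ereal \<Rightarrow> ((real \<Rightarrow> real) \<Rightarrow> real) \<Rightarrow> bool" where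
  "conserved \<delta> Q \<longleftrightarrow>
     (\<exists>m. \<forall>u. C_class m u \<and> solves_ILW \<delta> u \<longrightarrow> (\<forall>t. Q (u t) = Q (u 0)))"

end

theory Submission
  imports Defs "HOL-Library.Poly_Mapping" "HOL-Computational_Algebra.Formal_Power_Series"
begin

text \<open>
  Let \<open>\<chi> = \<Sum> \<epsilon>\<^sup>n \<chi>\<^sub>n\<close>. The recursion for \<open>\<chi>\<^sub>n\<close> says that \<open>(e\<^sup>\<chi> - 1) / \<epsilon> + L\<^sub>0 \<chi> = 2 u\<close>. By the
  addition theorem of the hyperbolic cotangent, the linearisation of this Baecklund transform maps
  the defect of \<open>\<chi>\<close> in the modified equation
  \<open>\<chi>\<^sub>t = G \<chi>\<^sub>x\<^sub>x + \<chi>\<^sub>x G \<chi>\<^sub>x + (e\<^sup>\<chi> - 1) / \<epsilon> \<chi>\<^sub>x + \<chi> \<chi>\<^sub>x / \<delta>\<close>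
  to the defect of \<open>u\<close> in ILW. The linearisation is invertible as a formal power series in \<open>\<epsilon>\<close>, so
  \<open>\<chi>\<close> solves the modified equation along ILW; the right-hand side of the latter has mean zero because
  \<open>G\<close> is skew, hence every \<open>\<integral> \<chi>\<^sub>n\<close> is conserved.

  This is carried out for trigonometric polynomials. The zero mode of \<open>\<chi>\<^sub>k\<^sub>+\<^sub>2\<close> is a sum of
  \<open>j\<close>-linear forms in the Fourier coefficients with \<open>k + 2 - j\<close> derivatives. Since the frequencies add
  up to zero, the two largest are comparable and can share all the derivatives, which gives a local
  Lipschitz bound in the Sobolev space of order \<open>k/2\<close>, uniform for \<open>\<delta>\<close> bounded away from zero. It
  provides the continuous extension, the interchange of Fourier truncation with \<open>\<delta> \<rightarrow> \<infinity>\<close>, and, as a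
  solution truncated at frequency \<open>N\<close> solves the equation up to \<open>O(1/N)\<close>, also the conservation.
\<close>

subsection \<open>Laurent polynomials as trigonometric polynomials\<close>

text \<open>On Laurent polynomials products and multipliers are finite algebra, so the Baecklund
  argument needs no convergence. The price is that a truncated solution is no solution, since the
  square of a polynomial of frequency N reaches 2 N. The conservation argument therefore admits a
  defect e: the derivative of a zero mode along the curve equals its derivative along the straight
  line in direction e, where difference quotients obey the same Lipschitz bound that constructs the
  extension. No gradient of an energy is ever computed.

  In every term of \<chi>_n the factors u and the derivatives together number at most n. At index k
  + 2 a j-linear term thus leaves, of the k derivatives that two factors of order k/2 can absorb, a
  surplus of at least j - 2: one negative power for each remaining factor, enough to sum its
  coefficients by Cauchy-Schwarz.

  The extension is a \<open>Lim\<close> along a filter, which is informative only if the filter is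
  proper and the limit exists. Fourier truncations settle both; afterwards an energy is only handled
  as a limit of energies of Laurent polynomials.\<close>

type_synonym laurent = "int \<Rightarrow>\<^sub>0 complex"

abbreviation lookup :: "laurent \<Rightarrow> int \<Rightarrow> complex" where "lookup \<equiv> Poly_Mapping.lookup"
abbreviation keys :: "laurent \<Rightarrow> int set" where "keys \<equiv> Poly_Mapping.keys"

text \<open>The index set may be any finite superset of the support, so that several products can be
  expanded over one common set and compared term by term.\<close>

lemma lookup_times:
  fixes p q :: laurent
  assumes "finite A" "keys p \<subseteq> A"
  shows "lookup (p * q) n = (\<Sum>a\<in>A. lookup p a * lookup q (n - a))"
proof -
  have inner: "Sum_any (\<lambda>r. lookup q r when n = a + r) = lookup q (n - a)" for a
  proof -
    have "(\<lambda>r. lookup q r when n = a + r) = (\<lambda>r. lookup q r when r = n - a)"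
      by (auto simp: fun_eq_iff when_def)
    then show ?thesis by (simp only: Sum_any_when_equal)
  qed
  have "lookup (p * q) n = Sum_any (\<lambda>a. lookup p a * lookup q (n - a))"
    by (simp add: lookup_mult inner)
  also have "\<dots> = (\<Sum>a\<in>A. lookup p a * lookup q (n - a))"
    by (rule Sum_any.expand_superset) (use assms in \<open>auto simp: in_keys_iff\<close>)
  finally show ?thesis .
qed

definition mult_op :: "(int \<Rightarrow> complex) \<Rightarrow> laurent \<Rightarrow> laurent" where
  "mult_op m p = Abs_poly_mapping (\<lambda>n. m n * lookup p n)"

lemma lookup_mult_op [simp]: "lookup (mult_op m p) n = m n * lookup p n"
proof -
  have "finite {n. m n * lookup p n \<noteq> 0}"
    by (rule finite_subset[OF _ finite_keys[of p]]) (auto simp: in_keys_iff)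
  then show ?thesis by (simp add: mult_op_def)
qed

lemma keys_mult_op: "Poly_Mapping.keys (mult_op m p) \<subseteq> keys p"
  by (auto simp: in_keys_iff)

abbreviation cst :: "complex \<Rightarrow> laurent" where "cst c \<equiv> Poly_Mapping.single 0 c"

lemma lookup_cst_times [simp]: "lookup (cst c * p) n = c * lookup p n"
proof -
  have "keys (cst c) \<subseteq> {0}" by simp
  then show ?thesis using lookup_times[of "{0}" "cst c" p n] by simp
qed

lemma lookup_times_cst [simp]: "lookup (p * cst c) n = c * lookup p n"
  by (subst mult.commute) (rule lookup_cst_times)

lemma lookup_2_times [simp]: "lookup (2 * p) n = 2 * lookup p n"
  by (subst (1 2) mult_2) (rule lookup_add)

lemma mult_op_add: "mult_op m (p + q) = mult_op m p + mult_op m q"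
  by (rule poly_mapping_eqI) (simp add: lookup_add algebra_simps)

lemma mult_op_diff: "mult_op m (p - q) = mult_op m p - mult_op m q"
  by (rule poly_mapping_eqI) (simp add: lookup_minus algebra_simps)

lemma mult_op_0 [simp]: "mult_op m 0 = 0"
  by (rule poly_mapping_eqI) simp

lemma mult_op_sum: "mult_op m (sum f A) = (\<Sum>a\<in>A. mult_op m (f a))"
  by (rule poly_mapping_eqI) (simp add: lookup_sum sum_distrib_left)

lemma mult_op_cst: "mult_op m (cst c * p) = cst c * mult_op m p"
  by (rule poly_mapping_eqI) simp

lemma mult_op_single [simp]: "mult_op m (Poly_Mapping.single n c) = Poly_Mapping.single n (m n * c)"
  by (rule poly_mapping_eqI) (simp add: lookup_single when_def)

abbreviation ddx :: "laurent \<Rightarrow> laurent" where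
  "ddx \<equiv> mult_op (\<lambda>n. \<i> * of_int n)"

lemma ddx_times: "ddx (p * q) = ddx p * q + p * ddx q"
proof (rule poly_mapping_eqI)
  fix n
  have A: "finite (keys p)" "keys p \<subseteq> keys p" "keys (ddx p) \<subseteq> keys p"
    using keys_mult_op by auto
  show "lookup (ddx (p * q)) n = lookup (ddx p * q + p * ddx q) n"
    by (simp add: lookup_add lookup_times[OF A(1,2)] lookup_times[OF A(1,3)] sum_distrib_left
        flip: sum.distrib) (auto intro!: sum.cong simp: algebra_simps)
qed

text \<open>The zero mode of a product pairs opposite frequencies, so the reflection of the
  summation index moves an odd multiplier to the other factor at the cost of a sign. This is
  integration against a skew operator.\<close>

lemma skew_pairing:
  assumes odd: "\<And>n. g (- n) = - g n"
  shows "lookup (p * mult_op g q) 0 = - lookup (q * mult_op g p) 0"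
proof -
  \<comment> \<open>Symmetric under negation, so that the reflection is a bijection of the index
    set.\<close>
  let ?K = "keys p \<union> uminus ` keys p \<union> keys q \<union> uminus ` keys q"
  have K: "finite ?K" "keys p \<subseteq> ?K" "keys q \<subseteq> ?K" by auto
  have "(\<Sum>a\<in>?K. lookup p a * (g (- a) * lookup q (- a))) = (\<Sum>a\<in>?K. lookup p (- a) * (g a * lookup q a))"
    by (rule sum.reindex_bij_witness[of _ uminus uminus]) (auto simp: image_iff)
  also have "\<dots> = - (\<Sum>a\<in>?K. lookup q a * (g (- a) * lookup p (- a)))"
    by (auto simp: odd sum_negf[symmetric] intro!: sum.cong)
  finally show ?thesis by (simp only: lookup_times[OF K(1,2)] lookup_times[OF K(1,3)] lookup_mult_op diff_0)
qed

text \<open>The hypothesis is \<open>coth a * coth b + 1 = coth (a + b) * (coth a + coth b)\<close>, multiplied out so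
  that it makes sense at vanishing frequencies.\<close>

lemma cotlar:
  fixes l g :: "int \<Rightarrow> complex" and \<iota> :: complex
  assumes add: "\<And>a b. l a * l b * (of_int a + of_int b) =
      l (a + b) * (of_int a * (of_int b * g b) + of_int b * (of_int a * g a) + \<iota> * (of_int a + of_int b))"
  shows "ddx (mult_op l p * mult_op l q) =
    mult_op l (ddx p * mult_op (\<lambda>n. - \<i> * g n) (ddx q) + mult_op (\<lambda>n. - \<i> * g n) (ddx p) * ddx q
       + cst \<iota> * ddx (p * q))"
proof (rule poly_mapping_eqI)
  fix n
  have A: "finite (keys p)" "keys p \<subseteq> keys p" "keys (mult_op l p) \<subseteq> keys p" "keys (ddx p) \<subseteq> keys p"
    "keys (mult_op (\<lambda>n. - \<i> * g n) (ddx p)) \<subseteq> keys p"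
    using keys_mult_op by (auto dest: keys_mult_op[THEN subsetD])
  have eq: "\<i> * of_int n * (l a * x * (l (n - a) * y)) =
     l n * (\<i> * of_int a * x * ( - \<i> * g (n - a) * (\<i> * of_int (n - a) * y))
       + (- \<i> * g a * (\<i> * of_int a * x)) * (\<i> * of_int (n - a) * y)
       + \<iota> * (\<i> * of_int n * (x * y)))" for a x y
  proof -
    have "\<i> * of_int n * (l a * x * (l (n - a) * y)) = \<i> * x * y * (l a * l (n - a) * (of_int a + of_int (n - a)))"
      by (simp add: algebra_simps)
    also have "\<dots> = \<i> * x * y * (l n * (of_int a * (of_int (n - a) * g (n - a)) +
        of_int (n - a) * (of_int a * g a) + \<iota> * of_int n))"
      using add[of a "n - a"] by simp
    also have "\<dots> = l n * (\<i> * of_int a * x * ( - \<i> * g (n - a) * (\<i> * of_int (n - a) * y))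
       + (- \<i> * g a * (\<i> * of_int a * x)) * (\<i> * of_int (n - a) * y)
       + \<iota> * (\<i> * of_int n * (x * y)))"
      by (simp add: algebra_simps)
    finally show ?thesis .
  qed
  show "lookup (ddx (mult_op l p * mult_op l q)) n = lookup (mult_op l (ddx p * mult_op (\<lambda>n. - \<i> * g n) (ddx q) + mult_op (\<lambda>n. - \<i> * g n) (ddx p) * ddx q
       + cst \<iota> * ddx (p * q))) n"
    by (simp only: lookup_mult_op lookup_add lookup_times[OF A(1,2)] lookup_times[OF A(1,3)]
      lookup_times[OF A(1,4)] lookup_times[OF A(1,5)] lookup_cst_times
      sum_distrib_left eq flip: sum.distrib)
qed

subsection \<open>The generating function and the modified equation\<close>

text \<open>The argument \<open>l\<close> is the symbol of \<open>L\<^sub>0\<close>.\<close>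

function chiL :: "(int \<Rightarrow> complex) \<Rightarrow> laurent \<Rightarrow> nat \<Rightarrow> laurent" where
  "chiL l p n =
     (if n = 0 then 0
      else if n = 1 then 2 * p
      else - (\<Sum>j=2..n. cst (1 / fact j) * (\<Sum>ns\<in>compositions n j. \<Prod>m\<leftarrow>ns. chiL l p m))
           - mult_op l (chiL l p (n - 1)))"
  by pat_completeness auto
termination
  by (relation "Wellfounded.measure (\<lambda>(l, p, n). n)") (auto intro: compositions_less)

declare chiL.simps [simp del]

lemma chiL_0 [simp]: "chiL l p 0 = 0" and chiL_1 [simp]: "chiL l p (Suc 0) = 2 * p"
  by (simp_all add: chiL.simps)

section \<open>Sums over compositions as coefficients of powers\<close>

lemma compositions_0: "compositions n 0 = (if n = 0 then {[]} else {})"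
  by (auto simp: compositions_def)

lemma compositions_Suc:
  "compositions n (Suc j) = (\<lambda>(m, ns). m # ns) ` (SIGMA m:{1..n}. compositions (n - m) j)"
proof -
  have "ns \<in> (\<lambda>(m, ns). m # ns) ` (SIGMA m:{1..n}. compositions (n - m) j)"
    if "ns \<in> compositions n (Suc j)" for ns
  proof -
    from that obtain m ms where "ns = m # ms" "m \<ge> 1" "\<forall>i\<in>set ms. 1 \<le> i" "length ms = j" "m + sum_list ms = n"
      by (cases ns) (auto simp: compositions_def)
    then show ?thesis
      by (intro image_eqI[of _ _ "(m, ms)"]) (auto simp: compositions_def)
  qed
  then show ?thesis by (auto simp: compositions_def)
qed

lemma finite_compositions: "finite (compositions n j)"
  by (induction j arbitrary: n) (auto simp: compositions_0 compositions_Suc)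

lemma sum_compositions_Suc:
  "(\<Sum>ns\<in>compositions n (Suc j). f ns) = (\<Sum>m=1..n. \<Sum>ns\<in>compositions (n - m) j. f (m # ns))"
  by (subst compositions_Suc, subst sum.reindex)
    (auto simp: inj_on_def sum.Sigma[symmetric] finite_compositions sum.Sigma case_prod_unfold)

text \<open>Expanding the product picks one index per factor; the missing constant term rules out
  index 0, which leaves exactly the compositions. It turns the combinatorial recursion for \<chi>
  into an identity of power series.\<close>

lemma fps_power_compositions:
  fixes F :: "'a :: comm_ring_1 fps"
  assumes "fps_nth F 0 = 0"
  shows "fps_nth (F ^ j) n = (\<Sum>ns\<in>compositions n j. \<Prod>m\<leftarrow>ns. fps_nth F m)"
proof (induction j arbitrary: n)
  case 0
  then show ?case by (simp add: compositions_0)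
next
  case (Suc j)
  have "fps_nth (F ^ Suc j) n = (\<Sum>m=0..n. fps_nth F m * fps_nth (F ^ j) (n - m))"
    by (simp add: fps_mult_nth)
  also have "\<dots> = (\<Sum>m=1..n. fps_nth F m * fps_nth (F ^ j) (n - m))"
    by (rule sum.mono_neutral_right) (auto simp: assms Suc_le_eq)
  also have "\<dots> = (\<Sum>ns\<in>compositions n (Suc j). \<Prod>m\<leftarrow>ns. fps_nth F m)"
    by (simp add: sum_compositions_Suc Suc sum_distrib_left)
  finally show ?case .
qed

section \<open>Power series over Laurent polynomials and their exponential\<close>

type_synonym lfps = "laurent fps"

definition lift :: "(laurent \<Rightarrow> laurent) \<Rightarrow> lfps \<Rightarrow> lfps" where
  "lift T F = Abs_fps (\<lambda>n. T (fps_nth F n))"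

lemma lift_nth [simp]: "fps_nth (lift T F) n = T (fps_nth F n)"
  by (simp add: lift_def)

abbreviation fcst :: "complex \<Rightarrow> lfps" where "fcst c \<equiv> fps_const (cst c)"

lemma fcst_nth [simp]: "fps_nth (fcst c * F) n = cst c * fps_nth F n"
  by simp

lemma lift_mult_op:
  "lift (mult_op m) (F + H) = lift (mult_op m) F + lift (mult_op m) H"
  "lift (mult_op m) (F - H) = lift (mult_op m) F - lift (mult_op m) H"
  "lift (mult_op m) (fcst c * F) = fcst c * lift (mult_op m) F"
  "lift (mult_op m) (fps_X * F) = fps_X * lift (mult_op m) F"
  by (auto simp: fps_eq_iff mult_op_add mult_op_diff mult_op_cst fps_X_mult_nth intro!: poly_mapping_eqI)

lemma lift_commute: "lift (mult_op m) (lift (mult_op m') F) = lift (mult_op m') (lift (mult_op m) F)"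
  by (auto simp: fps_eq_iff intro!: poly_mapping_eqI)

lemma lift_const: "lift (mult_op m) (fps_const p) = fps_const (mult_op m p)"
  by (auto simp: fps_eq_iff)

lemma lift_ddx_times: "lift ddx (F * H) = lift ddx F * H + F * lift ddx H"
  by (simp add: fps_eq_iff fps_mult_nth mult_op_sum ddx_times sum.distrib)

lemma lift_ddx_power: "lift ddx (F ^ j) = of_nat j * F ^ (j - 1) * lift ddx F"
proof (induction j)
  case 0
  have "lift ddx 1 = 0"
    by (auto simp: fps_eq_iff fps_one_nth lookup_one when_def intro!: poly_mapping_eqI)
  then show ?case by simp
next
  case (Suc j)
  then show ?case by (cases j) (simp_all add: lift_ddx_times algebra_simps)
qed

text \<open>The exponential series for F without constant term: there F^j starts at order j, so the
  summation over j may stop at n.\<close>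

definition fexp :: "lfps \<Rightarrow> lfps" where
  "fexp F = Abs_fps (\<lambda>n. \<Sum>j=0..n. cst (1 / fact j) * fps_nth (F ^ j) n)"

text \<open>The chain rule for the exponential, with H in the role of the derivative of F. Keeping H
  arbitrary serves both derivations in use, the one in space and the one in time.\<close>

lemma fexp_derivation:
  assumes F: "fps_nth F 0 = 0" and H: "fps_nth H 0 = 0"
  shows "(\<Sum>j=0..n. cst (1 / fact j) * fps_nth (of_nat j * F ^ (j - 1) * H) n) = fps_nth (fexp F * H) n"
proof -
  have cst_fact: "cst (1 / fact (Suc j)) * (of_nat (Suc j) * q) = cst (1 / fact j) * q" for j q
  proof -
    have "of_nat (Suc j) = cst (of_nat (Suc j))"
      by (rule single_of_nat[symmetric])
    then have "cst (1 / fact (Suc j)) * (of_nat (Suc j) * q) = cst (1 / fact (Suc j) * of_nat (Suc j)) * q"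
      by (metis (no_types) add_0 mult.assoc mult_single)
    also have "1 / fact (Suc j) * of_nat (Suc j) = (1 / fact j :: complex)"
      by (simp add: field_simps del: of_nat_Suc)
    finally show ?thesis .
  qed
  have "(\<Sum>j=0..n. cst (1 / fact j) * fps_nth (of_nat j * F ^ (j - 1) * H) n)
      = (\<Sum>j<n. cst (1 / fact j) * fps_nth (F ^ j * H) n)"
  proof (cases n)
    case 0
    then show ?thesis by simp
  next
    case (Suc n')
    have nth: "fps_nth (of_nat (Suc j) * F ^ j * H) n = of_nat (Suc j) * fps_nth (F ^ j * H) n" for j
      by (metis fps_mult_left_const_nth fps_of_nat mult.assoc)
    have "(\<Sum>j=0..n. cst (1 / fact j) * fps_nth (of_nat j * F ^ (j - 1) * H) n)
      = (\<Sum>j=0..n'. cst (1 / fact (Suc j)) * fps_nth (of_nat (Suc j) * F ^ j * H) n)"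
      unfolding Suc by (subst sum.atLeast0_atMost_Suc_shift) (simp del: of_nat_Suc fact_Suc)
    then show ?thesis
      unfolding nth cst_fact by (simp add: Suc lessThan_Suc_atMost atMost_atLeast0)
  qed
  also have "\<dots> = (\<Sum>j<n. \<Sum>i=0..n. cst (1 / fact j) * (fps_nth (F ^ j) i * fps_nth H (n - i)))"
    by (simp add: fps_mult_nth sum_distrib_left)
  also have "\<dots> = (\<Sum>i=0..n. \<Sum>j<n. cst (1 / fact j) * (fps_nth (F ^ j) i * fps_nth H (n - i)))"
    by (rule sum.swap)
  also have "\<dots> = (\<Sum>i=0..n. (\<Sum>j=0..i. cst (1 / fact j) * fps_nth (F ^ j) i) * fps_nth H (n - i))"
  proof (rule sum.cong[OF refl])
    fix i assume i: "i \<in> {0..n}"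
    show "(\<Sum>j<n. cst (1 / fact j) * (fps_nth (F ^ j) i * fps_nth H (n - i))) =
       (\<Sum>j=0..i. cst (1 / fact j) * fps_nth (F ^ j) i) * fps_nth H (n - i)"
    \<comment> \<open>For i = n the left side lacks the summand j = n, but the common factor is then
      the constant term of H, which vanishes.\<close>
    proof (cases "i = n")
      case True
      then show ?thesis by (simp add: H)
    next
      case False
      have *: "(\<Sum>j<n. cst (1 / fact j) * fps_nth (F ^ j) i) = (\<Sum>j=0..i. cst (1 / fact j) * fps_nth (F ^ j) i)"
        by (rule sum.mono_neutral_right)
          (use i False startsby_zero_power_prefix[OF F] in auto)
      then show ?thesis by (simp add: sum_distrib_right mult.assoc flip: *)
    qed
  qed
  also have "\<dots> = fps_nth (fexp F * H) n"
    by (simp add: fps_mult_nth fexp_def)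
  finally show ?thesis .
qed

lemma lift_ddx_fexp:
  assumes "fps_nth F 0 = 0"
  shows "lift ddx (fexp F) = fexp F * lift ddx F"
proof (rule fps_ext)
  fix n
  have "fps_nth (lift ddx (fexp F)) n = (\<Sum>j=0..n. cst (1 / fact j) * fps_nth (lift ddx (F ^ j)) n)"
    by (simp add: fexp_def mult_op_sum mult_op_cst)
  then show "fps_nth (lift ddx (fexp F)) n = fps_nth (fexp F * lift ddx F) n"
    using fexp_derivation[OF assms, of "lift ddx F" n] assms by (simp add: lift_ddx_power)
qed

section \<open>The Baecklund relation and the identity of Cotlar type\<close>

definition X_ser :: "(int \<Rightarrow> complex) \<Rightarrow> laurent \<Rightarrow> lfps" where
  "X_ser l p = Abs_fps (chiL l p)"

lemma X_ser_nth [simp]: "fps_nth (X_ser l p) = chiL l p"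
  by (simp add: X_ser_def fun_eq_iff)

text \<open>\<open>S_ser\<close> is \<open>(e\<^sup>\<chi> - 1) / \<epsilon>\<close>.\<close>

definition S_ser :: "(int \<Rightarrow> complex) \<Rightarrow> laurent \<Rightarrow> lfps" where
  "S_ser l p = Abs_fps (\<lambda>n. fps_nth (fexp (X_ser l p)) (Suc n))"

lemma fexp_X_ser: "fexp (X_ser l p) = 1 + fps_X * S_ser l p"
proof (rule fps_ext)
  fix n show "fps_nth (fexp (X_ser l p)) n = fps_nth (1 + fps_X * S_ser l p) n"
    by (cases n) (simp_all add: fexp_def S_ser_def fps_X_mult_nth)
qed

lemma fexp_X_ser_nth:
  "fps_nth (fexp (X_ser l p)) (Suc n) = chiL l p (Suc n) +
     (\<Sum>j=2..Suc n. cst (1 / fact j) * fps_nth (X_ser l p ^ j) (Suc n))"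
proof -
  have "{0..Suc n} = insert 0 (insert 1 {2..Suc n})" by auto
  then have "fps_nth (fexp (X_ser l p)) (Suc n) = (\<Sum>j\<in>insert 0 (insert 1 {2..Suc n}). cst (1 / fact j) * fps_nth (X_ser l p ^ j) (Suc n))"
    by (simp add: fexp_def)
  then show ?thesis by simp
qed

text \<open>Coefficient n is the recursion for \<chi> at index n + 1: the summand j = 1 of the
  exponential is \<chi> itself, those with j \<ge> 2 are the composition sums.\<close>

lemma S_ser_eq: "S_ser l p + lift (mult_op l) (X_ser l p) = fps_const (2 * p)"
proof (rule fps_ext)
  fix n
  have pow: "fps_nth (X_ser l p ^ j) n = (\<Sum>ns\<in>compositions n j. \<Prod>m\<leftarrow>ns. chiL l p m)" for j n
    by (subst fps_power_compositions) simp_all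
  show "fps_nth (S_ser l p + lift (mult_op l) (X_ser l p)) n = fps_nth (fps_const (2 * p)) n"
    by (cases n) (simp_all add: S_ser_def fexp_X_ser_nth pow chiL.simps[of l p "Suc (Suc _)"])
qed

text \<open>The diagonal case of the bilinear identity \<open>cotlar\<close>. There every term
  occurs twice, and the factor 2 cancels because 1/2 is among the coefficients.\<close>

lemma lift_cotlar:
  fixes l g :: "int \<Rightarrow> complex" and \<iota> :: complex
  assumes add: "\<And>a b. l a * l b * (of_int a + of_int b) =
      l (a + b) * (of_int a * (of_int b * g b) + of_int b * (of_int a * g a) + \<iota> * (of_int a + of_int b))"
  defines "D \<equiv> lift ddx" and "L \<equiv> lift (mult_op l)" and "Gf \<equiv> lift (mult_op (\<lambda>n. - \<i> * g n))"
  shows "L F * L (D F) = L (D F * Gf (D F)) + fcst \<iota> * L (F * D F)"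
proof -
  have half: "H = fcst (1/2) * (H + H)" for H :: lfps
    by (rule fps_ext, rule poly_mapping_eqI) (simp add: lookup_add)
  have cancel: "H = K" if "H + H = K + K" for H K :: lfps
    by (subst half, subst that, rule half[symmetric])
  have polar: "D (L F * L H) = L (D F * Gf (D H) + Gf (D F) * D H + fcst \<iota> * D (F * H))" for F H
  proof (rule fps_ext)
    fix n
    let ?f = "\<lambda>i. fps_nth F i" and ?h = "\<lambda>i. fps_nth H (n - i)"
    let ?g = "mult_op (\<lambda>n. - \<i> * g n)"
    have "fps_nth (D (L F * L H)) n = (\<Sum>i=0..n. ddx (mult_op l (?f i) * mult_op l (?h i)))"
      unfolding D_def L_def by (simp only: lift_nth fps_mult_nth mult_op_sum)
    also have "\<dots> = (\<Sum>i=0..n. mult_op l (ddx (?f i) * ?g (ddx (?h i)) + ?g (ddx (?f i)) * ddx (?h i)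
       + cst \<iota> * ddx (?f i * ?h i)))"
      by (simp only: cotlar[OF add])
    also have "\<dots> = fps_nth (L (D F * Gf (D H) + Gf (D F) * D H + fcst \<iota> * D (F * H))) n"
      unfolding D_def L_def Gf_def lift_nth fps_add_nth fcst_nth unfolding lift_nth fps_mult_nth mult_op_sum[symmetric]
        sum.distrib sum_distrib_left[symmetric] ..
    finally show "fps_nth (D (L F * L H)) n = fps_nth (L (D F * Gf (D H) + Gf (D F) * D H + fcst \<iota> * D (F * H))) n" .
  qed
  have DL: "D (L F) = L (D F)"
    unfolding D_def L_def by (rule lift_commute)
  have "L F * L (D F) + L F * L (D F) = D (L F * L F)"
    unfolding DL[symmetric] unfolding D_def lift_ddx_times by (simp only: mult.commute)
  also have "\<dots> = L (D F * Gf (D F) + Gf (D F) * D F + fcst \<iota> * D (F * F))"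
    by (rule polar)
  also have "\<dots> = L (D F * Gf (D F)) + L (D F * Gf (D F)) + fcst \<iota> * (L (F * D F) + L (F * D F))"
  proof -
    have "D (F * F) = F * D F + F * D F"
      unfolding D_def by (simp only: lift_ddx_times mult.commute)
    then show ?thesis
      unfolding L_def by (simp only: lift_mult_op mult.commute[of "Gf (D F)" "D F"])
  qed
  also have "\<dots> = (L (D F * Gf (D F)) + fcst \<iota> * L (F * D F)) + (L (D F * Gf (D F)) + fcst \<iota> * L (F * D F))"
    by (simp only: distrib_left add.assoc add.left_commute)
  finally show ?thesis
    by (rule cancel)
qed

text \<open>The commutative algebra behind \<open>R_ser_eq\<close>: every application of an operator
  is frozen into a letter, and what the operators satisfy enters as hypotheses. Here e is
  \<epsilon>, w is the derivative of X, \<open>1\<close> is the differentiated relation exp X = 1 +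
  e S, \<open>2\<close> its further derivative, \<open>3\<close> its image under L, and
  \<open>cot\<close> the identity of Cotlar type.\<close>

lemma modified_identity:
  fixes e :: "'a :: comm_ring_1"
  assumes 1: "e * DS = w + e * (S * w)"
    and 2: "e * DDS = Dw + e * (DS * w + S * Dw)"
    and LX: "LX = Gw - c * w + \<iota> * X"
    and Lw: "Lw = GDw - c * Dw + \<iota> * w"
    and LDS: "LDS = GDDS - c * DDS + \<iota> * DS"
    and 3: "e * LSw = e * LDS - Lw"
    and cot: "LX * Lw = LwGw + \<iota> * LXw"
  shows "(1 + e * S) * (GDw + w * Gw + S * w + \<iota> * (X * w)) + e * (GDLw + LwGw + LSw + \<iota> * LXw) =
    e * (GDDS + GDLw + (S + LX) * (DS + Lw))"
proof -
  have "(1 + e * S) * (GDw + w * Gw + S * w + \<iota> * (X * w)) + e * (GDLw + LwGw + LSw + \<iota> * LXw)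
    = (1 + e * S) * (GDw + w * Gw + S * w + \<iota> * (X * w)) + e * GDLw + e * (LwGw + \<iota> * LXw) + e * LSw"
    by (simp add: algebra_simps)
  also have "\<dots> = (1 + e * S) * (GDw + w * Gw + S * w + \<iota> * (X * w)) + e * GDLw + e * (LX * Lw) + (e * LDS - Lw)"
    unfolding 3 cot ..
  \<comment> \<open>The two sides agree up to multiples of the relations \<open>1\<close> and
    \<open>2\<close>; with the multiples written out, the step is an identity of
    polynomials.\<close>
  also have "\<dots> = e * (GDDS + GDLw + (S + LX) * (DS + Lw))
     - (Gw + S + \<iota> * X - \<iota>) * (e * DS - (w + e * (S * w))) - c * (e * DDS - (Dw + e * (DS * w + S * Dw)))"
    unfolding LX Lw LDS by (simp add: algebra_simps)
  finally show ?thesis unfolding 1 2 by simp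
qed

definition ilw_rhs :: "(int \<Rightarrow> complex) \<Rightarrow> laurent \<Rightarrow> laurent" where
  "ilw_rhs g p = mult_op (\<lambda>n. - \<i> * g n) (ddx (ddx p)) + 2 * p * ddx p"

text \<open>The right-hand side of the modified equation.\<close>

definition R_ser :: "(int \<Rightarrow> complex) \<Rightarrow> complex \<Rightarrow> lfps \<Rightarrow> lfps \<Rightarrow> lfps" where
  "R_ser g \<iota> X S = (let w = lift ddx X; Gf = lift (mult_op (\<lambda>n. - \<i> * g n)) in
     Gf (lift ddx w) + w * Gf w + S * w + fcst \<iota> * (X * w))"

text \<open>The linearised Baecklund transform maps the modified flow to the ILW flow.\<close>

lemma R_ser_eq:
  fixes l g :: "int \<Rightarrow> complex" and \<iota> :: complex and p :: laurent
  assumes add: "\<And>a b. l a * l b * (of_int a + of_int b) =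
      l (a + b) * (of_int a * (of_int b * g b) + of_int b * (of_int a * g a) + \<iota> * (of_int a + of_int b))"
    and l: "\<And>n. l n = of_int n * g n + of_int n + \<iota>"
  defines "L \<equiv> lift (mult_op l)"
  defines "X \<equiv> X_ser l p"
  defines "R \<equiv> R_ser g \<iota> X (S_ser l p)"
  shows "fexp X * R + fps_X * L R = fps_X * fps_const (2 * ilw_rhs g p)"
proof -
  define D where "D = lift ddx"
  define Gf where "Gf = lift (mult_op (\<lambda>n. - \<i> * g n))"
  define S where "S = S_ser l p"
  define w where "w = D X"
  have R: "R = Gf (D w) + w * Gf w + S * w + fcst \<iota> * (X * w)"
    unfolding R_def R_ser_def Let_def Gf_def D_def w_def S_def ..
  note lin = lift_mult_op
  \<comment> \<open>The summand \<open>of_int n\<close> of the symbol is \<open>- \<i>\<close> times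
    the symbol of the derivative; this is the letter c of \<open>modified_identity\<close>.\<close>
  have L: "L F = Gf (D F) - fcst \<i> * D F + fcst \<iota> * F" for F
  proof (rule fps_ext, rule poly_mapping_eqI)
    fix n k
    show "lookup (fps_nth (L F) n) k = lookup (fps_nth (Gf (D F) - fcst \<i> * D F + fcst \<iota> * F) n) k"
      unfolding L_def Gf_def D_def
      by (simp add: lookup_add lookup_minus l algebra_simps)
  qed
  have E: "fexp X = 1 + fps_X * S"
    unfolding X_def S_def by (rule fexp_X_ser)
  have X0: "fps_nth X 0 = 0" by (simp add: X_def)
  have DE: "fps_X * D S = w + fps_X * (S * w)"
  proof -
    have "D (fexp X) = fexp X * w"
      unfolding D_def w_def using lift_ddx_fexp[OF X0] .
    moreover have "D 1 = 0"
      unfolding D_def by (auto simp: fps_eq_iff fps_one_nth lookup_one when_def intro!: poly_mapping_eqI)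
    ultimately show ?thesis
      by (simp add: E D_def lin algebra_simps)
  qed
  have DDE: "fps_X * D (D S) = D w + fps_X * (D S * w + S * D w)"
    using arg_cong[OF DE, of D] unfolding D_def lin by (simp only: lift_ddx_times)
  have LSw: "fps_X * L (S * w) = fps_X * L (D S) - L w"
    using arg_cong[OF DE, of L] by (simp add: L_def lin algebra_simps)
  have cot: "L X * L w = L (w * Gf w) + fcst \<iota> * L (X * w)"
    unfolding L_def D_def Gf_def w_def using lift_cotlar[OF add] .
  have LR: "L R = Gf (D (L w)) + L (w * Gf w) + L (S * w) + fcst \<iota> * L (X * w)"
  proof -
    have "L (Gf (D w)) = Gf (D (L w))"
      unfolding L_def Gf_def D_def by (simp only: lift_commute[of l])
    then show ?thesis unfolding R by (simp add: L_def lin)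
  qed
  have SL: "S + L X = fps_const (2 * p)"
    unfolding S_def L_def X_def by (rule S_ser_eq)
  have DSL: "D S + L w = fps_const (ddx (2 * p))"
    using arg_cong[OF SL, of D] by (simp add: D_def L_def w_def lin lift_const lift_commute[of _ l])
  have GSL: "Gf (D (D S)) + Gf (D (L w)) = fps_const (mult_op (\<lambda>n. - \<i> * g n) (ddx (ddx (2 * p))))"
    using arg_cong[OF DSL, of "\<lambda>F. Gf (D F)"] by (simp add: D_def Gf_def lin lift_const)
  have two: "mult_op m (2 * q) = 2 * mult_op m q" for m q
    by (subst (1 2) mult_2) (rule mult_op_add)
  \<comment> \<open>In terms of v = 2 p, twice the right-hand side of ILW is G v_xx + v v_x, and v =
    S + L X by the Baecklund relation.\<close>
  have H: "fps_const (2 * ilw_rhs g p) = Gf (D (D S)) + Gf (D (L w)) + (S + L X) * (D S + L w)"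
    unfolding SL DSL GSL unfolding two ilw_rhs_def by (simp add: algebra_simps)
  define e where "e = (fps_X :: lfps)"
  have 1: "e * D S = w + e * (S * w)" and 2: "e * D (D S) = D w + e * (D S * w + S * D w)"
    and 3: "e * L (S * w) = e * L (D S) - L w" using DE DDE LSw by (simp_all add: e_def)
  show ?thesis
    unfolding E H LR unfolding R e_def[symmetric]
    by (rule modified_identity[OF 1 2 L[of X, folded w_def] L[of w] L[of "D S"] 3 cot])
qed

text \<open>Term by term: the first is a derivative; S w is one by differentiating exp X = 1 +
  \<epsilon> S and comparing coefficients at order n + 1; X w is half the derivative of X^2; and w G
  w has mean zero by skewness.\<close>

lemma R_ser_lookup_0:
  fixes l g :: "int \<Rightarrow> complex" and \<iota> :: complex and p :: laurent
  assumes odd: "\<And>n. g (- n) = - g n"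
  shows "lookup (fps_nth (R_ser g \<iota> (X_ser l p) (S_ser l p)) n) 0 = 0"
proof -
  define X where "X = X_ser l p"
  define S where "S = S_ser l p"
  define w where "w = lift ddx X"
  define T where "T = mult_op (\<lambda>n. - \<i> * g n)"
  have X0: "fps_nth X 0 = 0" by (simp add: X_def)
  have "lift ddx (1 + fps_X * S) = (1 + fps_X * S) * w"
    using lift_ddx_fexp[OF X0] unfolding X_def w_def S_def fexp_X_ser .
  moreover have "lift ddx 1 = 0"
    by (auto simp: fps_eq_iff fps_one_nth lookup_one when_def intro!: poly_mapping_eqI)
  ultimately have "fps_X * (S * w) = fps_X * lift ddx S - w"
    by (simp add: lift_mult_op algebra_simps)
  from arg_cong[OF this, of "\<lambda>F. fps_nth F (Suc n)"]
  have "fps_nth (S * w) n = ddx (fps_nth S n - fps_nth X (Suc n))"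
    by (simp add: w_def mult_op_diff fps_X_mult_nth)
  then have 1: "lookup (fps_nth (S * w) n) 0 = 0" by simp
  have "lift ddx (X * X) = 2 * (X * w)"
    unfolding mult_2 by (simp only: lift_ddx_times w_def mult.commute)
  moreover have "fps_nth (2 * (X * w)) n = 2 * fps_nth (X * w) n"
    unfolding mult_2 by simp
  ultimately have "2 * fps_nth (X * w) n = ddx (fps_nth (X * X) n)"
    by (metis lift_nth)
  then have "lookup (2 * fps_nth (X * w) n) 0 = lookup (ddx (fps_nth (X * X) n)) 0"
    by (rule arg_cong)
  then have 2: "lookup (fps_nth (X * w) n) 0 = 0" by simp
  have "lookup (fps_nth (w * lift T w) n) 0 = (\<Sum>i=0..n. lookup (fps_nth w i * T (fps_nth w (n - i))) 0)"
    by (simp add: fps_mult_nth lookup_sum)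
  \<comment> \<open>Skewness exchanges the indices i and n - i, so the sum over all i equals its own
    negative.\<close>
  also have "\<dots> = (\<Sum>i=0..n. - lookup (fps_nth w (n - i) * T (fps_nth w i)) 0)"
    unfolding T_def by (rule sum.cong[OF refl], rule skew_pairing) (simp add: odd)
  also have "\<dots> = - (\<Sum>i=0..n. lookup (fps_nth w (n - i) * T (fps_nth w i)) 0)"
    by (rule sum_negf)
  also have "(\<Sum>i=0..n. lookup (fps_nth w (n - i) * T (fps_nth w i)) 0)
      = (\<Sum>i=0..n. lookup (fps_nth w i * T (fps_nth w (n - i))) 0)"
    by (rule sum.reindex_bij_witness[of _ "\<lambda>i. n - i" "\<lambda>i. n - i"]) auto
  also have "\<dots> = lookup (fps_nth (w * lift T w) n) 0"
    by (simp add: fps_mult_nth lookup_sum)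
  finally have 3: "lookup (fps_nth (w * lift T w) n) 0 = 0" by simp
  show ?thesis
    using 1 2 3 unfolding R_ser_def Let_def X_def[symmetric] S_def[symmetric] w_def[symmetric] T_def[symmetric]
    by (simp add: lookup_add T_def)
qed

subsection \<open>Conservation along curves of trigonometric polynomials\<close>

text \<open>Differentiability of coefficients alone would not pass to products; the common finite
  support keeps every product a finite sum over a fixed index set.\<close>

definition lder :: "(real \<Rightarrow> laurent) \<Rightarrow> laurent \<Rightarrow> real \<Rightarrow> bool" where
  "lder f f' t \<longleftrightarrow> (\<exists>A. finite A \<and> (\<forall>s. keys (f s) \<subseteq> A)) \<and>
     (\<forall>n. ((\<lambda>s. lookup (f s) n) has_vector_derivative lookup f' n) (at t))"

lemma lder_unique: "lder f f' t \<Longrightarrow> lder f f'' t \<Longrightarrow> f' = f''"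
  unfolding lder_def by (metis poly_mapping_eqI vector_derivative_unique_at)

lemma lder_const: "lder (\<lambda>s. p) 0 t"
  by (auto simp: lder_def intro: finite_keys)

lemma lder_add: "lder f f' t \<Longrightarrow> lder g g' t \<Longrightarrow> lder (\<lambda>s. f s + g s) (f' + g') t"
  unfolding lder_def
proof (intro conjI allI; elim conjE exE)
  fix A B assume "finite A" "\<forall>s. keys (f s) \<subseteq> A" "finite B" "\<forall>s. keys (g s) \<subseteq> B"
  then show "\<exists>A. finite A \<and> (\<forall>s. keys (f s + g s) \<subseteq> A)"
    by (intro exI[of _ "A \<union> B"]) (use Poly_Mapping.keys_add in fastforce)
qed (auto simp: lookup_add intro: has_vector_derivative_add)

lemma lder_mult_op: "lder f f' t \<Longrightarrow> lder (\<lambda>s. mult_op m (f s)) (mult_op m f') t"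
  unfolding lder_def
proof (intro conjI allI; elim conjE exE)
  fix A assume "finite A" "\<forall>s. keys (f s) \<subseteq> A"
  then show "\<exists>A. finite A \<and> (\<forall>s. keys (mult_op m (f s)) \<subseteq> A)"
    using keys_mult_op by (intro exI[of _ A]) blast
qed (auto intro: has_vector_derivative_mult_right)

lemma lder_uminus: "lder f f' t \<Longrightarrow> lder (\<lambda>s. - f s) (- f') t"
  unfolding lder_def by (auto intro: has_vector_derivative_minus)

lemma lder_diff: "lder f f' t \<Longrightarrow> lder g g' t \<Longrightarrow> lder (\<lambda>s. f s - g s) (f' - g') t"
  using lder_add[of f f' t "\<lambda>s. - g s" "- g'"] lder_uminus[of g g' t] by simp

lemma lder_times:
  assumes f: "lder f f' t" and g: "lder g g' t"
  shows "lder (\<lambda>s. f s * g s) (f t * g' + f' * g t) t"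
proof -
  obtain A B where A: "finite A" "\<And>s. keys (f s) \<subseteq> A" and B: "finite B" "\<And>s. keys (g s) \<subseteq> B"
    using assms unfolding lder_def by metis
  \<comment> \<open>Outside A the coefficients of f vanish identically, hence so do their
    derivatives, and both products can be expanded over A.\<close>
  have f': "keys f' \<subseteq> A"
  proof
    fix n assume "n \<in> keys f'"
    show "n \<in> A"
    proof (rule ccontr)
      assume "n \<notin> A"
      then have "(\<lambda>s. lookup (f s) n) = (\<lambda>s. 0)"
        using A(2) by (metis in_keys_iff subsetD)
      then have "((\<lambda>s. 0) has_vector_derivative lookup f' n) (at t)"
        using f unfolding lder_def by metis
      then have "lookup f' n = 0"
        using vector_derivative_unique_at has_vector_derivative_const by blast
      then show False using \<open>n \<in> keys f'\<close> by (simp add: in_keys_iff)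
    qed
  qed
  have "keys (f s * g s) \<subseteq> (\<lambda>(a, c). a + c) ` (A \<times> B)" for s
    using Poly_Mapping.keys_mult[of "f s" "g s"] A(2)[of s] B(2)[of s] by force
  then have "\<exists>C. finite C \<and> (\<forall>s. keys (f s * g s) \<subseteq> C)"
    using A(1) B(1) by (intro exI[of _ "(\<lambda>(a, c). a + c) ` (A \<times> B)"]) auto
  moreover have "((\<lambda>s. lookup (f s * g s) n) has_vector_derivative lookup (f t * g' + f' * g t) n) (at t)" for n
    unfolding lookup_add lookup_times[OF A] lookup_times[OF A(1) f'] sum.distrib[symmetric]
    using f g by (auto simp: lder_def intro!: has_vector_derivative_sum has_vector_derivative_mult)
  ultimately show ?thesis by (simp add: lder_def)
qed

lemma lder_sum:
  "(\<And>i. i \<in> I \<Longrightarrow> lder (f i) (f' i) t) \<Longrightarrow> lder (\<lambda>s. \<Sum>i\<in>I. f i s) (\<Sum>i\<in>I. f' i) t"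
  by (induction I rule: infinite_finite_induct) (auto intro: lder_const lder_add)

lemma lder_cst: "lder f f' t \<Longrightarrow> lder (\<lambda>s. cst c * f s) (cst c * f') t"
  using lder_times[OF lder_const, of f f' t "cst c"] by simp

lemma ex_lder_prod_list:
  "(\<And>m. m \<in> set ms \<Longrightarrow> \<exists>f'. lder (f m) f' t) \<Longrightarrow> \<exists>f'. lder (\<lambda>s. \<Prod>m\<leftarrow>ms. f m s) f' t"
proof (induction ms)
  case Nil
  then show ?case using lder_const by auto
next
  case (Cons m ms)
  then obtain f' g' where "lder (f m) f' t" "lder (\<lambda>s. \<Prod>m\<leftarrow>ms. f m s) g' t"
    by (meson list.set_intros)
  from lder_times[OF this] show ?case by auto
qed

lemma ex_lder_sum:
  assumes "\<And>i. i \<in> I \<Longrightarrow> \<exists>f'. lder (f i) f' t"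
  shows "\<exists>f'. lder (\<lambda>s. \<Sum>i\<in>I. f i s) f' t"
proof -
  from assms obtain f' where "\<And>i. i \<in> I \<Longrightarrow> lder (f i) (f' i) t"
    by metis
  then show ?thesis using lder_sum by blast
qed

text \<open>Existence is all that the recursion has to give; the derivative is identified afterwards
  as the solution of the linearised relation.\<close>

lemma ex_lder_chiL:
  assumes p: "lder p p' t"
  shows "\<exists>y. lder (\<lambda>s. chiL l (p s) n) y t"
proof (induction n rule: less_induct)
  case (less n)
  consider "n = 0" | "n = 1" | "n \<ge> 2" by linarith
  then show ?case
  proof cases
    case 1
    then show ?thesis using lder_const by auto
  next
    case 2
    have "lder (\<lambda>s. 2 * p s) (2 * p') t"
      using lder_add[OF p p] by (simp only: mult_2)
    then show ?thesis using 2 by auto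
  next
    case 3
    have A: "\<exists>y. lder (\<lambda>s. \<Sum>j=2..n. cst (1 / fact j) * (\<Sum>ns\<in>compositions n j. \<Prod>m\<leftarrow>ns. chiL l (p s) m)) y t"
    proof (rule ex_lder_sum)
      fix j assume j: "j \<in> {2..n}"
      have "\<exists>y. lder (\<lambda>s. \<Sum>ns\<in>compositions n j. \<Prod>m\<leftarrow>ns. chiL l (p s) m) y t"
        by (intro ex_lder_sum ex_lder_prod_list less) (use j compositions_less in auto)
      then show "\<exists>y. lder (\<lambda>s. cst (1 / fact j) * (\<Sum>ns\<in>compositions n j. \<Prod>m\<leftarrow>ns. chiL l (p s) m)) y t"
        using lder_cst by blast
    qed
    obtain y where "lder (\<lambda>s. chiL l (p s) (n - 1)) y t"
      using less[of "n - 1"] 3 by auto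
    then have B: "\<exists>y. lder (\<lambda>s. mult_op l (chiL l (p s) (n - 1))) y t"
      using lder_mult_op by blast
    from A obtain y where y: "lder (\<lambda>s. \<Sum>j=2..n. cst (1 / fact j) * (\<Sum>ns\<in>compositions n j. \<Prod>m\<leftarrow>ns. chiL l (p s) m)) y t" ..
    from B obtain z where z: "lder (\<lambda>s. mult_op l (chiL l (p s) (n - 1))) z t" ..
    from lder_diff[OF lder_uminus[OF y] z] show ?thesis
      using 3 by (subst chiL.simps) auto
  qed
qed

section \<open>Linearisation of the Baecklund relation\<close>

definition flder :: "(real \<Rightarrow> lfps) \<Rightarrow> lfps \<Rightarrow> real \<Rightarrow> bool" where
  "flder F H t \<longleftrightarrow> (\<forall>n. lder (\<lambda>s. fps_nth (F s) n) (fps_nth H n) t)"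

lemma flder_times: "flder F F' t \<Longrightarrow> flder H H' t \<Longrightarrow> flder (\<lambda>s. F s * H s) (F t * H' + F' * H t) t"
  unfolding flder_def fps_mult_nth fps_add_nth sum.distrib[symmetric]
  by (auto intro!: lder_sum lder_times)

lemma flder_power: "flder F F' t \<Longrightarrow> flder (\<lambda>s. F s ^ j) (of_nat j * F t ^ (j - 1) * F') t"
proof (induction j)
  case 0
  then show ?case by (simp add: flder_def lder_const)
next
  case (Suc j)
  then have "flder (\<lambda>s. F s * F s ^ j) (F t * (of_nat j * F t ^ (j - 1) * F') + F' * F t ^ j) t"
    by (intro flder_times)
  also have "F t * (of_nat j * F t ^ (j - 1) * F') + F' * F t ^ j = of_nat (Suc j) * F t ^ (Suc j - 1) * F'"
    by (cases j) (simp_all add: algebra_simps)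
  finally show ?case by simp
qed

text \<open>The operator is the identity plus terms that raise the order in \<epsilon>, so each
  coefficient is determined by the earlier ones. No invertibility of the multiplier l is
  involved.\<close>

lemma linearized_unique:
  assumes E: "fps_nth E 0 = 1" and Y: "E * Y + fps_X * lift (mult_op l) Y = 0"
  shows "Y = 0"
proof -
  have "fps_nth Y n = 0" for n
  proof (induction n rule: less_induct)
    case (less n)
    have "(\<Sum>i=0..n. fps_nth E i * fps_nth Y (n - i)) = (\<Sum>i\<in>{0}. fps_nth E i * fps_nth Y (n - i))"
      by (rule sum.mono_neutral_right) (auto simp: less)
    then have "fps_nth (E * Y) n = fps_nth Y n"
      by (simp add: fps_mult_nth E)
    moreover have "fps_nth (E * Y + fps_X * lift (mult_op l) Y) n = 0"
      using Y by simp
    ultimately show ?case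
      using less[of "n - 1"] by (cases n) auto
  qed
  then show ?thesis by (simp add: fps_eq_iff)
qed

text \<open>Differentiate exp X - 1 + \<epsilon> L X = 2 \<epsilon> p along the curve.\<close>

lemma linearized_X_ser:
  assumes p: "lder p p' t"
  obtains Y where "\<And>n. lder (\<lambda>s. chiL l (p s) n) (fps_nth Y n) t"
    "fexp (X_ser l (p t)) * Y + fps_X * lift (mult_op l) Y = fps_X * fps_const (2 * p')"
proof -
  obtain y where y: "\<And>n. lder (\<lambda>s. chiL l (p s) n) (y n) t"
    using ex_lder_chiL[OF p] by metis
  define Y where "Y = Abs_fps y"
  have Y: "flder (\<lambda>s. X_ser l (p s)) Y t"
    using y by (simp add: flder_def Y_def)
  have Y0: "fps_nth Y 0 = 0"
    using lder_unique[OF y[of 0]] lder_const by (simp add: Y_def)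
  have E: "lder (\<lambda>s. fps_nth (fexp (X_ser l (p s))) n) (fps_nth (fexp (X_ser l (p t)) * Y) n) t" for n
  proof -
    have "lder (\<lambda>s. fps_nth (fexp (X_ser l (p s))) n)
      (\<Sum>j=0..n. cst (1 / fact j) * fps_nth (of_nat j * X_ser l (p t) ^ (j - 1) * Y) n) t"
      unfolding fexp_def fps_nth_Abs_fps
      using flder_power[OF Y] by (intro lder_sum lder_cst) (auto simp: flder_def)
    then show ?thesis
      using fexp_derivation[of "X_ser l (p t)" Y n] Y0 by simp
  qed
  have eq: "fexp (X_ser l (p t)) * Y + fps_X * lift (mult_op l) Y = fps_X * fps_const (2 * p')"
  proof (rule fps_ext)
    fix n
    show "fps_nth (fexp (X_ser l (p t)) * Y + fps_X * lift (mult_op l) Y) n = fps_nth (fps_X * fps_const (2 * p')) n"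
    proof (cases n)
      case 0
      then show ?thesis by (simp add: Y0)
    next
      case (Suc m)
      \<comment> \<open>S is shifted by one place against exp X, hence coefficient n of the one
        relation meets coefficient m = n - 1 of the other.\<close>
      have rel: "fps_nth (fexp (X_ser l (p s))) n + mult_op l (chiL l (p s) m) = fps_nth (fps_const (2 * p s)) m" for s
        using arg_cong[OF S_ser_eq[of l "p s"], of "\<lambda>F. fps_nth F m"] by (simp add: S_ser_def Suc)
      have "lder (\<lambda>s. fps_nth (fexp (X_ser l (p s))) n + mult_op l (chiL l (p s) m))
        (fps_nth (fexp (X_ser l (p t)) * Y) n + mult_op l (y m)) t"
        by (intro lder_add E lder_mult_op y)
      moreover have "lder (\<lambda>s. fps_nth (fps_const (2 * p s)) m) (fps_nth (fps_const (2 * p')) m) t"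
        using lder_add[OF p p] unfolding mult_2 by (cases m) (auto intro: lder_const)
      ultimately have "fps_nth (fexp (X_ser l (p t)) * Y) n + mult_op l (y m) = fps_nth (fps_const (2 * p')) m"
        unfolding rel by (rule lder_unique)
      then show ?thesis
        by (simp only: fps_add_nth fps_X_mult_nth Suc lift_nth Y_def fps_nth_Abs_fps) simp
    qed
  qed
  show ?thesis
    by (rule that[OF _ eq]) (simp add: Y_def y)
qed

lemma lder_line: "lder (\<lambda>s. p + cst (of_real s) * e) e 0"
proof -
  have "lder (\<lambda>s. cst (of_real s)) (cst 1) 0"
    unfolding lder_def
  proof (intro conjI allI)
    show "\<exists>A. finite A \<and> (\<forall>s::real. keys (cst (complex_of_real s)) \<subseteq> A)"
      by (rule exI[of _ "{0}"]) auto
    fix n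
    show "((\<lambda>s. lookup (cst (complex_of_real s)) n) has_vector_derivative lookup (cst 1) n) (at 0)"
      unfolding lookup_single when_def by (auto intro!: derivative_eq_intros)
  qed
  from lder_add[OF lder_const lder_times[OF this lder_const], of p e]
  show ?thesis by simp
qed

text \<open>If a curve solves ILW up to the defect \<open>e\<close>, then the zero mode changes at the same rate as along
  the line in the direction \<open>e\<close>.\<close>

theorem chiL_zero_mode_derivative:
  fixes l g :: "int \<Rightarrow> complex" and \<iota> :: complex
  assumes add: "\<And>a b. l a * l b * (of_int a + of_int b) =
      l (a + b) * (of_int a * (of_int b * g b) + of_int b * (of_int a * g a) + \<iota> * (of_int a + of_int b))"
    and l: "\<And>n. l n = of_int n * g n + of_int n + \<iota>"
    and odd: "\<And>n. g (- n) = - g n"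
    and p: "lder p (ilw_rhs g (p t) + e) t"
  obtains y where "((\<lambda>s. lookup (chiL l (p s) n) 0) has_vector_derivative y) (at t)"
    "((\<lambda>s. lookup (chiL l (p t + cst (of_real s) * e) n) 0) has_vector_derivative y) (at 0)"
proof -
  obtain Y where Y: "\<And>n. lder (\<lambda>s. chiL l (p s) n) (fps_nth Y n) t"
    "fexp (X_ser l (p t)) * Y + fps_X * lift (mult_op l) Y = fps_X * fps_const (2 * (ilw_rhs g (p t) + e))"
    using linearized_X_ser[OF p] by metis
  obtain Z where Z: "\<And>n. lder (\<lambda>s. chiL l (p t + cst (of_real s) * e) n) (fps_nth Z n) 0"
    "fexp (X_ser l (p t)) * Z + fps_X * lift (mult_op l) Z = fps_X * fps_const (2 * e)"
    using linearized_X_ser[OF lder_line, of l "p t" e] by auto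
  define R where "R = R_ser g \<iota> (X_ser l (p t)) (S_ser l (p t))"
  have R: "fexp (X_ser l (p t)) * R + fps_X * lift (mult_op l) R = fps_X * fps_const (2 * ilw_rhs g (p t))"
    unfolding R_def by (rule R_ser_eq[OF add l])
  \<comment> \<open>The series Y, R and Z solve the linearised equation with source the full
    velocity, its ILW part and the defect, respectively; linearity and uniqueness give Y = R +
    Z.\<close>
  have "Y - R - Z = 0"
  proof (rule linearized_unique)
    show "fps_nth (fexp (X_ser l (p t))) 0 = 1"
      by (simp add: fexp_X_ser)
    have "fexp (X_ser l (p t)) * (Y - R - Z) + fps_X * lift (mult_op l) (Y - R - Z) =
      (fexp (X_ser l (p t)) * Y + fps_X * lift (mult_op l) Y) - (fexp (X_ser l (p t)) * R + fps_X * lift (mult_op l) R)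
      - (fexp (X_ser l (p t)) * Z + fps_X * lift (mult_op l) Z)"
      by (simp add: lift_mult_op algebra_simps)
    also have "\<dots> = fps_X * (fps_const (2 * (ilw_rhs g (p t) + e)) - fps_const (2 * ilw_rhs g (p t)) - fps_const (2 * e))"
      unfolding Y(2) Z(2) R by (simp only: right_diff_distrib)
    also have "\<dots> = 0" by (simp add: algebra_simps)
    finally show "fexp (X_ser l (p t)) * (Y - R - Z) + fps_X * lift (mult_op l) (Y - R - Z) = 0" .
  qed
  then have "Y = R + Z" by (simp add: algebra_simps)
  then have "lookup (fps_nth Y n) 0 = lookup (fps_nth Z n) 0"
    using R_ser_lookup_0[of g, OF odd, of \<iota> l "p t" n] by (simp add: R_def lookup_add)
  then show ?thesis
    using that Y(1)[of n] Z(1)[of n] unfolding lder_def by metis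
qed

subsection \<open>Multilinear forms and their Sobolev bounds\<close>

text \<open>A linear version of the Japanese bracket; it is at least 1, hence safe as a
  divisor.\<close>

abbreviation jb :: "int \<Rightarrow> real" where "jb n \<equiv> 1 + \<bar>real_of_int n\<bar>"

definition words :: "int set \<Rightarrow> nat \<Rightarrow> int list set" where
  "words A j = {ns. set ns \<subseteq> A \<and> length ns = j}"

lemma finite_words: "finite A \<Longrightarrow> finite (words A j)"
  unfolding words_def by (rule finite_lists_length_eq)

lemma words_0 [simp]: "words A 0 = {[]}"
  by (auto simp: words_def)

lemma words_Suc: "words A (Suc j) = (\<lambda>(a, ns). a # ns) ` (A \<times> words A j)"
  by (auto simp: words_def length_Suc_conv image_iff)

lemma sum_words_Suc: "(\<Sum>ns\<in>words A (Suc j). f ns) = (\<Sum>a\<in>A. \<Sum>ns\<in>words A j. f (a # ns))"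
  unfolding words_Suc by (subst sum.reindex) (auto simp: inj_on_def sum.cartesian_product case_prod_unfold)

lemma sum_words_append:
  "(\<Sum>xs\<in>words A i. \<Sum>ys\<in>words A j. f xs ys) = (\<Sum>zs\<in>words A (i + j). f (take i zs) (drop i zs))"
  unfolding sum.cartesian_product
proof (rule sum.reindex_bij_witness[of _ "\<lambda>zs. (take i zs, drop i zs)" "\<lambda>(xs, ys). xs @ ys"])
  fix zs assume "zs \<in> words A (i + j)"
  then show "(take i zs, drop i zs) \<in> words A i \<times> words A j"
    by (auto simp: words_def dest: in_set_takeD in_set_dropD)
qed (auto simp: words_def)

text \<open>Dominates \<open>jb\<close> of each letter and also of the total, which is the frequency
  at which an outer multiplier acts.\<close>

definition wsize :: "int list \<Rightarrow> real" where
  "wsize ns = 1 + (\<Sum>a\<leftarrow>ns. \<bar>real_of_int a\<bar>)"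

lemma sum_list_abs_nonneg: "0 \<le> (\<Sum>a\<leftarrow>ns. \<bar>real_of_int a\<bar>)"
  by (rule sum_list_nonneg) auto

lemma wsize_ge_1: "1 \<le> wsize ns"
  using sum_list_abs_nonneg by (simp add: wsize_def)

lemma wsize_append: "wsize xs \<le> wsize (xs @ ys)" "wsize ys \<le> wsize (xs @ ys)"
  using sum_list_abs_nonneg by (simp_all add: wsize_def)

lemma wsize_sum_list: "jb (sum_list ns) \<le> wsize ns"
  by (induction ns) (auto simp: wsize_def)

definition symbols :: "real \<Rightarrow> (int \<Rightarrow> complex) set" where
  "symbols K = {l. \<forall>n. cmod (l n) \<le> K * jb n}"

text \<open>Homogeneous of degree \<open>j\<close> in the Laurent polynomial with \<open>n - j\<close> derivatives, uniformly over the
  symbols \<open>l\<close> of linear growth.\<close>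

definition hform :: "real \<Rightarrow> nat \<Rightarrow> nat \<Rightarrow> ((int \<Rightarrow> complex) \<Rightarrow> laurent \<Rightarrow> laurent) \<Rightarrow> bool" where
  "hform K n j X \<longleftrightarrow> 1 \<le> j \<and> j \<le> n \<and> (\<exists>C\<ge>0. \<forall>l\<in>symbols K. \<exists>m.
     (\<forall>ns. length ns = j \<longrightarrow> cmod (m ns) \<le> C * wsize ns ^ (n - j)) \<and>
     (\<forall>A p. finite A \<longrightarrow> keys p \<subseteq> A \<longrightarrow>
        X l p = (\<Sum>ns\<in>words A j. Poly_Mapping.single (sum_list ns) (m ns * (\<Prod>a\<leftarrow>ns. lookup p a)))))"

text \<open>The kernels multiply on the two halves of the concatenated word. Since i \<le> n and j
  \<le> n', the truncated differences add up to the right exponent.\<close>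

lemma hform_times:
  assumes "hform K n i X" "hform K n' j Y"
  shows "hform K (n + n') (i + j) (\<lambda>l p. X l p * Y l p)"
proof -
  from assms(1) obtain C where ij: "1 \<le> i" "i \<le> n" and C: "C \<ge> 0" "\<forall>l\<in>symbols K. \<exists>m.
     (\<forall>ns. length ns = i \<longrightarrow> cmod (m ns) \<le> C * wsize ns ^ (n - i)) \<and>
     (\<forall>A p. finite A \<longrightarrow> keys p \<subseteq> A \<longrightarrow>
        X l p = (\<Sum>ns\<in>words A i. Poly_Mapping.single (sum_list ns) (m ns * (\<Prod>a\<leftarrow>ns. lookup p a))))"
    unfolding hform_def by blast
  from assms(2) obtain D where ij': "1 \<le> j" "j \<le> n'" and D: "D \<ge> 0" "\<forall>l\<in>symbols K. \<exists>m.
     (\<forall>ns. length ns = j \<longrightarrow> cmod (m ns) \<le> D * wsize ns ^ (n' - j)) \<and>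
     (\<forall>A p. finite A \<longrightarrow> keys p \<subseteq> A \<longrightarrow>
        Y l p = (\<Sum>ns\<in>words A j. Poly_Mapping.single (sum_list ns) (m ns * (\<Prod>a\<leftarrow>ns. lookup p a))))"
    unfolding hform_def by blast
  have "\<exists>m. (\<forall>ns. length ns = i + j \<longrightarrow> cmod (m ns) \<le> (C * D) * wsize ns ^ (n + n' - (i + j))) \<and>
     (\<forall>A p. finite A \<longrightarrow> keys p \<subseteq> A \<longrightarrow>
        X l p * Y l p = (\<Sum>ns\<in>words A (i + j). Poly_Mapping.single (sum_list ns) (m ns * (\<Prod>a\<leftarrow>ns. lookup p a))))"
    if l: "l \<in> symbols K" for l
  proof -
    from C(2) l obtain m where m: "\<And>ns. length ns = i \<Longrightarrow> cmod (m ns) \<le> C * wsize ns ^ (n - i)"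
      "\<And>A p. finite A \<Longrightarrow> keys p \<subseteq> A \<Longrightarrow>
        X l p = (\<Sum>ns\<in>words A i. Poly_Mapping.single (sum_list ns) (m ns * (\<Prod>a\<leftarrow>ns. lookup p a)))"
      by blast
    from D(2) l obtain m' where m': "\<And>ns. length ns = j \<Longrightarrow> cmod (m' ns) \<le> D * wsize ns ^ (n' - j)"
      "\<And>A p. finite A \<Longrightarrow> keys p \<subseteq> A \<Longrightarrow>
        Y l p = (\<Sum>ns\<in>words A j. Poly_Mapping.single (sum_list ns) (m' ns * (\<Prod>a\<leftarrow>ns. lookup p a)))"
      by blast
    show ?thesis
    proof (intro exI[of _ "\<lambda>ns. m (take i ns) * m' (drop i ns)"] conjI allI impI)
      fix ns :: "int list" assume len: "length ns = i + j"
      have w: "wsize (take i ns) \<le> wsize ns" "wsize (drop i ns) \<le> wsize ns"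
        using wsize_append(1)[of "take i ns" "drop i ns"] wsize_append(2)[of "drop i ns" "take i ns"] by simp_all
      have "cmod (m (take i ns)) \<le> C * wsize (take i ns) ^ (n - i)"
        by (rule m(1)) (simp add: len)
      also have "\<dots> \<le> C * wsize ns ^ (n - i)"
        using C(1) w wsize_ge_1[of "take i ns"] by (intro mult_left_mono power_mono) auto
      finally have 1: "cmod (m (take i ns)) \<le> C * wsize ns ^ (n - i)" .
      have "cmod (m' (drop i ns)) \<le> D * wsize (drop i ns) ^ (n' - j)"
        by (rule m'(1)) (simp add: len)
      also have "\<dots> \<le> D * wsize ns ^ (n' - j)"
        using D(1) w wsize_ge_1[of "drop i ns"] by (intro mult_left_mono power_mono) auto
      finally have 2: "cmod (m' (drop i ns)) \<le> D * wsize ns ^ (n' - j)" .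
      have "cmod (m (take i ns) * m' (drop i ns)) \<le> (C * wsize ns ^ (n - i)) * (D * wsize ns ^ (n' - j))"
        unfolding norm_mult using 1 2 C(1) wsize_ge_1[of ns] by (intro mult_mono) auto
      also have "\<dots> = (C * D) * wsize ns ^ ((n - i) + (n' - j))"
        by (simp add: power_add)
      also have "(n - i) + (n' - j) = n + n' - (i + j)" using ij ij' by simp
      finally show "cmod (m (take i ns) * m' (drop i ns)) \<le> (C * D) * wsize ns ^ (n + n' - (i + j))" .
    next
      fix A p assume A: "finite A" "keys p \<subseteq> A"
      have "X l p * Y l p = (\<Sum>xs\<in>words A i. \<Sum>ys\<in>words A j.
          Poly_Mapping.single (sum_list xs + sum_list ys) (m xs * (\<Prod>a\<leftarrow>xs. lookup p a) * (m' ys * (\<Prod>a\<leftarrow>ys. lookup p a))))"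
        unfolding m(2)[OF A] m'(2)[OF A] by (simp add: sum_product mult_single)
      also have "\<dots> = (\<Sum>zs\<in>words A (i + j). Poly_Mapping.single (sum_list (take i zs) + sum_list (drop i zs))
          (m (take i zs) * (\<Prod>a\<leftarrow>take i zs. lookup p a) * (m' (drop i zs) * (\<Prod>a\<leftarrow>drop i zs. lookup p a))))"
        by (rule sum_words_append)
      also have "\<dots> = (\<Sum>ns\<in>words A (i + j). Poly_Mapping.single (sum_list ns)
          (m (take i ns) * m' (drop i ns) * (\<Prod>a\<leftarrow>ns. lookup p a)))"
      proof (rule sum.cong[OF refl])
        fix zs :: "int list"
        have 1: "sum_list (take i zs) + sum_list (drop i zs) = sum_list zs"
          by (metis append_take_drop_id sum_list_append)
        have "(\<Prod>a\<leftarrow>zs. lookup p a) = (\<Prod>a\<leftarrow>take i zs. lookup p a) * (\<Prod>a\<leftarrow>drop i zs. lookup p a)"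
          by (metis append_take_drop_id map_append prod_list.append)
        then show "Poly_Mapping.single (sum_list (take i zs) + sum_list (drop i zs))
          (m (take i zs) * (\<Prod>a\<leftarrow>take i zs. lookup p a) * (m' (drop i zs) * (\<Prod>a\<leftarrow>drop i zs. lookup p a)))
          = Poly_Mapping.single (sum_list zs) (m (take i zs) * m' (drop i zs) * (\<Prod>a\<leftarrow>zs. lookup p a))"
          unfolding 1 by (simp add: mult_ac)
      qed
      finally show "X l p * Y l p = (\<Sum>ns\<in>words A (i + j). Poly_Mapping.single (sum_list ns)
          (m (take i ns) * m' (drop i ns) * (\<Prod>a\<leftarrow>ns. lookup p a)))" .
    qed
  qed
  then show ?thesis
    using ij ij' C(1) D(1) unfolding hform_def by (intro conjI exI[of _ "C * D"]) auto
qed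

lemma hform_mult_op:
  assumes "hform K n j X" and K: "0 \<le> K"
  shows "hform K (Suc n) j (\<lambda>l p. mult_op l (X l p))"
proof -
  from assms(1) obtain C where ij: "1 \<le> j" "j \<le> n" and C: "C \<ge> 0" "\<forall>l\<in>symbols K. \<exists>m.
     (\<forall>ns. length ns = j \<longrightarrow> cmod (m ns) \<le> C * wsize ns ^ (n - j)) \<and>
     (\<forall>A p. finite A \<longrightarrow> keys p \<subseteq> A \<longrightarrow>
        X l p = (\<Sum>ns\<in>words A j. Poly_Mapping.single (sum_list ns) (m ns * (\<Prod>a\<leftarrow>ns. lookup p a))))"
    unfolding hform_def by blast
  have "\<exists>m. (\<forall>ns. length ns = j \<longrightarrow> cmod (m ns) \<le> (K * C) * wsize ns ^ (Suc n - j)) \<and>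
     (\<forall>A p. finite A \<longrightarrow> keys p \<subseteq> A \<longrightarrow>
        mult_op l (X l p) = (\<Sum>ns\<in>words A j. Poly_Mapping.single (sum_list ns) (m ns * (\<Prod>a\<leftarrow>ns. lookup p a))))"
    if l: "l \<in> symbols K" for l
  proof -
    from C(2) l obtain m where m: "\<And>ns. length ns = j \<Longrightarrow> cmod (m ns) \<le> C * wsize ns ^ (n - j)"
      "\<And>A p. finite A \<Longrightarrow> keys p \<subseteq> A \<Longrightarrow>
        X l p = (\<Sum>ns\<in>words A j. Poly_Mapping.single (sum_list ns) (m ns * (\<Prod>a\<leftarrow>ns. lookup p a)))"
      by blast
    show ?thesis
    proof (intro exI[of _ "\<lambda>ns. l (sum_list ns) * m ns"] conjI allI impI)
      fix ns :: "int list" assume len: "length ns = j"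
      have "cmod (l (sum_list ns)) \<le> K * (jb (sum_list ns))"
        using l by (simp add: symbols_def)
      also have "\<dots> \<le> K * wsize ns"
        using K wsize_sum_list by (intro mult_left_mono) auto
      finally have "cmod (l (sum_list ns) * m ns) \<le> (K * wsize ns) * (C * wsize ns ^ (n - j))"
        unfolding norm_mult using m(1)[OF len] K wsize_ge_1[of ns] by (intro mult_mono) auto
      then show "cmod (l (sum_list ns) * m ns) \<le> (K * C) * wsize ns ^ (Suc n - j)"
        using ij by (simp add: Suc_diff_le mult_ac)
    next
      fix A p assume A: "finite A" "keys p \<subseteq> A"
      show "mult_op l (X l p) = (\<Sum>ns\<in>words A j. Poly_Mapping.single (sum_list ns) (l (sum_list ns) * m ns * (\<Prod>a\<leftarrow>ns. lookup p a)))"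
        unfolding m(2)[OF A] by (simp add: mult_op_sum mult_ac)
    qed
  qed
  then show ?thesis
    using ij C(1) K unfolding hform_def by (intro conjI exI[of _ "K * C"]) auto
qed

lemma hform_cst:
  assumes "hform K n j X"
  shows "hform K n j (\<lambda>l p. cst c * X l p)"
proof -
  from assms(1) obtain C where ij: "1 \<le> j" "j \<le> n" and C: "C \<ge> 0" "\<forall>l\<in>symbols K. \<exists>m.
     (\<forall>ns. length ns = j \<longrightarrow> cmod (m ns) \<le> C * wsize ns ^ (n - j)) \<and>
     (\<forall>A p. finite A \<longrightarrow> keys p \<subseteq> A \<longrightarrow>
        X l p = (\<Sum>ns\<in>words A j. Poly_Mapping.single (sum_list ns) (m ns * (\<Prod>a\<leftarrow>ns. lookup p a))))"
    unfolding hform_def by blast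
  have "\<exists>m. (\<forall>ns. length ns = j \<longrightarrow> cmod (m ns) \<le> (cmod c * C) * wsize ns ^ (n - j)) \<and>
     (\<forall>A p. finite A \<longrightarrow> keys p \<subseteq> A \<longrightarrow>
        cst c * X l p = (\<Sum>ns\<in>words A j. Poly_Mapping.single (sum_list ns) (m ns * (\<Prod>a\<leftarrow>ns. lookup p a))))"
    if l: "l \<in> symbols K" for l
  proof -
    from C(2) l obtain m where m: "\<And>ns. length ns = j \<Longrightarrow> cmod (m ns) \<le> C * wsize ns ^ (n - j)"
      "\<And>A p. finite A \<Longrightarrow> keys p \<subseteq> A \<Longrightarrow>
        X l p = (\<Sum>ns\<in>words A j. Poly_Mapping.single (sum_list ns) (m ns * (\<Prod>a\<leftarrow>ns. lookup p a)))"
      by blast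
    show ?thesis
    proof (intro exI[of _ "\<lambda>ns. c * m ns"] conjI allI impI)
      fix ns :: "int list" assume len: "length ns = j"
      show "cmod (c * m ns) \<le> (cmod c * C) * wsize ns ^ (n - j)"
        unfolding norm_mult mult.assoc using m(1)[OF len] by (intro mult_left_mono) auto
    next
      fix A p assume A: "finite A" "keys p \<subseteq> A"
      show "cst c * X l p = (\<Sum>ns\<in>words A j. Poly_Mapping.single (sum_list ns) (c * m ns * (\<Prod>a\<leftarrow>ns. lookup p a)))"
        unfolding m(2)[OF A] by (simp add: sum_distrib_left mult_single mult_ac)
    qed
  qed
  then show ?thesis
    using ij C(1) unfolding hform_def by (intro conjI exI[of _ "cmod c * C"]) auto
qed

lemma hform_id: "hform K 1 1 (\<lambda>l p. 2 * p)"
  unfolding hform_def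
proof (intro conjI exI[of _ 2] ballI exI[of _ "\<lambda>_. 2"] allI impI)
  fix A p assume A: "finite A" "keys p \<subseteq> A"
  show "2 * p = (\<Sum>ns\<in>words A 1. Poly_Mapping.single (sum_list ns) (2 * (\<Prod>a\<leftarrow>ns. lookup p a)))"
  proof (rule poly_mapping_eqI)
    fix n
    have "(\<Sum>a\<in>A. lookup (Poly_Mapping.single a (2 * lookup p a)) n) = (\<Sum>a\<in>A. if a = n then 2 * lookup p n else 0)"
      by (rule sum.cong) (auto simp: lookup_single when_def)
    also have "\<dots> = 2 * lookup p n"
      using A by (auto simp: in_keys_iff)
    finally show "lookup (2 * p) n = lookup (\<Sum>ns\<in>words A 1. Poly_Mapping.single (sum_list ns) (2 * (\<Prod>a\<leftarrow>ns. lookup p a))) n"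
      by (simp add: sum_words_Suc lookup_sum)
  qed
qed auto

text \<open>Finite sums of homogeneous forms of varying degree but common weight n. The inductive
  format gives closure under sums and lets each estimate be proved for one homogeneous form at a
  time.\<close>

inductive form :: "real \<Rightarrow> nat \<Rightarrow> ((int \<Rightarrow> complex) \<Rightarrow> laurent \<Rightarrow> laurent) \<Rightarrow> bool" for K n where
  form_0: "form K n (\<lambda>l p. 0)"
| form_step: "hform K n j X \<Longrightarrow> form K n Y \<Longrightarrow> form K n (\<lambda>l p. X l p + Y l p)"

lemma form_hform: "hform K n j X \<Longrightarrow> form K n X"
  using form_step[OF _ form_0, of K n j X] by simp

lemma form_add: "form K n X \<Longrightarrow> form K n Y \<Longrightarrow> form K n (\<lambda>l p. X l p + Y l p)"
proof (induction rule: form.induct)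
  case form_0
  then show ?case by simp
next
  case (form_step j X X')
  then show ?case using form.form_step[of K n j X "\<lambda>l p. X' l p + Y l p"] by (simp add: add.assoc)
qed

lemma form_cst: "form K n X \<Longrightarrow> form K n (\<lambda>l p. cst c * X l p)"
proof (induction rule: form.induct)
  case form_0
  then show ?case by (simp add: form.form_0)
next
  case (form_step j X X')
  then show ?case using form.form_step[OF hform_cst[of K n j X c]] by (simp add: distrib_left)
qed

lemma form_mult_op: "form K n X \<Longrightarrow> 0 \<le> K \<Longrightarrow> form K (Suc n) (\<lambda>l p. mult_op l (X l p))"
proof (induction rule: form.induct)
  case form_0
  then show ?case by (simp add: form.form_0)
next
  case (form_step j X X')
  then show ?case using form.form_step[OF hform_mult_op[of K n j X]] by (simp add: mult_op_add)
qed

lemma form_hform_times: "form K n Y \<Longrightarrow> hform K m j X \<Longrightarrow> form K (m + n) (\<lambda>l p. X l p * Y l p)"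
proof (induction rule: form.induct)
  case form_0
  then show ?case by (simp add: form.form_0)
next
  case (form_step i Y Y')
  then show ?case using form.form_step[OF hform_times[of K m j X n i Y]] by (simp add: distrib_left)
qed

lemma form_times: "form K m X \<Longrightarrow> form K n Y \<Longrightarrow> form K (m + n) (\<lambda>l p. X l p * Y l p)"
proof (induction rule: form.induct)
  case form_0
  then show ?case by (simp add: form.form_0)
next
  case (form_step j X X')
  then show ?case using form_add[OF form_hform_times[of K n Y m j X]] by (simp add: distrib_right)
qed

lemma form_sum:
  "(\<And>i. i \<in> I \<Longrightarrow> form K n (X i)) \<Longrightarrow> form K n (\<lambda>l p. \<Sum>i\<in>I. X i l p)"
  by (induction I rule: infinite_finite_induct) (auto intro: form_0 form_add)

lemma form_prod_list:
  assumes "ms \<noteq> []" "\<And>m. m \<in> set ms \<Longrightarrow> form K m (X m)"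
  shows "form K (sum_list ms) (\<lambda>l p. \<Prod>m\<leftarrow>ms. X m l p)"
  using assms by (induction ms rule: list_nonempty_induct) (auto intro: form_times)

lemma form_uminus: "form K n X \<Longrightarrow> form K n (\<lambda>l p. - X l p)"
proof -
  assume "form K n X"
  from form_cst[OF this, of "- 1"] show ?thesis
    by (simp add: single_uminus)
qed

text \<open>The recursion respects the weight: a product adds the weights of its factors, and the
  multiplier, of order one, accounts for the step from n - 1 to n.\<close>

lemma form_chiL:
  assumes K: "0 \<le> K" and "1 \<le> n"
  shows "form K n (\<lambda>l p. chiL l p n)"
  using assms(2)
proof (induction n rule: less_induct)
  case (less n)
  show ?case
  proof (cases "n = 1")
    case True
    then show ?thesis using form_hform[OF hform_id] by simp
  next
    case False
    with less have n: "n \<ge> 2" by simp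
    have "form K n (\<lambda>l p. - (\<Sum>j=2..n. cst (1 / fact j) * (\<Sum>ns\<in>compositions n j. \<Prod>m\<leftarrow>ns. chiL l p m))
          + - mult_op l (chiL l p (n - 1)))"
    proof (intro form_add form_uminus form_sum form_cst)
      fix j ns assume j: "j \<in> {2..n}" and ns: "ns \<in> compositions n j"
      have "form K (sum_list ns) (\<lambda>l p. \<Prod>m\<leftarrow>ns. chiL l p m)"
        using j ns by (intro form_prod_list less) (auto simp: compositions_less compositions_def)
      then show "form K n (\<lambda>l p. \<Prod>m\<leftarrow>ns. chiL l p m)"
        using ns by (simp add: compositions_def)
    next
      show "form K n (\<lambda>l p. mult_op l (chiL l p (n - 1)))"
        using form_mult_op[OF less(1)[of "n - 1"] K] n by simp
    qed
    then show ?thesis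
      using n by (subst chiL.simps) simp
  qed
qed

section \<open>Counting estimate for words of total frequency zero\<close>

fun distinguished :: "('a \<Rightarrow> real) \<Rightarrow> ('a \<Rightarrow> real) \<Rightarrow> 'a list \<Rightarrow> real" where
  "distinguished g h [] = 0"
| "distinguished g h (y # ys) = g y * (\<Prod>a\<leftarrow>ys. h a) + h y * distinguished g h ys"

lemma prod_list_map_nonneg: "(\<And>a. 0 \<le> (h a :: real)) \<Longrightarrow> 0 \<le> (\<Prod>a\<leftarrow>xs. h a)"
  by (induction xs) auto

lemma distinguished_nonneg:
  "(\<And>a. 0 \<le> g a) \<Longrightarrow> (\<And>a. 0 \<le> h a) \<Longrightarrow> 0 \<le> distinguished g h xs"
  by (induction xs) (auto intro!: add_nonneg_nonneg mult_nonneg_nonneg prod_list_map_nonneg)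

lemma distinguished_ge:
  assumes g: "\<And>a. 0 \<le> g a" and h: "\<And>a. 0 \<le> h a"
  shows "g a * (\<Prod>c\<leftarrow>xs @ ys. h c) \<le> distinguished g h (xs @ a # ys)"
proof (induction xs)
  case Nil
  then show ?case using distinguished_nonneg[of g h ys] g h by simp
next
  case (Cons x xs)
  have "g a * (\<Prod>c\<leftarrow>(x # xs) @ ys. h c) = h x * (g a * (\<Prod>c\<leftarrow>xs @ ys. h c))"
    by (simp add: mult_ac)
  also have "\<dots> \<le> h x * distinguished g h (xs @ a # ys)"
    by (rule mult_left_mono[OF Cons h])
  also have "\<dots> \<le> distinguished g h ((x # xs) @ a # ys)"
    using g[of x] prod_list_map_nonneg[of h "xs @ a # ys"] h by simp
  finally show ?case .
qed

lemma sum_words_prod: "(\<Sum>ns\<in>words A i. \<Prod>a\<leftarrow>ns. h a) = (\<Sum>a\<in>A. h a :: real) ^ i"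
proof (induction i)
  case (Suc i)
  then show ?case
    by (simp add: sum_words_Suc sum_distrib_left[symmetric] sum_distrib_right[symmetric])
qed simp

text \<open>\<open>distinguished g h\<close> is the linear coefficient in s of the product of the h
  + s g over the word, so this is the derivative at s = 0 of the i-th power of the sum over A of h +
  s g.\<close>

lemma sum_words_distinguished:
  "(\<Sum>ns\<in>words A i. distinguished g h ns) = real i * (\<Sum>a\<in>A. g a) * (\<Sum>a\<in>A. h a) ^ (i - 1)"
proof (induction i)
  case (Suc i)
  have "(\<Sum>ns\<in>words A (Suc i). distinguished g h ns) =
     (\<Sum>a\<in>A. g a) * (\<Sum>a\<in>A. h a) ^ i + (\<Sum>a\<in>A. h a) * (real i * (\<Sum>a\<in>A. g a) * (\<Sum>a\<in>A. h a) ^ (i - 1))"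
    by (simp add: sum_words_Suc sum.distrib sum_distrib_left[symmetric] sum_distrib_right[symmetric]
        sum_words_prod Suc)
  then show ?case by (cases i) (simp_all add: algebra_simps)
qed simp

text \<open>On words of total zero each letter is determined by the others.\<close>

lemma sum_words_delete:
  assumes A: "finite A" and f: "\<And>ns. 0 \<le> (f ns :: real)" and q: "q < j"
  shows "(\<Sum>ns | ns \<in> words A j \<and> sum_list ns = 0. f (take q ns @ drop (Suc q) ns)) \<le> (\<Sum>ns\<in>words A (j - 1). f ns)"
proof -
  let ?S = "{ns. ns \<in> words A j \<and> sum_list ns = 0}"
  let ?del = "\<lambda>ns :: int list. take q ns @ drop (Suc q) ns"
  have inv: "take q (?del ns) @ (- sum_list (?del ns)) # drop q (?del ns) = ns" if "ns \<in> ?S" for ns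
  proof -
    have len: "q < length ns" using that q by (auto simp: words_def)
    then have ns: "ns = take q ns @ ns ! q # drop (Suc q) ns" by (rule id_take_nth_drop)
    then have "sum_list ns = sum_list (take q ns) + (ns ! q + sum_list (drop (Suc q) ns))"
      by (metis sum_list.Cons sum_list_append)
    then have "ns ! q = - sum_list (?del ns)" using that by simp
    then show ?thesis using ns len by (simp add: min_def)
  qed
  have inj: "inj_on ?del ?S"
    by (rule inj_on_inverseI[of _ "\<lambda>ms. take q ms @ (- sum_list ms) # drop q ms"]) (rule inv)
  have "(\<Sum>ns\<in>?S. f (?del ns)) = (\<Sum>ms\<in>?del ` ?S. f ms)"
    using inj by (simp add: sum.reindex)
  also have "\<dots> \<le> (\<Sum>ms\<in>words A (j - 1). f ms)"
    by (rule sum_mono2) (use A f q in \<open>auto simp: finite_words, auto simp: words_def dest: in_set_takeD in_set_dropD\<close>)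
  finally show ?thesis .
qed

lemma sum_list_abs_le: "(\<And>a. a \<in> set ns \<Longrightarrow> \<bar>real_of_int a\<bar> \<le> M) \<Longrightarrow> (\<Sum>a\<leftarrow>ns. \<bar>real_of_int a\<bar>) \<le> real (length ns) * M"
  by (induction ns) (auto simp: algebra_simps add_mono)

lemma prod_le_wsize:
  assumes d: "\<And>a. 0 \<le> (d a :: real)" and h: "\<And>a. h a = d a / jb a"
    and sub: "\<And>a. a \<in> set xs \<Longrightarrow> jb a \<le> W"
  shows "(\<Prod>a\<leftarrow>xs. d a) \<le> W ^ length xs * (\<Prod>a\<leftarrow>xs. h a)"
  using sub
proof (induction xs)
  case (Cons x xs)
  have "d x = jb x * h x"
    using abs_ge_zero[of "real_of_int x"] by (simp add: h field_simps add_nonneg_eq_0_iff)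
  moreover have h0: "0 \<le> h a" for a by (simp add: h d)
  moreover have "W \<ge> 0" using Cons.prems[of x] abs_ge_zero[of "real_of_int x"] by simp
  ultimately have "d x * (\<Prod>a\<leftarrow>xs. d a) \<le> (W * h x) * (W ^ length xs * (\<Prod>a\<leftarrow>xs. h a))"
    using Cons d by (intro mult_mono) (auto intro!: mult_right_mono prod_list_map_nonneg mult_nonneg_nonneg)
  then show ?case by (simp add: mult_ac)
qed simp

text \<open>The letters \<open>s\<close> and \<open>t\<close> carry all derivatives, and AM-GM splits their product; each of the
  \<open>j - 2\<close> other letters takes a negative power from the surplus \<open>k - (k + 2 - j)\<close>.\<close>

lemma pair_estimate:
  fixes d :: "int \<Rightarrow> real" and k j :: nat
  assumes d: "\<And>a. 0 \<le> d a" and ns: "ns = xs @ [s] @ ys @ [t] @ zs" "length ns = j" "j \<le> k + 2"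
    and W: "wsize ns \<le> 2 * real j * jb s" "wsize ns \<le> 2 * real j * jb t"
  defines "g \<equiv> \<lambda>a. jb a ^ k * (d a)\<^sup>2" and "h \<equiv> \<lambda>a. d a / jb a"
  shows "wsize ns ^ (k + 2 - j) * (\<Prod>a\<leftarrow>ns. d a) \<le>
     (2 * real j) ^ k * (\<Sum>q<j. distinguished g h (take q ns @ drop (Suc q) ns))"
proof -
  let ?W = "wsize ns" and ?r = "xs @ ys @ zs"
  have j: "j = length ?r + 2" using ns by simp
  have g0: "\<And>a. 0 \<le> g a" and h0: "\<And>a. 0 \<le> h a" using d by (auto simp: g_def h_def)
  have W1: "1 \<le> ?W" by (rule wsize_ge_1)
  let ?del = "\<lambda>q. distinguished g h (take q ns @ drop (Suc q) ns)"
  have letters: "jb a \<le> ?W" if "a \<in> set ns" for a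
  proof -
    from that obtain us vs where "ns = us @ a # vs" by (meson split_list)
    then show ?thesis using sum_list_abs_nonneg[of us] sum_list_abs_nonneg[of vs] by (simp add: wsize_def)
  qed
  have "(\<Prod>a\<leftarrow>?r. d a) \<le> ?W ^ length ?r * (\<Prod>a\<leftarrow>?r. h a)"
    by (rule prod_le_wsize) (use d letters ns(1) in \<open>auto simp: h_def\<close>)
  then have "(?W ^ (k + 2 - j) * (d s * d t)) * (\<Prod>a\<leftarrow>?r. d a) \<le> (?W ^ (k + 2 - j) * (d s * d t)) * (?W ^ length ?r * (\<Prod>a\<leftarrow>?r. h a))"
    using W1 d by (intro mult_left_mono) auto
  also have "\<dots> = (?W ^ (k + 2 - j) * ?W ^ length ?r) * (d s * d t) * (\<Prod>a\<leftarrow>?r. h a)"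
    by (simp add: mult_ac)
  \<comment> \<open>The remaining word has j - 2 letters and j \<le> k + 2, so the exponents add up
    to k.\<close>
  also have "?W ^ (k + 2 - j) * ?W ^ length ?r = ?W ^ k"
    using j ns(3) by (simp flip: power_add)
  also have "?W ^ k * (d s * d t) * (\<Prod>a\<leftarrow>?r. h a) \<le> (2 * real j) ^ k * (g s + g t) * (\<Prod>a\<leftarrow>?r. h a)"
  proof (rule mult_right_mono)
    have amgm: "d s * d t \<le> (d s)\<^sup>2 + (d t)\<^sup>2"
      using sum_squares_bound[of "d s" "d t"] mult_nonneg_nonneg[OF d[of s] d[of t]] by (simp add: power2_eq_square)
    have "?W ^ k * (d s * d t) \<le> ?W ^ k * (d s)\<^sup>2 + ?W ^ k * (d t)\<^sup>2"
      using mult_left_mono[OF amgm, of "?W ^ k"] W1 by (simp add: distrib_left)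
    also have "\<dots> \<le> (2 * real j * jb s) ^ k * (d s)\<^sup>2 + (2 * real j * jb t) ^ k * (d t)\<^sup>2"
      using W W1 by (intro add_mono mult_right_mono power_mono) auto
    also have "\<dots> = (2 * real j) ^ k * (g s + g t)"
      unfolding power_mult_distrib g_def by (simp add: algebra_simps)
    finally show "?W ^ k * (d s * d t) \<le> (2 * real j) ^ k * (g s + g t)" .
  qed (rule prod_list_map_nonneg[OF h0])
  also have "\<dots> = (2 * real j) ^ k * (g t * (\<Prod>a\<leftarrow>?r. h a) + g s * (\<Prod>a\<leftarrow>?r. h a))"
    by (simp add: algebra_simps)
  \<comment> \<open>Deleting s leaves t as the distinguished letter, and vice versa; the deleted
    letter is the one that the zero total recovers.\<close>
  also have "\<dots> \<le> (2 * real j) ^ k * (?del (length xs) + ?del (length (xs @ s # ys)))"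
  proof (intro mult_left_mono add_mono)
    have "take (length xs) ns @ drop (Suc (length xs)) ns = (xs @ ys) @ t # zs"
      by (simp add: ns(1))
    then show "g t * (\<Prod>a\<leftarrow>?r. h a) \<le> ?del (length xs)"
      using distinguished_ge[of g h t "xs @ ys" zs] g0 h0 by simp
    have "take (length (xs @ s # ys)) ns @ drop (Suc (length (xs @ s # ys))) ns = xs @ s # ys @ zs"
      by (simp add: ns(1))
    then show "g s * (\<Prod>a\<leftarrow>?r. h a) \<le> ?del (length (xs @ s # ys))"
      using distinguished_ge[of g h s xs "ys @ zs"] g0 h0 by simp
  qed auto
  also have "?del (length xs) + ?del (length (xs @ s # ys)) = (\<Sum>q\<in>{length xs, length (xs @ s # ys)}. ?del q)"
    by simp
  also have "(2 * real j) ^ k * \<dots> \<le> (2 * real j) ^ k * (\<Sum>q<j. ?del q)"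
    by (intro mult_left_mono sum_mono2) (use ns distinguished_nonneg[OF g0 h0] in auto)
  finally show ?thesis by (simp add: ns(1) mult_ac)
qed

lemma ex_maximal:
  fixes f :: "'a \<Rightarrow> real"
  assumes "finite S" "S \<noteq> {}"
  shows "\<exists>a\<in>S. \<forall>c\<in>S. f c \<le> f a"
proof -
  have "Max (f ` S) \<in> f ` S" using assms by (intro Max_in) auto
  then obtain a where "a \<in> S" "Max (f ` S) = f a" by auto
  then show ?thesis using assms(1) by (metis Max_ge finite_imageI imageI)
qed

text \<open>Let a be a letter of largest modulus and c one of largest modulus among the others. The
  zero total bounds |a| by the sum of the others, hence by j |c|, so a and c are both comparable to
  the size of the word and \<open>pair_estimate\<close> applies to them in either order.\<close>

lemma zero_sum_estimate:
  fixes d :: "int \<Rightarrow> real" and k j :: nat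
  assumes A: "finite A" and d: "\<And>a. 0 \<le> d a" and j: "2 \<le> j" "j \<le> k + 2"
  defines "g \<equiv> \<lambda>a. jb a ^ k * (d a)\<^sup>2" and "h \<equiv> \<lambda>a. d a / jb a"
  shows "(\<Sum>ns | ns \<in> words A j \<and> sum_list ns = 0. wsize ns ^ (k + 2 - j) * (\<Prod>a\<leftarrow>ns. d a))
    \<le> (2 * real j) ^ k * (real j * (real j * (\<Sum>a\<in>A. g a) * (\<Sum>a\<in>A. h a) ^ (j - 2)))"
proof -
  let ?S = "{ns. ns \<in> words A j \<and> sum_list ns = 0}"
  let ?f = "distinguished g h"
  have g0: "\<And>a. 0 \<le> g a" and h0: "\<And>a. 0 \<le> h a" using d by (auto simp: g_def h_def)
  have "(\<Sum>ns\<in>?S. wsize ns ^ (k + 2 - j) * (\<Prod>a\<leftarrow>ns. d a))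
      \<le> (\<Sum>ns\<in>?S. (2 * real j) ^ k * (\<Sum>q<j. ?f (take q ns @ drop (Suc q) ns)))"
  proof (rule sum_mono)
    fix ns assume "ns \<in> ?S"
    then have len: "length ns = j" and sum0: "sum_list ns = 0" by (auto simp: words_def)
    let ?m = "\<lambda>a. \<bar>real_of_int a\<bar>"
    have "set ns \<noteq> {}" using len j by auto
    then obtain a where a: "a \<in> set ns" "\<And>c. c \<in> set ns \<Longrightarrow> ?m c \<le> ?m a"
      using ex_maximal[of "set ns" ?m] by auto
    from a(1) obtain us vs where uv: "ns = us @ a # vs" by (meson split_list)
    then have "set (us @ vs) \<noteq> {}" using len j by auto
    then obtain c where c: "c \<in> set (us @ vs)" "\<And>e. e \<in> set (us @ vs) \<Longrightarrow> ?m e \<le> ?m c"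
      using ex_maximal[of "set (us @ vs)" ?m] by auto
    have rest: "(\<Sum>e\<leftarrow>us @ vs. ?m e) \<le> real (length (us @ vs)) * ?m c"
      by (rule sum_list_abs_le) (rule c)
    have Weq: "wsize ns = 1 + ?m a + (\<Sum>e\<leftarrow>us @ vs. ?m e)"
      by (simp add: wsize_def uv)
    \<comment> \<open>The only use of the zero total in the choice of the pair: it is what makes the
      second largest letter large as well.\<close>
    have "a = - sum_list (us @ vs)" using sum0 uv by simp
    then have "?m a \<le> (\<Sum>e\<leftarrow>us @ vs. ?m e)"
      using wsize_sum_list[of "us @ vs"] by (simp add: wsize_def)
    then have "wsize ns \<le> 1 + 2 * (real (length (us @ vs)) * ?m c)"
      using rest unfolding Weq by simp
    also have "\<dots> \<le> 2 * real j * (1 + ?m c)"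
    proof -
      have "real (length (us @ vs)) * ?m c \<le> real j * ?m c"
        using len uv by (intro mult_right_mono) auto
      then show ?thesis using j by (simp add: algebra_simps)
    qed
    finally have Wc: "wsize ns \<le> 2 * real j * (1 + ?m c)" .
    have "wsize ns \<le> 1 + real (length ns) * ?m a"
      unfolding wsize_def using sum_list_abs_le[OF a(2)] by simp
    also have "\<dots> \<le> 2 * real j * (1 + ?m a)"
    proof -
      have "0 \<le> real j * ?m a" "real j \<ge> 2" using j by simp_all
      then have "1 \<le> real j * ?m a + real j * 2" by linarith
      then show ?thesis by (simp add: algebra_simps len)
    qed
    finally have Wa: "wsize ns \<le> 2 * real j * (1 + ?m a)" .
    from c(1) consider "c \<in> set us" | "c \<in> set vs" by auto
    then show "wsize ns ^ (k + 2 - j) * (\<Prod>a\<leftarrow>ns. d a) \<le> (2 * real j) ^ k * (\<Sum>q<j. ?f (take q ns @ drop (Suc q) ns))"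
    proof cases
      case 1
      then obtain xs ys where "us = xs @ c # ys" by (meson split_list)
      then have "ns = xs @ [c] @ ys @ [a] @ vs" using uv by simp
      from pair_estimate[where d = d, OF d this len j(2) Wc Wa] show ?thesis
        unfolding g_def h_def .
    next
      case 2
      then obtain xs ys where "vs = xs @ c # ys" by (meson split_list)
      then have "ns = us @ [a] @ xs @ [c] @ ys" using uv by simp
      from pair_estimate[where d = d, OF d this len j(2) Wa Wc] show ?thesis
        unfolding g_def h_def .
    qed
  qed
  also have "\<dots> = (2 * real j) ^ k * (\<Sum>q<j. \<Sum>ns\<in>?S. ?f (take q ns @ drop (Suc q) ns))"
    by (simp add: sum_distrib_left sum.swap[of _ ?S])
  also have "\<dots> \<le> (2 * real j) ^ k * (\<Sum>q<j. \<Sum>ns\<in>words A (j - 1). ?f ns)"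
    by (intro mult_left_mono sum_mono sum_words_delete) (use A distinguished_nonneg[OF g0 h0] in auto)
  \<comment> \<open>With one letter removed the constraint is gone and the sum over the other j - 1
    letters factorises.\<close>
  also have "(\<Sum>q<j. \<Sum>ns\<in>words A (j - 1). ?f ns) = real j * (real (j - 1) * (\<Sum>a\<in>A. g a) * (\<Sum>a\<in>A. h a) ^ (j - 2))"
    using j by (simp add: sum_words_distinguished numeral_2_eq_2 of_nat_diff)
  also have "(2 * real j) ^ k * \<dots> \<le> (2 * real j) ^ k * (real j * (real j * (\<Sum>a\<in>A. g a) * (\<Sum>a\<in>A. h a) ^ (j - 2)))"
    using g0 h0 by (intro mult_left_mono mult_right_mono zero_le_power sum_nonneg) auto
  finally show ?thesis .
qed

section \<open>Sobolev weights and the resulting multilinear bound\<close>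

definition wt :: "nat \<Rightarrow> int \<Rightarrow> real" where
  "wt k n = (1 + (of_int n)\<^sup>2) powr (real k / 2)"

lemma wt_ge_1: "1 \<le> wt k n"
  unfolding wt_def by (rule ge_one_powr_ge_zero) auto

lemma wt_mono: "k \<le> k' \<Longrightarrow> wt k n \<le> wt k' n"
  unfolding wt_def by (rule powr_mono) auto

lemma abs_power_le_wt: "jb n ^ k \<le> 2 ^ k * wt k n"
proof -
  have "(jb n)\<^sup>2 \<le> 2\<^sup>2 * (1 + (of_int n)\<^sup>2)"
    using sum_squares_bound[of 1 "\<bar>real_of_int n\<bar>"] by (simp add: power2_eq_square algebra_simps)
  then have "((jb n)\<^sup>2) powr (real k / 2) \<le> (2\<^sup>2 * (1 + (of_int n)\<^sup>2)) powr (real k / 2)"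
    by (rule powr_mono2[rotated 2]) auto
  moreover have "(x\<^sup>2) powr (real k / 2) = x ^ k" if "x > 0" for x :: real
    using that by (simp add: powr_powr powr_realpow[symmetric] flip: powr_numeral)
  moreover have "(2\<^sup>2 * (1 + (real_of_int n)\<^sup>2)) powr (real k / 2) = (2\<^sup>2) powr (real k / 2) * wt k n"
    unfolding wt_def by (rule powr_mult)
  ultimately show ?thesis by (simp add: powr_realpow)
qed

lemma wt_le_abs_power: "wt k n \<le> jb n ^ k"
proof -
  have "1 + (of_int n)\<^sup>2 \<le> (jb n)\<^sup>2"
    by (simp add: power2_eq_square algebra_simps)
  then have "wt k n \<le> ((jb n)\<^sup>2) powr (real k / 2)"
    unfolding wt_def by (intro powr_mono2) auto
  also have "\<dots> = jb n ^ k"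
    by (simp add: powr_powr powr_realpow[symmetric] flip: powr_numeral)
  finally show ?thesis .
qed

definition hnorm2 :: "nat \<Rightarrow> laurent \<Rightarrow> real" where
  "hnorm2 k p = (\<Sum>n\<in>keys p. wt k n * (cmod (lookup p n))\<^sup>2)"

lemma hnorm2_eq:
  assumes "finite A" "keys p \<subseteq> A"
  shows "hnorm2 k p = (\<Sum>n\<in>A. wt k n * (cmod (lookup p n))\<^sup>2)"
  unfolding hnorm2_def by (rule sum.mono_neutral_left) (use assms in \<open>auto simp: in_keys_iff\<close>)

lemma wt_nonneg: "0 \<le> wt k n" using wt_ge_1[of k n] by simp

lemma hnorm2_mono: "k \<le> k' \<Longrightarrow> hnorm2 k p \<le> hnorm2 k' p"
  unfolding hnorm2_def by (intro sum_mono mult_right_mono wt_mono) auto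

lemma inverse_square_sum:
  obtains Z where "0 \<le> Z" "\<And>A. finite A \<Longrightarrow> (\<Sum>a\<in>A. 1 / (jb a)\<^sup>2) \<le> Z"
proof -
  have s: "summable (\<lambda>n. 1 / (1 + real n)\<^sup>2)"
    using inverse_squares_sums by (simp add: sums_iff add.commute)
  define Z where "Z = suminf (\<lambda>n. 1 / (1 + real n)\<^sup>2)"
  have fin: "(\<Sum>n\<in>B. 1 / (1 + real n)\<^sup>2) \<le> Z" if "finite B" for B
    unfolding Z_def by (rule sum_le_suminf[OF s that]) auto
  have "(\<Sum>a\<in>A. 1 / (jb a)\<^sup>2) \<le> 2 * Z" if A: "finite A" for A
  proof -
    let ?f = "\<lambda>a. 1 / (jb a)\<^sup>2"
    \<comment> \<open>The absolute value is injective on integers of one sign, so each half is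
      dominated by the one-sided series.\<close>
    have half: "(\<Sum>a\<in>{a\<in>A. P a}. ?f a) \<le> Z" if "inj_on (\<lambda>a. nat \<bar>a\<bar>) {a\<in>A. P a}" for P
    proof -
      have "(\<Sum>a\<in>{a\<in>A. P a}. ?f a) = (\<Sum>n\<in>(\<lambda>a. nat \<bar>a\<bar>) ` {a\<in>A. P a}. 1 / (1 + real n)\<^sup>2)"
        using that by (subst sum.reindex) auto
      also have "\<dots> \<le> Z" using A by (intro fin) auto
      finally show ?thesis .
    qed
    have "(\<Sum>a\<in>A. ?f a) = (\<Sum>a\<in>{a\<in>A. a \<ge> 0}. ?f a) + (\<Sum>a\<in>{a\<in>A. \<not> a \<ge> 0}. ?f a)"
      using A by (subst sum.union_disjoint[symmetric]) (auto intro!: sum.cong)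
    also have "\<dots> \<le> Z + Z"
      by (intro add_mono half) (auto simp: inj_on_def)
    finally show ?thesis by simp
  qed
  moreover have "0 \<le> 2 * Z" using fin[of "{}"] by simp
  ultimately show ?thesis using that by blast
qed

text \<open>A letter without derivatives carries the factor 1 / jb, and Cauchy-Schwarz bounds its
  sum by square-summable data. The constant depends on B only and not on the support A; this is what
  survives the removal of the truncation.\<close>

lemma zero_sum_bound:
  assumes j: "2 \<le> j" "j \<le> k + 2" and B: "0 \<le> B"
  obtains C where "0 \<le> C" "\<And>A d. finite A \<Longrightarrow> (\<And>a. 0 \<le> d a) \<Longrightarrow> (\<Sum>a\<in>A. wt k a * (d a)\<^sup>2) \<le> B \<Longrightarrow>
    (\<Sum>ns | ns \<in> words A j \<and> sum_list ns = 0. wsize ns ^ (k + 2 - j) * (\<Prod>a\<leftarrow>ns. d a)) \<le> C"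
proof -
  obtain Z where Z: "0 \<le> Z" "\<And>A. finite A \<Longrightarrow> (\<Sum>a\<in>A. 1 / (jb a)\<^sup>2) \<le> Z"
    using inverse_square_sum by metis
  define C where "C = (2 * real j) ^ k * (real j * (real j * (2 ^ k * B) * sqrt (B * Z) ^ (j - 2)))"
  show ?thesis
  proof (rule that[of C])
    show "0 \<le> C" using B Z(1) unfolding C_def by auto
    fix A :: "int set" and d :: "int \<Rightarrow> real"
    assume A: "finite A" and d: "\<And>a. 0 \<le> d a" and S: "(\<Sum>a\<in>A. wt k a * (d a)\<^sup>2) \<le> B"
    have "(\<Sum>a\<in>A. jb a ^ k * (d a)\<^sup>2) \<le> (\<Sum>a\<in>A. 2 ^ k * (wt k a * (d a)\<^sup>2))"
      unfolding mult.assoc[symmetric] by (intro sum_mono mult_right_mono abs_power_le_wt) auto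
    also have "\<dots> \<le> 2 ^ k * B"
      using S by (simp flip: sum_distrib_left)
    finally have g: "(\<Sum>a\<in>A. jb a ^ k * (d a)\<^sup>2) \<le> 2 ^ k * B" .
    have "(\<Sum>a\<in>A. (d a)\<^sup>2) \<le> (\<Sum>a\<in>A. wt k a * (d a)\<^sup>2)"
      by (intro sum_mono) (simp add: wt_ge_1 mult_le_cancel_right1)
    then have d2: "(\<Sum>a\<in>A. (d a)\<^sup>2) \<le> B" using S by simp
    have "(\<Sum>a\<in>A. d a * (1 / jb a))\<^sup>2 \<le> (\<Sum>a\<in>A. (d a)\<^sup>2) * (\<Sum>a\<in>A. (1 / jb a)\<^sup>2)"
      by (rule Cauchy_Schwarz_ineq_sum)
    also have "\<dots> \<le> B * Z"
      using d2 Z(2)[OF A] B by (intro mult_mono) (auto simp: power_divide intro: sum_nonneg)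
    finally have h: "(\<Sum>a\<in>A. d a / jb a) \<le> sqrt (B * Z)"
      by (intro real_le_rsqrt) simp
    have h0: "0 \<le> (\<Sum>a\<in>A. d a / jb a)"
      using d by (intro sum_nonneg) auto
    show "(\<Sum>ns | ns \<in> words A j \<and> sum_list ns = 0. wsize ns ^ (k + 2 - j) * (\<Prod>a\<leftarrow>ns. d a)) \<le> C"
      unfolding C_def
      by (rule order.trans[OF zero_sum_estimate[OF A d j]])
        (intro mult_left_mono mult_mono power_mono mult_nonneg_nonneg zero_le_power g h h0 sum_nonneg, use B in auto)
  qed
qed

text \<open>As a polynomial in \<theta>, the product of the c + \<theta> e minus the product of the
  c has nonnegative coefficients and no constant term; on [0, 1] it is therefore at most \<theta>
  times its value at 1.\<close>

lemma prod_list_perturb: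
  fixes c e :: "int \<Rightarrow> real" and p q :: laurent
  assumes q: "\<And>a. cmod (lookup q a) \<le> c a" and pq: "\<And>a. cmod (lookup p a - lookup q a) \<le> \<theta> * e a"
    and e: "\<And>a. 0 \<le> e a" and \<theta>: "0 \<le> \<theta>" "\<theta> \<le> 1"
  shows "cmod ((\<Prod>a\<leftarrow>ns. lookup p a) - (\<Prod>a\<leftarrow>ns. lookup q a)) \<le> \<theta> * (\<Prod>a\<leftarrow>ns. c a + e a)"
proof -
  have c: "0 \<le> c a" for a using q[of a] norm_ge_zero order_trans by blast
  have ce: "0 \<le> c a + \<theta> * e a" for a using c[of a] e[of a] \<theta> by simp
  have p: "cmod (lookup p a) \<le> c a + \<theta> * e a" for a
    using norm_triangle_ineq[of "lookup q a" "lookup p a - lookup q a"] q[of a] pq[of a] by simp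
  have P: "cmod (\<Prod>a\<leftarrow>ns. lookup p a) \<le> (\<Prod>a\<leftarrow>ns. c a + \<theta> * e a)" for ns
    by (induction ns) (auto simp: norm_mult intro!: mult_mono p ce)
  have 1: "cmod ((\<Prod>a\<leftarrow>ns. lookup p a) - (\<Prod>a\<leftarrow>ns. lookup q a)) \<le> (\<Prod>a\<leftarrow>ns. c a + \<theta> * e a) - (\<Prod>a\<leftarrow>ns. c a)"
  proof (induction ns)
    case (Cons a ns)
    let ?P = "\<Prod>a\<leftarrow>ns. lookup p a" and ?Q = "\<Prod>a\<leftarrow>ns. lookup q a"
      and ?A = "\<Prod>a\<leftarrow>ns. c a + \<theta> * e a" and ?B = "\<Prod>a\<leftarrow>ns. c a"
    have "lookup p a * ?P - lookup q a * ?Q = (lookup p a - lookup q a) * ?P + lookup q a * (?P - ?Q)"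
      by (simp add: algebra_simps)
    then have "cmod (lookup p a * ?P - lookup q a * ?Q) \<le> cmod (lookup p a - lookup q a) * cmod ?P + cmod (lookup q a) * cmod (?P - ?Q)"
      by (metis norm_mult norm_triangle_ineq)
    also have "\<dots> \<le> (\<theta> * e a) * ?A + c a * (?A - ?B)"
      using e \<theta> by (intro add_mono mult_mono pq P q Cons c) auto
    also have "\<dots> = (c a + \<theta> * e a) * ?A - c a * ?B"
      by (simp add: algebra_simps)
    finally show ?case by simp
  qed simp
  have T: "(\<Prod>a\<leftarrow>ns. c a + \<theta> * e a) \<le> (\<Prod>a\<leftarrow>ns. c a + e a)" for ns
  proof (induction ns)
    case (Cons a ns)
    have "\<theta> * e a \<le> e a" using e[of a] \<theta> by (simp add: mult_left_le_one_le)
    then show ?case using Cons ce c e \<theta>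
      by (auto intro!: mult_mono prod_list_map_nonneg add_nonneg_nonneg)
  qed simp
  have 2: "(\<Prod>a\<leftarrow>ns. c a + \<theta> * e a) - (\<Prod>a\<leftarrow>ns. c a) \<le> \<theta> * ((\<Prod>a\<leftarrow>ns. c a + e a) - (\<Prod>a\<leftarrow>ns. c a))"
  proof (induction ns)
    case (Cons a ns)
    let ?A = "\<Prod>a\<leftarrow>ns. c a + \<theta> * e a" and ?B = "\<Prod>a\<leftarrow>ns. c a" and ?T = "\<Prod>a\<leftarrow>ns. c a + e a"
    have "(c a + \<theta> * e a) * ?A - c a * ?B = c a * (?A - ?B) + (\<theta> * e a) * ?A"
      by (simp add: algebra_simps)
    also have "\<dots> \<le> c a * (\<theta> * (?T - ?B)) + (\<theta> * e a) * ?T"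
      using e \<theta> by (intro add_mono mult_left_mono Cons c T) auto
    also have "\<dots> = \<theta> * ((c a + e a) * ?T - c a * ?B)"
      by (simp add: algebra_simps)
    finally show ?case by simp
  qed simp
  have "\<theta> * ((\<Prod>a\<leftarrow>ns. c a + e a) - (\<Prod>a\<leftarrow>ns. c a)) \<le> \<theta> * (\<Prod>a\<leftarrow>ns. c a + e a)"
    using \<theta>(1) prod_list_map_nonneg[of c ns] c by (intro mult_left_mono) auto
  with 1 2 show ?thesis by linarith
qed

text \<open>The difference p - q is divided by \<theta>, the multilinear bound is applied to |q| +
  |p - q| / \<theta>, and \<open>prod_list_perturb\<close> returns one factor \<theta>. A positive
  bound \<theta> in place of the norm itself keeps the division legitimate when p = q.\<close>

lemma form_lipschitz:
  assumes "form K (k + 2) X" and B: "0 \<le> B"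
  shows "\<exists>C\<ge>0. \<forall>l\<in>symbols K. \<forall>p q \<theta>. lookup p 0 = 0 \<longrightarrow> lookup q 0 = 0 \<longrightarrow> hnorm2 k q \<le> B \<longrightarrow>
     hnorm2 k (p - q) \<le> \<theta>\<^sup>2 \<longrightarrow> 0 < \<theta> \<longrightarrow> \<theta> \<le> 1 \<longrightarrow> cmod (lookup (X l p) 0 - lookup (X l q) 0) \<le> C * \<theta>"
  using assms(1)
proof (induction rule: form.induct)
  case form_0
  then show ?case by (intro exI[of _ 0]) auto
next
  case (form_step j X Y)
  from form_step(1) obtain D where j: "1 \<le> j" "j \<le> k + 2" and D: "D \<ge> 0" "\<forall>l\<in>symbols K. \<exists>m.
     (\<forall>ns. length ns = j \<longrightarrow> cmod (m ns) \<le> D * wsize ns ^ (k + 2 - j)) \<and>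
     (\<forall>A p. finite A \<longrightarrow> keys p \<subseteq> A \<longrightarrow>
        X l p = (\<Sum>ns\<in>words A j. Poly_Mapping.single (sum_list ns) (m ns * (\<Prod>a\<leftarrow>ns. lookup p a))))"
    unfolding hform_def by blast
  have "\<exists>C\<ge>0. \<forall>l\<in>symbols K. \<forall>p q \<theta>. lookup p 0 = 0 \<longrightarrow> lookup q 0 = 0 \<longrightarrow> hnorm2 k q \<le> B \<longrightarrow>
     hnorm2 k (p - q) \<le> \<theta>\<^sup>2 \<longrightarrow> 0 < \<theta> \<longrightarrow> \<theta> \<le> 1 \<longrightarrow> cmod (lookup (X l p) 0 - lookup (X l q) 0) \<le> C * \<theta>"
  proof (cases "j = 1")
    case True
    \<comment> \<open>A linear form sees in its zero mode only the zero mode of p. Degree one, where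
      no pair of letters is available, thus contributes nothing.\<close>
    have "lookup (X l p) 0 = 0" if l: "l \<in> symbols K" and p: "lookup p 0 = 0" for l p
    proof -
      from D(2) l obtain m where m: "\<And>A p. finite A \<Longrightarrow> keys p \<subseteq> A \<Longrightarrow>
        X l p = (\<Sum>ns\<in>words A 1. Poly_Mapping.single (sum_list ns) (m ns * (\<Prod>a\<leftarrow>ns. lookup p a)))"
        unfolding True by blast
      have "X l p = (\<Sum>a\<in>keys p. Poly_Mapping.single a (m [a] * lookup p a))"
        using m[of "keys p" p] by (simp add: sum_words_Suc)
      then have "lookup (X l p) 0 = (\<Sum>a\<in>keys p. lookup (Poly_Mapping.single a (m [a] * lookup p a)) 0)"
        by (simp add: lookup_sum)
      also have "\<dots> = 0"
        by (rule sum.neutral) (auto simp: lookup_single when_def p)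
      finally show ?thesis .
    qed
    then show ?thesis by (intro exI[of _ 0]) auto
  next
    case False
    with j have j2: "2 \<le> j" by simp
    obtain C where C: "0 \<le> C" "\<And>A d. finite A \<Longrightarrow> (\<And>a. 0 \<le> d a) \<Longrightarrow> (\<Sum>a\<in>A. wt k a * (d a)\<^sup>2) \<le> 2 * B + 2 \<Longrightarrow>
      (\<Sum>ns | ns \<in> words A j \<and> sum_list ns = 0. wsize ns ^ (k + 2 - j) * (\<Prod>a\<leftarrow>ns. d a)) \<le> C"
      using zero_sum_bound[OF j2 j(2), of "2 * B + 2"] B by auto
    have "cmod (lookup (X l p) 0 - lookup (X l q) 0) \<le> (D * C) * \<theta>"
      if l: "l \<in> symbols K" and qB: "hnorm2 k q \<le> B" and pq: "hnorm2 k (p - q) \<le> \<theta>\<^sup>2" and \<theta>: "0 < \<theta>" "\<theta> \<le> 1" for l p q \<theta>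
    proof -
      from D(2) l obtain m where m: "\<And>ns. length ns = j \<Longrightarrow> cmod (m ns) \<le> D * wsize ns ^ (k + 2 - j)"
        "\<And>A p. finite A \<Longrightarrow> keys p \<subseteq> A \<Longrightarrow>
          X l p = (\<Sum>ns\<in>words A j. Poly_Mapping.single (sum_list ns) (m ns * (\<Prod>a\<leftarrow>ns. lookup p a)))"
        by blast
      define A where "A = keys p \<union> keys q"
      have A: "finite A" "keys p \<subseteq> A" "keys q \<subseteq> A" "keys (p - q) \<subseteq> A"
        by (auto simp: A_def in_keys_iff lookup_minus)
      let ?S = "{ns. ns \<in> words A j \<and> sum_list ns = 0}"
      have rep: "lookup (X l r) 0 = (\<Sum>ns\<in>?S. m ns * (\<Prod>a\<leftarrow>ns. lookup r a))" if "keys r \<subseteq> A" for r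
        unfolding m(2)[OF A(1) that] lookup_sum lookup_single when_def
        using finite_words[OF A(1), of j] by (simp add: sum.inter_filter)
      define c where "c = (\<lambda>a. cmod (lookup q a))"
      \<comment> \<open>Normalised to weighted square sum at most 1; together with c this explains
        the bound 2 B + 2.\<close>
      define e where "e = (\<lambda>a. cmod (lookup (p - q) a) / \<theta>)"
      have c0: "0 \<le> c a" and e0: "0 \<le> e a" for a using \<theta> by (auto simp: c_def e_def)
      have "(\<Sum>a\<in>A. wt k a * (c a + e a)\<^sup>2) \<le> (\<Sum>a\<in>A. 2 * (wt k a * (c a)\<^sup>2) + 2 / \<theta>\<^sup>2 * (wt k a * (cmod (lookup (p - q) a))\<^sup>2))"
      proof (rule sum_mono)
        fix a
        have "(c a + e a)\<^sup>2 \<le> 2 * (c a)\<^sup>2 + 2 * (e a)\<^sup>2"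
          using sum_squares_bound[of "c a" "e a"] by (simp add: power2_sum)
        from mult_left_mono[OF this wt_nonneg[of k a]]
        show "wt k a * (c a + e a)\<^sup>2 \<le> 2 * (wt k a * (c a)\<^sup>2) + 2 / \<theta>\<^sup>2 * (wt k a * (cmod (lookup (p - q) a))\<^sup>2)"
          by (simp add: e_def power_divide algebra_simps)
      qed
      also have "\<dots> = 2 * hnorm2 k q + 2 / \<theta>\<^sup>2 * hnorm2 k (p - q)"
        by (simp add: sum.distrib sum_distrib_left hnorm2_eq[OF A(1,3)] hnorm2_eq[OF A(1,4)] c_def)
      also have "\<dots> \<le> 2 * B + 2 / \<theta>\<^sup>2 * \<theta>\<^sup>2"
        using qB pq by (intro add_mono mult_left_mono) auto
      also have "\<dots> = 2 * B + 2" using \<theta> by simp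
      finally have main: "(\<Sum>ns\<in>?S. wsize ns ^ (k + 2 - j) * (\<Prod>a\<leftarrow>ns. c a + e a)) \<le> C"
        using c0 e0 by (intro C(2)[OF A(1)]) auto
      have "cmod (lookup (X l p) 0 - lookup (X l q) 0)
        = cmod (\<Sum>ns\<in>?S. m ns * ((\<Prod>a\<leftarrow>ns. lookup p a) - (\<Prod>a\<leftarrow>ns. lookup q a)))"
        by (simp add: rep[OF A(2)] rep[OF A(3)] sum_subtractf right_diff_distrib)
      also have "\<dots> \<le> (\<Sum>ns\<in>?S. (D * wsize ns ^ (k + 2 - j)) * (\<theta> * (\<Prod>a\<leftarrow>ns. c a + e a)))"
      proof (rule sum_norm_le)
        fix ns assume "ns \<in> ?S"
        then have len: "length ns = j" by (simp add: words_def)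
        have "cmod ((\<Prod>a\<leftarrow>ns. lookup p a) - (\<Prod>a\<leftarrow>ns. lookup q a)) \<le> \<theta> * (\<Prod>a\<leftarrow>ns. c a + e a)"
          by (rule prod_list_perturb) (use \<theta> e0 in \<open>auto simp: c_def e_def lookup_minus\<close>)
        then show "cmod (m ns * ((\<Prod>a\<leftarrow>ns. lookup p a) - (\<Prod>a\<leftarrow>ns. lookup q a)))
           \<le> (D * wsize ns ^ (k + 2 - j)) * (\<theta> * (\<Prod>a\<leftarrow>ns. c a + e a))"
          unfolding norm_mult using m(1)[OF len] D(1) wsize_ge_1[of ns] by (intro mult_mono) auto
      qed
      also have "\<dots> = D * \<theta> * (\<Sum>ns\<in>?S. wsize ns ^ (k + 2 - j) * (\<Prod>a\<leftarrow>ns. c a + e a))"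
        by (simp add: sum_distrib_left mult_ac)
      also have "\<dots> \<le> D * \<theta> * C"
        using main D(1) \<theta> by (intro mult_left_mono) auto
      finally show ?thesis by (simp add: mult_ac)
    qed
    then show ?thesis using C(1) D(1) by (intro exI[of _ "D * C"]) auto
  qed
  then obtain C1 where C1: "C1 \<ge> 0" "\<And>l p q \<theta>. l \<in> symbols K \<Longrightarrow> lookup p 0 = 0 \<Longrightarrow> lookup q 0 = 0 \<Longrightarrow> hnorm2 k q \<le> B \<Longrightarrow>
     hnorm2 k (p - q) \<le> \<theta>\<^sup>2 \<Longrightarrow> 0 < \<theta> \<Longrightarrow> \<theta> \<le> 1 \<Longrightarrow> cmod (lookup (X l p) 0 - lookup (X l q) 0) \<le> C1 * \<theta>"
    by blast
  from form_step(3) obtain C2 where C2: "C2 \<ge> 0" "\<And>l p q \<theta>. l \<in> symbols K \<Longrightarrow> lookup p 0 = 0 \<Longrightarrow> lookup q 0 = 0 \<Longrightarrow> hnorm2 k q \<le> B \<Longrightarrow>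
     hnorm2 k (p - q) \<le> \<theta>\<^sup>2 \<Longrightarrow> 0 < \<theta> \<Longrightarrow> \<theta> \<le> 1 \<Longrightarrow> cmod (lookup (Y l p) 0 - lookup (Y l q) 0) \<le> C2 * \<theta>"
    by blast
  have "cmod (lookup (X l p + Y l p) 0 - lookup (X l q + Y l q) 0) \<le> (C1 + C2) * \<theta>"
    if "l \<in> symbols K" "lookup p 0 = 0" "lookup q 0 = 0" "hnorm2 k q \<le> B" "hnorm2 k (p - q) \<le> \<theta>\<^sup>2" "0 < \<theta>" "\<theta> \<le> 1"
    for l p q \<theta>
  proof -
    have "lookup (X l p + Y l p) 0 - lookup (X l q + Y l q) 0 =
       (lookup (X l p) 0 - lookup (X l q) 0) + (lookup (Y l p) 0 - lookup (Y l q) 0)"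
      by (simp add: lookup_add)
    then show ?thesis
      using norm_triangle_ineq[of "lookup (X l p) 0 - lookup (X l q) 0" "lookup (Y l p) 0 - lookup (Y l q) 0"]
        C1(2)[OF that] C2(2)[OF that] by (simp add: distrib_right)
  qed
  then show ?case using C1(1) C2(1) by (intro exI[of _ "C1 + C2"]) auto
qed

subsection \<open>Rapidly convergent trigonometric series\<close>

lemma laurent_expand:
  assumes "finite A" "keys p \<subseteq> A"
  shows "p = (\<Sum>n\<in>A. Poly_Mapping.single n (lookup p n))"
proof (rule poly_mapping_eqI)
  fix m
  have "lookup (\<Sum>n\<in>A. Poly_Mapping.single n (lookup p n)) m = (\<Sum>n\<in>A. if n = m then lookup p m else 0)"
    unfolding lookup_sum by (rule sum.cong) (auto simp: lookup_single when_def)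
  then show "lookup p m = lookup (\<Sum>n\<in>A. Poly_Mapping.single n (lookup p n)) m"
    using assms by (auto simp: in_keys_iff)
qed

lemma laurent_times_expand:
  "p * q = (\<Sum>n\<in>keys p. \<Sum>m\<in>keys q. Poly_Mapping.single (n + m) (lookup p n * lookup q m))"
proof -
  have "(\<Sum>n\<in>keys p. Poly_Mapping.single n (lookup p n)) * (\<Sum>m\<in>keys q. Poly_Mapping.single m (lookup q m)) =
     (\<Sum>n\<in>keys p. \<Sum>m\<in>keys q. Poly_Mapping.single (n + m) (lookup p n * lookup q m))"
    by (simp add: sum_product mult_single)
  then show ?thesis
    by (simp only: laurent_expand[OF finite_keys order_refl, symmetric])
qed

section \<open>Evaluation of Laurent polynomials on the line\<close>

definition leval :: "laurent \<Rightarrow> real \<Rightarrow> complex" where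
  "leval p x = (\<Sum>n\<in>keys p. lookup p n * cis (of_int n * x))"

lemma leval_eq:
  assumes "finite A" "keys p \<subseteq> A"
  shows "leval p x = (\<Sum>n\<in>A. lookup p n * cis (of_int n * x))"
  unfolding leval_def by (rule sum.mono_neutral_left) (use assms in \<open>auto simp: in_keys_iff\<close>)

lemma leval_0 [simp]: "leval 0 x = 0"
  by (simp add: leval_def)

lemma leval_add: "leval (p + q) x = leval p x + leval q x"
proof -
  have A: "finite (keys p \<union> keys q)" "keys p \<subseteq> keys p \<union> keys q" "keys q \<subseteq> keys p \<union> keys q"
    "keys (p + q) \<subseteq> keys p \<union> keys q"
    using Poly_Mapping.keys_add[of p q] by auto
  show ?thesis
    by (simp add: leval_eq[OF A(1,2)] leval_eq[OF A(1,3)] leval_eq[OF A(1,4)] lookup_add distrib_right sum.distrib)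
qed

lemma leval_uminus: "leval (- p) x = - leval p x"
  using leval_add[of p "- p" x] by (simp add: eq_neg_iff_add_eq_0 add.commute)

lemma leval_diff: "leval (p - q) x = leval p x - leval q x"
  using leval_add[of p "- q" x] by (simp add: leval_uminus)

lemma leval_sum: "leval (sum f A) x = (\<Sum>a\<in>A. leval (f a) x)"
  by (induction A rule: infinite_finite_induct) (auto simp: leval_add)

lemma leval_single [simp]: "leval (Poly_Mapping.single n c) x = c * cis (of_int n * x)"
  by (subst leval_eq[of "{n}"]) auto

lemma leval_times: "leval (p * q) x = leval p x * leval q x"
proof -
  have "leval (p * q) x = (\<Sum>n\<in>keys p. \<Sum>m\<in>keys q. lookup p n * lookup q m * cis (of_int (n + m) * x))"
    by (subst laurent_times_expand) (simp add: leval_sum)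
  also have "\<dots> = leval p x * leval q x"
    unfolding leval_def sum_product by (intro sum.cong refl) (simp add: cis_mult[symmetric] distrib_right)
  finally show ?thesis .
qed

lemma leval_1 [simp]: "leval 1 x = 1"
  using leval_single[of 0 1 x] by simp

text \<open>The norm of a weighted Wiener algebra: submultiplicative, above the supremum norm, and
  losing one order per symbol of linear growth.\<close>

definition wnorm :: "nat \<Rightarrow> laurent \<Rightarrow> real" where
  "wnorm s p = (\<Sum>n\<in>keys p. jb n ^ s * cmod (lookup p n))"

lemma wnorm_eq:
  assumes "finite A" "keys p \<subseteq> A"
  shows "wnorm s p = (\<Sum>n\<in>A. jb n ^ s * cmod (lookup p n))"
  unfolding wnorm_def by (rule sum.mono_neutral_left) (use assms in \<open>auto simp: in_keys_iff\<close>)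

lemma wnorm_nonneg: "0 \<le> wnorm s p"
  unfolding wnorm_def by (intro sum_nonneg) auto

lemma wnorm_0 [simp]: "wnorm s 0 = 0"
  by (simp add: wnorm_def)

lemma wnorm_add: "wnorm s (p + q) \<le> wnorm s p + wnorm s q"
proof -
  have A: "finite (keys p \<union> keys q)" "keys p \<subseteq> keys p \<union> keys q" "keys q \<subseteq> keys p \<union> keys q"
    "keys (p + q) \<subseteq> keys p \<union> keys q"
    using Poly_Mapping.keys_add[of p q] by auto
  show ?thesis
    unfolding wnorm_eq[OF A(1,2)] wnorm_eq[OF A(1,3)] wnorm_eq[OF A(1,4)] lookup_add sum.distrib[symmetric]
      distrib_left[symmetric]
    by (intro sum_mono mult_left_mono norm_triangle_ineq) auto
qed

lemma wnorm_sum: "wnorm s (sum f A) \<le> (\<Sum>a\<in>A. wnorm s (f a))"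
proof (induction A rule: infinite_finite_induct)
  case (insert a A)
  then show ?case using wnorm_add[of s "f a" "sum f A"] by simp
qed auto

lemma wnorm_single [simp]: "wnorm s (Poly_Mapping.single n c) = jb n ^ s * cmod c"
  by (subst wnorm_eq[of "{n}"]) auto

lemma wnorm_times: "wnorm s (p * q) \<le> wnorm s p * wnorm s q"
proof -
  have "wnorm s (p * q) \<le> (\<Sum>n\<in>keys p. \<Sum>m\<in>keys q. wnorm s (Poly_Mapping.single (n + m) (lookup p n * lookup q m)))"
    by (subst laurent_times_expand) (rule order.trans[OF wnorm_sum sum_mono[OF wnorm_sum]])
  also have "\<dots> \<le> (\<Sum>n\<in>keys p. \<Sum>m\<in>keys q. (jb n ^ s * cmod (lookup p n)) * (jb m ^ s * cmod (lookup q m)))"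
  proof (intro sum_mono)
    fix n m
    have "jb (n + m) \<le> jb n * jb m"
      by (auto simp: algebra_simps intro: order.trans[OF abs_triangle_ineq])
    then have "(jb (n + m)) ^ s \<le> (jb n * jb m) ^ s"
      by (intro power_mono) auto
    from mult_right_mono[OF this, of "cmod (lookup p n) * cmod (lookup q m)"]
    show "wnorm s (Poly_Mapping.single (n + m) (lookup p n * lookup q m)) \<le>
       (jb n ^ s * cmod (lookup p n)) * (jb m ^ s * cmod (lookup q m))"
      by (simp add: norm_mult power_mult_distrib mult_ac)
  qed
  also have "\<dots> = wnorm s p * wnorm s q"
    by (simp add: wnorm_def sum_product)
  finally show ?thesis .
qed

lemma wnorm_mult_op:
  assumes "m \<in> symbols K"
  shows "wnorm s (mult_op m p) \<le> K * wnorm (Suc s) p"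
proof -
  have "wnorm s (mult_op m p) = (\<Sum>n\<in>keys p. jb n ^ s * cmod (m n * lookup p n))"
    using keys_mult_op by (subst wnorm_eq[of "keys p"]) auto
  also have "\<dots> \<le> (\<Sum>n\<in>keys p. K * (jb n ^ Suc s * cmod (lookup p n)))"
  proof (intro sum_mono)
    fix n
    have "jb n ^ s * (cmod (m n) * cmod (lookup p n)) \<le>
       jb n ^ s * ((K * jb n) * cmod (lookup p n))"
      using assms by (intro mult_left_mono mult_right_mono) (auto simp: symbols_def)
    then show "jb n ^ s * cmod (m n * lookup p n) \<le> K * (jb n ^ Suc s * cmod (lookup p n))"
      by (simp add: norm_mult mult_ac)
  qed
  finally show ?thesis by (simp add: wnorm_def sum_distrib_left)
qed

lemma norm_leval: "cmod (leval p x) \<le> wnorm 0 p"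
  unfolding leval_def wnorm_def by (rule sum_norm_le) (simp add: norm_mult)

text \<open>States that f lies in the completion for \<open>wnorm s\<close>, with an explicit
  approximating sequence. Carrying the sequence along transfers each operation on functions to the
  same operation on Laurent polynomials.\<close>

definition approx :: "nat \<Rightarrow> (real \<Rightarrow> complex) \<Rightarrow> (nat \<Rightarrow> laurent) \<Rightarrow> bool" where
  "approx s f p \<longleftrightarrow> (\<forall>\<epsilon>>0. \<exists>N0. \<forall>M\<ge>N0. \<forall>N\<ge>N0. wnorm s (p M - p N) < \<epsilon>) \<and>
     (\<forall>x. (\<lambda>N. leval (p N) x) \<longlonglongrightarrow> f x)"

lemma approxD: "approx s f p \<Longrightarrow> 0 < \<epsilon> \<Longrightarrow> \<exists>N0. \<forall>M\<ge>N0. \<forall>N\<ge>N0. wnorm s (p M - p N) < \<epsilon>"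
  by (simp add: approx_def)

lemma approx_lim: "approx s f p \<Longrightarrow> (\<lambda>N. leval (p N) x) \<longlonglongrightarrow> f x"
  by (simp add: approx_def)

lemma wnorm_mono: "s \<le> s' \<Longrightarrow> wnorm s p \<le> wnorm s' p"
  unfolding wnorm_def by (intro sum_mono mult_right_mono power_increasing) auto

lemma approx_mono: "approx s' f p \<Longrightarrow> s \<le> s' \<Longrightarrow> approx s f p"
  unfolding approx_def by (meson le_less_trans wnorm_mono)

lemma approx_bounded:
  assumes "approx s f p"
  obtains B where "0 < B" "\<And>N. wnorm s (p N) \<le> B"
proof -
  obtain N0 where N0: "\<And>M N. M \<ge> N0 \<Longrightarrow> N \<ge> N0 \<Longrightarrow> wnorm s (p M - p N) < 1"
    using approxD[OF assms, of 1] by auto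
  define B where "B = wnorm s (p N0) + 1 + (\<Sum>N\<le>N0. wnorm s (p N))"
  have "wnorm s (p N) \<le> B" for N
  proof (cases "N \<le> N0")
    case True
    then have "wnorm s (p N) \<le> (\<Sum>N\<le>N0. wnorm s (p N))"
      by (intro member_le_sum) (auto simp: wnorm_nonneg)
    then show ?thesis using wnorm_nonneg[of s "p N0"] by (simp add: B_def)
  next
    case False
    have "wnorm s (p N) \<le> wnorm s (p N - p N0) + wnorm s (p N0)"
      using wnorm_add[of s "p N - p N0" "p N0"] by simp
    also have "\<dots> \<le> 1 + wnorm s (p N0)" using N0[of N N0] False by simp
    also have "\<dots> \<le> B" unfolding B_def by (simp add: sum_nonneg wnorm_nonneg)
    finally show ?thesis .
  qed
  moreover have "0 < B"
    using wnorm_nonneg sum_nonneg[of "{..N0}" "\<lambda>N. wnorm s (p N)"] by (simp add: B_def add_pos_nonneg add_nonneg_pos)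
  ultimately show ?thesis using that by blast
qed

lemma approx_const: "approx s (\<lambda>x. leval p x) (\<lambda>N. p)"
  by (simp add: approx_def)

lemma approx_add:
  assumes "approx s f p" "approx s g q"
  shows "approx s (\<lambda>x. f x + g x) (\<lambda>N. p N + q N)"
  unfolding approx_def leval_add
proof (intro conjI allI impI tendsto_add approx_lim[OF assms(1)] approx_lim[OF assms(2)])
  fix \<epsilon> :: real assume \<epsilon>: "0 < \<epsilon>"
  obtain N1 where N1: "\<And>M N. M \<ge> N1 \<Longrightarrow> N \<ge> N1 \<Longrightarrow> wnorm s (p M - p N) < \<epsilon> / 2"
    using approxD[OF assms(1), of "\<epsilon> / 2"] \<epsilon> by auto
  obtain N2 where N2: "\<And>M N. M \<ge> N2 \<Longrightarrow> N \<ge> N2 \<Longrightarrow> wnorm s (q M - q N) < \<epsilon> / 2"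
    using approxD[OF assms(2), of "\<epsilon> / 2"] \<epsilon> by auto
  show "\<exists>N0. \<forall>M\<ge>N0. \<forall>N\<ge>N0. wnorm s (p M + q M - (p N + q N)) < \<epsilon>"
  proof (intro exI[of _ "max N1 N2"] allI impI)
    fix M N assume MN: "max N1 N2 \<le> M" "max N1 N2 \<le> N"
    have "wnorm s (p M + q M - (p N + q N)) \<le> wnorm s (p M - p N) + wnorm s (q M - q N)"
      using wnorm_add[of s "p M - p N" "q M - q N"] by (simp add: algebra_simps)
    then show "wnorm s (p M + q M - (p N + q N)) < \<epsilon>"
      using N1[of M N] N2[of M N] MN by simp
  qed
qed

lemma approx_times:
  assumes "approx s f p" "approx s g q"
  shows "approx s (\<lambda>x. f x * g x) (\<lambda>N. p N * q N)"
  unfolding approx_def leval_times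
proof (intro conjI allI impI tendsto_mult approx_lim[OF assms(1)] approx_lim[OF assms(2)])
  fix \<epsilon> :: real assume \<epsilon>: "0 < \<epsilon>"
  obtain A where A: "0 < A" "\<And>N. wnorm s (p N) \<le> A" using approx_bounded[OF assms(1)] by metis
  obtain B where B: "0 < B" "\<And>N. wnorm s (q N) \<le> B" using approx_bounded[OF assms(2)] by metis
  obtain N1 where N1: "\<And>M N. M \<ge> N1 \<Longrightarrow> N \<ge> N1 \<Longrightarrow> wnorm s (p M - p N) < \<epsilon> / (2 * B)"
    using approxD[OF assms(1), of "\<epsilon> / (2 * B)"] \<epsilon> B by auto
  obtain N2 where N2: "\<And>M N. M \<ge> N2 \<Longrightarrow> N \<ge> N2 \<Longrightarrow> wnorm s (q M - q N) < \<epsilon> / (2 * A)"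
    using approxD[OF assms(2), of "\<epsilon> / (2 * A)"] \<epsilon> A by auto
  show "\<exists>N0. \<forall>M\<ge>N0. \<forall>N\<ge>N0. wnorm s (p M * q M - p N * q N) < \<epsilon>"
  proof (intro exI[of _ "max N1 N2"] allI impI)
    fix M N assume MN: "max N1 N2 \<le> M" "max N1 N2 \<le> N"
    have "p M * q M - p N * q N = (p M - p N) * q M + p N * (q M - q N)"
      by (simp add: algebra_simps)
    then have "wnorm s (p M * q M - p N * q N) \<le> wnorm s (p M - p N) * wnorm s (q M) + wnorm s (p N) * wnorm s (q M - q N)"
      using wnorm_add[of s "(p M - p N) * q M" "p N * (q M - q N)"] wnorm_times[of s "p M - p N" "q M"]
        wnorm_times[of s "p N" "q M - q N"] by simp
    also have "\<dots> \<le> wnorm s (p M - p N) * B + A * wnorm s (q M - q N)"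
      using A B by (intro add_mono mult_left_mono mult_right_mono) (auto simp: wnorm_nonneg)
    also have "\<dots> < \<epsilon> / (2 * B) * B + A * (\<epsilon> / (2 * A))"
      using N1[of M N] N2[of M N] MN A B by (intro add_strict_mono mult_strict_left_mono mult_strict_right_mono) auto
    also have "\<dots> = \<epsilon>" using A B by simp
    finally show "wnorm s (p M * q M - p N * q N) < \<epsilon>" .
  qed
qed

lemma approx_cst: "approx s f p \<Longrightarrow> approx s (\<lambda>x. c * f x) (\<lambda>N. cst c * p N)"
  using approx_times[OF approx_const[of s "cst c"], of f p] by simp

lemma approx_uminus: "approx s f p \<Longrightarrow> approx s (\<lambda>x. - f x) (\<lambda>N. - p N)"
  using approx_cst[of s f p "-1"] by (simp add: single_uminus)

lemma approx_diff: "approx s f p \<Longrightarrow> approx s g q \<Longrightarrow> approx s (\<lambda>x. f x - g x) (\<lambda>N. p N - q N)"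
  using approx_add[OF _ approx_uminus, of s f p g q] by simp

lemma approx_sum:
  "(\<And>i. i \<in> I \<Longrightarrow> approx s (f i) (p i)) \<Longrightarrow> approx s (\<lambda>x. \<Sum>i\<in>I. f i x) (\<lambda>N. \<Sum>i\<in>I. p i N)"
proof (induction I rule: infinite_finite_induct)
  case (insert i I)
  then show ?case by (auto intro: approx_add)
qed (use approx_const[of s 0] in auto)

lemma approx_prod_list:
  "(\<And>m. m \<in> set ms \<Longrightarrow> approx s (f m) (p m)) \<Longrightarrow> approx s (\<lambda>x. \<Prod>m\<leftarrow>ms. f m x) (\<lambda>N. \<Prod>m\<leftarrow>ms. p m N)"
proof (induction ms)
  case Nil
  then show ?case using approx_const[of s 1] by simp
next
  case (Cons m ms)
  then show ?case by (auto intro: approx_times)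
qed

lemma approx_exists:
  assumes "\<And>\<epsilon>. 0 < \<epsilon> \<Longrightarrow> \<exists>N0. \<forall>M\<ge>N0. \<forall>N\<ge>N0. wnorm s (p M - p N) < \<epsilon>"
  shows "approx s (\<lambda>x. lim (\<lambda>N. leval (p N) x)) p"
proof -
  have "Cauchy (\<lambda>N. leval (p N) x)" for x
    unfolding Cauchy_def
  proof (intro allI impI)
    fix e :: real assume "e > 0"
    then obtain N0 where N0: "\<forall>M\<ge>N0. \<forall>N\<ge>N0. wnorm s (p M - p N) < e" using assms by blast
    have le: "dist (leval (p M) x) (leval (p N) x) \<le> wnorm s (p M - p N)" for M N
      using norm_leval[of "p M - p N" x] wnorm_mono[of 0 s "p M - p N"] by (simp add: dist_norm leval_diff)
    show "\<exists>N0. \<forall>M\<ge>N0. \<forall>N\<ge>N0. dist (leval (p M) x) (leval (p N) x) < e"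
      by (intro exI[of _ N0] allI impI, rule le_less_trans[OF le]) (use N0 in blast)
  qed
  then show ?thesis
    using assms by (simp add: approx_def Cauchy_convergent_iff convergent_LIMSEQ_iff)
qed

lemma approx_uniform:
  assumes "approx s f p" and "0 < \<epsilon>"
  obtains N0 where "\<And>N x. N \<ge> N0 \<Longrightarrow> cmod (f x - leval (p N) x) \<le> \<epsilon>"
proof -
  obtain N0 where N0: "\<And>M N. M \<ge> N0 \<Longrightarrow> N \<ge> N0 \<Longrightarrow> wnorm 0 (p M - p N) < \<epsilon>"
    using approxD[OF approx_mono[OF assms(1)] assms(2), of 0] by auto
  have "cmod (f x - leval (p N) x) \<le> \<epsilon>" if N: "N \<ge> N0" for N x
  proof (rule tendsto_upperbound)
    show "((\<lambda>M. cmod (leval (p M) x - leval (p N) x)) \<longlonglongrightarrow> cmod (f x - leval (p N) x))"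
      by (intro tendsto_intros approx_lim[OF assms(1)])
    show "\<forall>\<^sub>F M in sequentially. cmod (leval (p M) x - leval (p N) x) \<le> \<epsilon>"
    proof (rule eventually_sequentiallyI)
      fix M assume "M \<ge> N0"
      then show "cmod (leval (p M) x - leval (p N) x) \<le> \<epsilon>"
        using norm_leval[of "p M - p N" x] N0[of M N] N by (simp add: leval_diff)
    qed
  qed simp
  then show ?thesis using that by blast
qed

lemma continuous_leval: "continuous_on S (leval p)"
  unfolding leval_def by (intro continuous_intros)

lemma leval_periodic: "leval p (x + 2 * pi) = leval p x"
proof -
  have "cis (of_int n * (x + 2 * pi)) = cis (of_int n * x)" for n
  proof -
    have "cis (of_int n * (x + 2 * pi)) = cis (of_int n * x) * cis (2 * pi * of_int n)"
      by (simp add: cis_mult algebra_simps)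
    then show ?thesis by (simp add: cis_multiple_2pi)
  qed
  then show ?thesis by (simp add: leval_def)
qed

lemma approx_continuous:
  assumes "approx s f p"
  shows "continuous_on S f"
proof (rule uniform_limit_theorem)
  show "\<forall>\<^sub>F N in sequentially. continuous_on S (leval (p N))"
    by (simp add: continuous_leval)
  show "uniform_limit S (\<lambda>N. leval (p N)) f sequentially"
  proof (rule uniform_limitI)
    fix e :: real assume "e > 0"
    then obtain N0 where "\<And>N x. N \<ge> N0 \<Longrightarrow> cmod (f x - leval (p N) x) \<le> e / 2"
      using approx_uniform[OF assms, of "e / 2"] by auto
    note N0 = this
    have "dist (leval (p n) x) (f x) < e" if "n \<ge> N0" for n x
      using N0[OF that, of x] \<open>e > 0\<close> by (simp add: dist_norm norm_minus_commute)
    then show "\<forall>\<^sub>F n in sequentially. \<forall>x\<in>S. dist (leval (p n) x) (f x) < e"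
      by (intro eventually_sequentiallyI[of N0]) auto
  qed
qed simp

lemma leval_has_vector_derivative: "(leval p has_vector_derivative leval (ddx p) x) (at x)"
proof -
  have eq: "leval (ddx p) x = (\<Sum>n\<in>keys p. lookup p n * (of_int n * (\<i> * cis (of_int n * x))))"
    by (subst leval_eq[of "keys p"]) (use keys_mult_op in \<open>auto simp: mult_ac\<close>)
  have cis: "((\<lambda>x. cis (of_int n * x)) has_vector_derivative (of_int n * (\<i> * cis (of_int n * x)))) (at x)" for n
  proof -
    have "((\<lambda>x. cis (of_int n * x)) has_derivative (\<lambda>t. t *\<^sub>R (of_int n * (\<i> * cis (of_int n * x))))) (at x)"
      by (rule derivative_eq_intros refl)+ (auto simp: scaleR_conv_of_real)
    then show ?thesis by (simp add: has_vector_derivative_def)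
  qed
  show ?thesis
    unfolding eq unfolding leval_def
    by (intro has_vector_derivative_sum has_vector_derivative_mult_right cis)
qed

lemma symbols_ddx: "(\<lambda>n. \<i> * of_int n) \<in> symbols 1"
  by (auto simp: symbols_def norm_mult)

lemma wcauchy_mult_op:
  assumes "approx (Suc s) f p" and m: "m \<in> symbols K" and \<epsilon>: "0 < \<epsilon>"
  shows "\<exists>N0. \<forall>M\<ge>N0. \<forall>N\<ge>N0. wnorm s (mult_op m (p M) - mult_op m (p N)) < \<epsilon>"
proof -
  have K: "K \<ge> 0"
  proof -
    have "cmod (m 0) \<le> K" using m by (auto simp: symbols_def dest: spec[of _ 0])
    then show ?thesis using norm_ge_zero order_trans by blast
  qed
  obtain N0 where N0: "\<And>M N. M \<ge> N0 \<Longrightarrow> N \<ge> N0 \<Longrightarrow> wnorm (Suc s) (p M - p N) < \<epsilon> / (K + 1)"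
    using approxD[OF assms(1), of "\<epsilon> / (K + 1)"] \<epsilon> K by auto
  show ?thesis
  proof (intro exI[of _ N0] allI impI)
    fix M N assume "M \<ge> N0" "N \<ge> N0"
    have "wnorm s (mult_op m (p M) - mult_op m (p N)) \<le> K * wnorm (Suc s) (p M - p N)"
      using wnorm_mult_op[OF m, of s "p M - p N"] by (simp add: mult_op_diff)
    also have "\<dots> \<le> K * (\<epsilon> / (K + 1))"
      using N0[OF \<open>M \<ge> N0\<close> \<open>N \<ge> N0\<close>] K by (intro mult_left_mono) auto
    also have "\<dots> < \<epsilon>" using K \<epsilon> by (simp add: field_simps)
    finally show "wnorm s (mult_op m (p M) - mult_op m (p N)) < \<epsilon>" .
  qed
qed

text \<open>Termwise differentiation: the differentiated polynomials are Cauchy in a norm above the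
  supremum norm, so they converge uniformly.\<close>

lemma approx_Dx:
  assumes "approx (Suc s) f p"
  shows "approx s (Dx f) (\<lambda>N. ddx (p N))" "(f has_vector_derivative Dx f x) (at x)"
proof -
  define g' where "g' = (\<lambda>x. lim (\<lambda>N. leval (ddx (p N)) x))"
  have ap: "approx s g' (\<lambda>N. ddx (p N))"
    unfolding g'_def by (rule approx_exists) (rule wcauchy_mult_op[OF assms symbols_ddx])
  have "\<exists>g. \<forall>x\<in>UNIV. (\<lambda>n. leval (p n) x) \<longlonglongrightarrow> g x \<and> (g has_derivative (\<lambda>h. h *\<^sub>R g' x)) (at x within UNIV)"
  proof (rule has_derivative_sequence)
    show "\<And>n x. x \<in> UNIV \<Longrightarrow> (leval (p n) has_derivative (\<lambda>h. h *\<^sub>R leval (ddx (p n)) x)) (at x within UNIV)"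
      using leval_has_vector_derivative by (simp add: has_vector_derivative_def)
    show "\<forall>\<^sub>F n in sequentially. \<forall>x\<in>UNIV. \<forall>h. norm (h *\<^sub>R leval (ddx (p n)) x - h *\<^sub>R g' x) \<le> e * norm h" if e: "0 < e" for e
    proof -
      obtain N0 where N0: "\<And>N x. N \<ge> N0 \<Longrightarrow> cmod (g' x - leval (ddx (p N)) x) \<le> e"
        using approx_uniform[OF ap e] by metis
      show ?thesis
      proof (rule eventually_sequentiallyI[of N0], intro ballI allI)
        fix n x h assume "N0 \<le> n"
        have "norm (h *\<^sub>R leval (ddx (p n)) x - h *\<^sub>R g' x) = \<bar>h\<bar> * cmod (g' x - leval (ddx (p n)) x)"
          by (simp flip: scaleR_diff_right add: norm_minus_commute)
        also have "\<dots> \<le> \<bar>h\<bar> * e" using N0[OF \<open>N0 \<le> n\<close>] by (intro mult_left_mono) auto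
        finally show "norm (h *\<^sub>R leval (ddx (p n)) x - h *\<^sub>R g' x) \<le> e * norm h" by (simp add: mult.commute)
      qed
    qed
    show "(0::real) \<in> UNIV" "(\<lambda>n. leval (p n) 0) \<longlonglongrightarrow> f 0" using approx_lim[OF assms] by auto
  qed auto
  then obtain g where g: "\<And>x. (\<lambda>n. leval (p n) x) \<longlonglongrightarrow> g x" "\<And>x. (g has_derivative (\<lambda>h. h *\<^sub>R g' x)) (at x)"
    by auto
  have "g = f"
    using LIMSEQ_unique[OF g(1) approx_lim[OF assms]] by (simp add: fun_eq_iff)
  then have d: "(f has_vector_derivative g' x) (at x)" for x
    using g(2) by (simp add: has_vector_derivative_def)
  then have "Dx f = g'"
    by (auto simp: Dx_def fun_eq_iff intro: vector_derivative_at)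
  then show "approx s (Dx f) (\<lambda>N. ddx (p N))" "(f has_vector_derivative Dx f x) (at x)"
    using ap d by simp_all
qed

section \<open>Integrals over the torus and Fourier coefficients\<close>

lemma torus_integral:
  fixes f :: "real \<Rightarrow> 'b::euclidean_space"
  assumes "continuous_on {0..2*pi} f"
  shows "integrable torus f" "integral\<^sup>L torus f = integral {0..2*pi} f"
  using continuous_imp_integrable_real[OF assms] by (auto intro: lebesgue_integral_eq_integral)

lemma torus_FTC:
  fixes f :: "real \<Rightarrow> 'b::euclidean_space"
  assumes "\<And>x. (F has_vector_derivative f x) (at x)" "continuous_on {0..2*pi} f"
  shows "integral\<^sup>L torus f = F (2 * pi) - F 0"
proof -
  have "(f has_integral (F (2 * pi) - F 0)) {0..2*pi}"
    using assms(1) by (intro fundamental_theorem_of_calculus) (auto intro: has_vector_derivative_at_within)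
  then show ?thesis using torus_integral[OF assms(2)] by (simp add: integral_unique)
qed

lemma cis_has_vector_derivative:
  "((\<lambda>x. cis (a * x)) has_vector_derivative (\<i> * of_real a * cis (a * x))) (at x)"
proof -
  have "((\<lambda>x. cis (a * x)) has_derivative (\<lambda>t. t *\<^sub>R (\<i> * of_real a * cis (a * x)))) (at x)"
    by (rule derivative_eq_intros refl)+ (auto simp: scaleR_conv_of_real)
  then show ?thesis by (simp add: has_vector_derivative_def)
qed

lemma cis_int_2pi: "cis (of_int n * (2 * pi)) = 1"
  using cis_multiple_2pi[of "of_int n"] by (simp add: mult.commute)

lemma torus_integral_cis: "integral\<^sup>L torus (\<lambda>x. cis (of_int n * x)) = (if n = 0 then 2 * pi else 0)"
proof (cases "n = 0")
  case True
  then show ?thesis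
    by (subst torus_integral) (auto intro!: continuous_intros simp: scaleR_conv_of_real)
next
  case False
  have "integral\<^sup>L torus (\<lambda>x. cis (of_int n * x)) =
     cis (of_int n * (2 * pi)) / (\<i> * of_int n) - cis (of_int n * 0) / (\<i> * of_int n)"
  proof (rule torus_FTC)
    fix x
    show "((\<lambda>x. cis (of_int n * x) / (\<i> * of_int n)) has_vector_derivative cis (of_int n * x)) (at x)"
      using has_vector_derivative_divide[OF cis_has_vector_derivative[of "of_int n" x], of "\<i> * of_int n"] False by simp
  qed (intro continuous_intros)
  then show ?thesis using False by (simp only: cis_int_2pi) simp
qed

lemma continuous_times_cis:
  "continuous_on S f \<Longrightarrow> continuous_on S (\<lambda>x. f x * cis (- (of_int n * x)))"
  by (intro continuous_intros)

lemma fourier_coeff_bound: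
  assumes "continuous_on {0..2*pi} f" "\<And>x. x \<in> {0..2*pi} \<Longrightarrow> cmod (f x) \<le> e"
  shows "cmod (fourier_coeff f n) \<le> e"
proof -
  have "cmod (integral\<^sup>L torus (\<lambda>x. f x * cis (- (of_int n * x)))) \<le> e * (2 * pi - 0)"
    unfolding torus_integral(2)[OF continuous_times_cis[OF assms(1)]]
    by (rule integral_bound) (use assms continuous_times_cis in \<open>auto simp: norm_mult\<close>)
  then show ?thesis
    by (simp add: fourier_coeff_def norm_divide field_simps)
qed

lemma fourier_coeff_diff:
  assumes "continuous_on {0..2*pi} f" "continuous_on {0..2*pi} g"
  shows "fourier_coeff (\<lambda>x. f x - g x) n = fourier_coeff f n - fourier_coeff g n"
  unfolding fourier_coeff_def left_diff_distrib
  by (subst Bochner_Integration.integral_diff)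
    (use assms in \<open>auto intro!: torus_integral continuous_times_cis simp: diff_divide_distrib\<close>)

lemma fourier_coeff_leval: "fourier_coeff (leval p) n = lookup p n"
proof -
  have eq: "leval p x * cis (- (of_int n * x)) = (\<Sum>m\<in>keys p. lookup p m * cis (of_int (m - n) * x))" for x
    unfolding leval_def sum_distrib_right by (intro sum.cong refl) (simp add: mult.assoc cis_mult algebra_simps)
  have "integral\<^sup>L torus (\<lambda>x. leval p x * cis (- (of_int n * x))) =
     (\<Sum>m\<in>keys p. lookup p m * integral\<^sup>L torus (\<lambda>x. cis (of_int (m - n) * x)))"
    unfolding eq
    by (subst Bochner_Integration.integral_sum) (auto intro!: torus_integral continuous_intros)
  also have "\<dots> = (\<Sum>m\<in>keys p. if m = n then lookup p n * (2 * pi) else 0)"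
    unfolding torus_integral_cis by (intro sum.cong) auto
  also have "\<dots> = lookup p n * (2 * pi)" by (simp add: in_keys_iff)
  finally show ?thesis by (simp add: fourier_coeff_def)
qed

lemma approx_fourier_coeff:
  assumes "approx s f p"
  shows "(\<lambda>N. lookup (p N) n) \<longlonglongrightarrow> fourier_coeff f n"
proof (rule LIMSEQ_I)
  fix r :: real assume r: "0 < r"
  obtain N0 where N0: "\<And>N x. N \<ge> N0 \<Longrightarrow> cmod (f x - leval (p N) x) \<le> r / 2"
    using approx_uniform[OF assms, of "r / 2"] r by auto
  show "\<exists>N0. \<forall>N\<ge>N0. cmod (lookup (p N) n - fourier_coeff f n) < r"
  proof (intro exI[of _ N0] allI impI)
    fix N assume N: "N \<ge> N0"
    have "cmod (fourier_coeff (\<lambda>x. f x - leval (p N) x) n) \<le> r / 2"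
      by (rule fourier_coeff_bound) (use N0[OF N] approx_continuous[OF assms] continuous_leval in \<open>auto intro!: continuous_on_diff\<close>)
    then show "cmod (lookup (p N) n - fourier_coeff f n) < r"
      using r by (simp add: fourier_coeff_diff approx_continuous[OF assms] continuous_leval fourier_coeff_leval norm_minus_commute)
  qed
qed

text \<open>Lower semicontinuity of the weighted sum: for finite F the limit in M can be taken
  inside, and the bound does not depend on F.\<close>

lemma approx_coeff_tail:
  assumes "approx s f p" "0 < \<epsilon>"
  obtains N0 where "\<And>N F. N \<ge> N0 \<Longrightarrow> finite F \<Longrightarrow>
    (\<Sum>n\<in>F. jb n ^ s * cmod (fourier_coeff f n - lookup (p N) n)) \<le> \<epsilon>"
proof -
  obtain N0 where N0: "\<And>M N. M \<ge> N0 \<Longrightarrow> N \<ge> N0 \<Longrightarrow> wnorm s (p M - p N) < \<epsilon>"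
    using approxD[OF assms] by auto
  have "(\<Sum>n\<in>F. jb n ^ s * cmod (fourier_coeff f n - lookup (p N) n)) \<le> \<epsilon>"
    if N: "N \<ge> N0" and F: "finite F" for N F
  proof (rule tendsto_upperbound)
    show "((\<lambda>M. \<Sum>n\<in>F. jb n ^ s * cmod (lookup (p M) n - lookup (p N) n)) \<longlongrightarrow>
      (\<Sum>n\<in>F. jb n ^ s * cmod (fourier_coeff f n - lookup (p N) n))) sequentially"
      by (intro tendsto_intros approx_fourier_coeff[OF assms(1)])
    show "\<forall>\<^sub>F M in sequentially. (\<Sum>n\<in>F. jb n ^ s * cmod (lookup (p M) n - lookup (p N) n)) \<le> \<epsilon>"
    proof (rule eventually_sequentiallyI)
      fix M assume M: "M \<ge> N0"
      let ?q = "p M - p N"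
      have "(\<Sum>n\<in>F. jb n ^ s * cmod (lookup ?q n)) \<le> (\<Sum>n\<in>F \<union> keys ?q. jb n ^ s * cmod (lookup ?q n))"
        using F by (intro sum_mono2) auto
      also have "\<dots> = wnorm s ?q"
        using F by (subst wnorm_eq[of "F \<union> keys ?q"]) auto
      finally show "(\<Sum>n\<in>F. jb n ^ s * cmod (lookup (p M) n - lookup (p N) n)) \<le> \<epsilon>"
        using N0[OF M N] by (simp add: lookup_minus)
    qed
  qed simp
  then show ?thesis using that by blast
qed

lemma symbols_nonneg: "m \<in> symbols K \<Longrightarrow> 0 \<le> K"
  by (auto simp: symbols_def dest!: spec[of _ 0] intro: order.trans[OF norm_ge_zero])

text \<open>The multiplier on functions is an unordered infinite sum, so absolute summability has to
  be known before its value means anything. The symbol grows linearly, which costs one order of the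
  norm.\<close>

lemma approx_fourier_multiplier:
  assumes f: "approx (Suc s) f p" and m: "m \<in> symbols K"
  shows "approx s (fourier_multiplier m f) (\<lambda>N. mult_op m (p N))"
proof -
  let ?c = "fourier_coeff f"
  have K: "0 \<le> K" by (rule symbols_nonneg[OF m])
  have mb: "cmod (m n) \<le> K * jb n" for n using m by (simp add: symbols_def)
  have summable: "(\<lambda>n. m n * ?c n * cis (of_int n * x)) summable_on UNIV" for x
  proof (rule abs_summable_summable)
    obtain N0 where N0: "\<And>N F. N \<ge> N0 \<Longrightarrow> finite F \<Longrightarrow>
      (\<Sum>n\<in>F. jb n ^ 1 * cmod (?c n - lookup (p N) n)) \<le> 1"
      using approx_coeff_tail[OF approx_mono[OF f], of 1 1] by auto
    have bd: "(\<Sum>n\<in>F. cmod (m n * ?c n * cis (of_int n * x))) \<le> K * (1 + wnorm 1 (p N0))" if F: "finite F" for F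
    proof -
      have "(\<Sum>n\<in>F. cmod (m n * ?c n * cis (of_int n * x))) \<le>
        (\<Sum>n\<in>F. K * (jb n ^ 1 * cmod (?c n - lookup (p N0) n) + jb n ^ 1 * cmod (lookup (p N0) n)))"
      proof (rule sum_mono)
        fix n
        have "cmod (m n * ?c n * cis (of_int n * x)) = cmod (m n) * cmod (?c n)"
          by (simp add: norm_mult)
        also have "\<dots> \<le> (K * jb n) * (cmod (?c n - lookup (p N0) n) + cmod (lookup (p N0) n))"
          using mb[of n] K norm_triangle_ineq[of "?c n - lookup (p N0) n" "lookup (p N0) n"] by (intro mult_mono) auto
        finally show "cmod (m n * ?c n * cis (of_int n * x)) \<le> K * (jb n ^ 1 * cmod (?c n - lookup (p N0) n) + jb n ^ 1 * cmod (lookup (p N0) n))"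
          by (simp add: algebra_simps)
      qed
      also have "\<dots> = K * ((\<Sum>n\<in>F. jb n ^ 1 * cmod (?c n - lookup (p N0) n)) + (\<Sum>n\<in>F. jb n ^ 1 * cmod (lookup (p N0) n)))"
        by (simp only: sum_distrib_left[symmetric] sum.distrib)
      also have "\<dots> \<le> K * (1 + wnorm 1 (p N0))"
      proof (intro mult_left_mono add_mono)
        have "(\<Sum>n\<in>F. jb n ^ 1 * cmod (lookup (p N0) n)) \<le> (\<Sum>n\<in>F \<union> keys (p N0). jb n ^ 1 * cmod (lookup (p N0) n))"
          using F by (intro sum_mono2) auto
        also have "\<dots> = wnorm 1 (p N0)"
          using F by (subst wnorm_eq[of "F \<union> keys (p N0)"]) auto
        finally show "(\<Sum>n\<in>F. jb n ^ 1 * cmod (lookup (p N0) n)) \<le> wnorm 1 (p N0)" .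
      qed (use N0[of N0 F] F K in auto)
      finally show ?thesis .
    qed
    show "(\<lambda>n. cmod (m n * ?c n * cis (of_int n * x))) summable_on UNIV"
      by (rule nonneg_bdd_above_summable_on) (auto intro!: bdd_aboveI2 bd)
  qed
  have lim: "(\<lambda>N. leval (mult_op m (p N)) x) \<longlonglongrightarrow> fourier_multiplier m f x" for x
  proof (rule LIMSEQ_I)
    fix r :: real assume r: "0 < r"
    define \<epsilon> where "\<epsilon> = r / (2 * (K + 1))"
    have \<epsilon>: "0 < \<epsilon>" "K * \<epsilon> < r"
    proof -
      show "0 < \<epsilon>" using r K by (simp add: \<epsilon>_def)
      have "K * \<epsilon> \<le> (K + 1) * \<epsilon>" using \<open>0 < \<epsilon>\<close> by simp
      also have "\<dots> = r / 2" using K by (simp add: \<epsilon>_def divide_simps)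
      also have "\<dots> < r" using r by simp
      finally show "K * \<epsilon> < r" .
    qed
    obtain N0 where N0: "\<And>N F. N \<ge> N0 \<Longrightarrow> finite F \<Longrightarrow>
      (\<Sum>n\<in>F. jb n ^ 1 * cmod (?c n - lookup (p N) n)) \<le> \<epsilon>"
      using approx_coeff_tail[OF approx_mono[OF f] \<epsilon>(1), of 1] by auto
    show "\<exists>N0. \<forall>N\<ge>N0. cmod (leval (mult_op m (p N)) x - fourier_multiplier m f x) < r"
    proof (intro exI[of _ N0] allI impI)
      fix N assume N: "N \<ge> N0"
      have "cmod (fourier_multiplier m f x - leval (mult_op m (p N)) x) \<le> K * \<epsilon>"
      proof (rule tendsto_upperbound)
        have "((\<lambda>F. \<Sum>n\<in>F. m n * ?c n * cis (of_int n * x)) \<longlongrightarrow> fourier_multiplier m f x) (finite_subsets_at_top UNIV)"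
          using summable[of x] unfolding fourier_multiplier_def by (rule infsum_tendsto)
        then show "((\<lambda>F. cmod ((\<Sum>n\<in>F. m n * ?c n * cis (of_int n * x)) - leval (mult_op m (p N)) x)) \<longlongrightarrow>
           cmod (fourier_multiplier m f x - leval (mult_op m (p N)) x)) (finite_subsets_at_top UNIV)"
          by (intro tendsto_intros)
        \<comment> \<open>As soon as F contains the support of \<open>p N\<close>, the partial sum
          and the polynomial run over the same frequencies and the coefficients can be
          subtracted.\<close>
        have "\<forall>\<^sub>F F in finite_subsets_at_top UNIV. finite F \<and> keys (p N) \<subseteq> F \<and> F \<subseteq> UNIV"
          by (intro eventually_finite_subsets_at_top[THEN iffD2] exI[of _ "keys (p N)"]) auto
        then show "\<forall>\<^sub>F F in finite_subsets_at_top UNIV. cmod ((\<Sum>n\<in>F. m n * ?c n * cis (of_int n * x)) - leval (mult_op m (p N)) x) \<le> K * \<epsilon>"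
        proof (rule eventually_mono)
          fix F assume F: "finite F \<and> keys (p N) \<subseteq> F \<and> F \<subseteq> UNIV"
          then have "keys (mult_op m (p N)) \<subseteq> F" using keys_mult_op by blast
          then have "leval (mult_op m (p N)) x = (\<Sum>n\<in>F. m n * lookup (p N) n * cis (of_int n * x))"
            using F by (subst leval_eq[of F]) auto
          then have "cmod ((\<Sum>n\<in>F. m n * ?c n * cis (of_int n * x)) - leval (mult_op m (p N)) x) =
             cmod (\<Sum>n\<in>F. m n * (?c n - lookup (p N) n) * cis (of_int n * x))"
            by (simp add: sum_subtractf algebra_simps)
          also have "\<dots> \<le> (\<Sum>n\<in>F. K * (jb n ^ 1 * cmod (?c n - lookup (p N) n)))"
          proof (rule sum_norm_le)
            fix n
            show "cmod (m n * (?c n - lookup (p N) n) * cis (of_int n * x)) \<le> K * (jb n ^ 1 * cmod (?c n - lookup (p N) n))"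
              using mult_right_mono[OF mb[of n], of "cmod (?c n - lookup (p N) n)"] by (simp add: norm_mult mult_ac)
          qed
          also have "\<dots> \<le> K * \<epsilon>"
            using N0[OF N, of F] F K by (simp flip: sum_distrib_left add: mult_left_mono)
          finally show "cmod ((\<Sum>n\<in>F. m n * ?c n * cis (of_int n * x)) - leval (mult_op m (p N)) x) \<le> K * \<epsilon>" .
        qed
      qed simp
      then show "cmod (leval (mult_op m (p N)) x - fourier_multiplier m f x) < r"
        using \<epsilon> by (simp add: norm_minus_commute)
    qed
  qed
  then show ?thesis
    using wcauchy_mult_op[OF f m] by (simp add: approx_def)
qed

subsection \<open>The symbols of the depth-dependent operators\<close>

text \<open>Contains \<infinity> besides the finite depths bounded away from 0, so a single constant
  covers the whole range of the limit.\<close>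

definition depths :: "real \<Rightarrow> ereal set" where
  "depths \<kappa> = {\<delta>. 0 < \<delta> \<and> inv_depth \<delta> \<le> \<kappa>}"

definition gsym :: "ereal \<Rightarrow> int \<Rightarrow> real" where
  "gsym \<delta> n = (if \<delta> = \<infinity> then of_int (sgn n) else if n = 0 then 0
     else coth (real_of_ereal \<delta> * of_int n) - 1 / (real_of_ereal \<delta> * of_int n))"

text \<open>The symbol of L0: with G having symbol \<open>- \<i> * g\<close>, one finds
  \<open>(- \<i> * g - \<i>) * (\<i> * n) = n * g + n\<close>.\<close>

definition lsym :: "ereal \<Rightarrow> int \<Rightarrow> complex" where
  "lsym \<delta> n = of_int n * of_real (gsym \<delta> n) + of_int n + of_real (inv_depth \<delta>)"

lemma G_symbol_eq: "G_symbol \<delta> n = - \<i> * of_real (gsym \<delta> n)"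
  by (simp add: G_symbol_def gsym_def hilbert_symbol_def Let_def)

lemma gsym_odd: "gsym \<delta> (- n) = - gsym \<delta> n"
  by (simp add: gsym_def coth_def sgn_if)

lemma depth_cases:
  assumes "0 < \<delta>"
  obtains "\<delta> = \<infinity>" "inv_depth \<delta> = 0" | d where "\<delta> = ereal d" "0 < d" "inv_depth \<delta> = 1 / d"
  using assms by (cases \<delta>) (auto simp: inv_depth_def inverse_eq_divide)

lemma inv_depth_nonneg: "0 < \<delta> \<Longrightarrow> 0 \<le> inv_depth \<delta>"
  by (auto elim: depth_cases)

text \<open>coth x = 1 + exp(-x) / sinh x, and sinh x \<ge> x.\<close>

lemma coth_bound:
  assumes "0 < x"
  shows "1 \<le> coth x" "coth x \<le> 1 + 1 / x"
proof -
  have s: "x \<le> sinh x"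
  proof -
    have "sinh 0 - 0 \<le> sinh x - x"
    proof (rule DERIV_nonneg_imp_nondecreasing[where f = "\<lambda>x::real. sinh x - x"])
      fix y :: real
      show "\<exists>z. ((\<lambda>x. sinh x - x) has_real_derivative z) (at y) \<and> 0 \<le> z"
        by (intro exI[of _ "cosh y - 1"] conjI) (auto intro!: derivative_eq_intros simp: cosh_real_ge_1)
    qed (use assms in simp)
    then show ?thesis by simp
  qed
  have c: "cosh x = sinh x + exp (- x)" using cosh_minus_sinh[of x] by simp
  have pos: "0 < sinh x" using s assms by linarith
  have "coth x = 1 + exp (- x) / sinh x"
    using pos by (simp add: coth_def c add_divide_distrib)
  moreover have "exp (- x) / sinh x \<le> 1 / x"
    using s assms pos by (intro frac_le) auto
  moreover have "0 \<le> exp (- x) / sinh x" using pos by simp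
  ultimately show "1 \<le> coth x" "coth x \<le> 1 + 1 / x" by simp_all
qed

lemma gsym_bound:
  assumes "0 < \<delta>"
  shows "\<bar>gsym \<delta> n\<bar> \<le> 1 + 2 * inv_depth \<delta>"
proof (cases rule: depth_cases[OF assms])
  case 1
  then show ?thesis by (simp add: gsym_def sgn_if)
next
  case (2 d)
  have pos: "\<bar>gsym \<delta> n\<bar> \<le> 1 + 2 * inv_depth \<delta>" if n: "n > 0" for n
  proof -
    let ?x = "d * real_of_int n"
    have x: "0 < ?x" "d \<le> ?x" using 2 n by simp_all
    have inv: "1 / ?x \<le> 1 / d" "0 \<le> 1 / ?x" using x 2 by (auto intro!: divide_left_mono mult_pos_pos)
    have "gsym \<delta> n = coth ?x - 1 / ?x" using 2 n by (simp add: gsym_def)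
    then show ?thesis using coth_bound[OF x(1)] inv 2(3) by simp
  qed
  consider "n > 0" | "n = 0" | "- n > 0" by linarith
  then show ?thesis
  proof cases
    case 3
    then show ?thesis using pos[of "- n"] by (simp add: gsym_odd)
  qed (use pos 2 in \<open>auto simp: gsym_def\<close>)
qed

lemma G_symbol_in_symbols: "0 < \<delta> \<Longrightarrow> G_symbol \<delta> \<in> symbols (1 + 2 * inv_depth \<delta>)"
proof -
  assume \<delta>: "0 < \<delta>"
  have "1 + 2 * inv_depth \<delta> \<le> (1 + 2 * inv_depth \<delta>) * jb n" for n
    using inv_depth_nonneg[OF \<delta>] by (simp add: mult_le_cancel_left1)
  moreover have "cmod (G_symbol \<delta> n) \<le> 1 + 2 * inv_depth \<delta>" for n
    unfolding G_symbol_eq using gsym_bound[OF \<delta>, of n] by (simp add: norm_mult)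
  ultimately have "cmod (G_symbol \<delta> n) \<le> (1 + 2 * inv_depth \<delta>) * jb n" for n
    by (rule order_trans[rotated])
  then show ?thesis by (simp add: symbols_def)
qed

lemma lsym_in_symbols:
  assumes "\<delta> \<in> depths \<kappa>"
  shows "lsym \<delta> \<in> symbols (2 + 3 * \<kappa>)"
proof -
  from assms have \<delta>: "0 < \<delta>" and \<kappa>: "inv_depth \<delta> \<le> \<kappa>" by (auto simp: depths_def)
  note \<iota> = inv_depth_nonneg[OF \<delta>]
  have "cmod (lsym \<delta> n) \<le> (2 + 3 * \<kappa>) * jb n" for n
  proof -
    have "lsym \<delta> n = of_real (of_int n * gsym \<delta> n + of_int n + inv_depth \<delta>)"
      by (simp add: lsym_def)
    then have "cmod (lsym \<delta> n) = \<bar>of_int n * gsym \<delta> n + of_int n + inv_depth \<delta>\<bar>"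
      by (simp only: norm_of_real)
    also have "\<dots> \<le> \<bar>real_of_int n\<bar> * \<bar>gsym \<delta> n\<bar> + \<bar>real_of_int n\<bar> + inv_depth \<delta>"
      using \<iota> by (simp add: abs_mult[symmetric])
    also have "\<dots> \<le> \<bar>real_of_int n\<bar> * (1 + 2 * \<kappa>) + \<bar>real_of_int n\<bar> + \<kappa>"
      using gsym_bound[OF \<delta>, of n] \<kappa> by (intro add_mono mult_left_mono) auto
    also have "\<dots> \<le> (2 + 3 * \<kappa>) * jb n"
    proof -
      have "0 \<le> \<kappa> * \<bar>real_of_int n\<bar>" "0 \<le> \<kappa>" using \<iota> \<kappa> by simp_all
      then show ?thesis by (simp add: algebra_simps)
    qed
    finally show ?thesis .
  qed
  then show ?thesis by (simp add: symbols_def)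
qed

lemma coth_add:
  fixes x y :: real
  assumes "x \<noteq> 0" "y \<noteq> 0" "x + y \<noteq> 0"
  shows "coth x * coth y + 1 = coth (x + y) * (coth x + coth y)"
proof -
  have "sinh x \<noteq> 0" "sinh y \<noteq> 0" "sinh (x + y) \<noteq> 0" using assms by simp_all
  then have nz: "sinh x \<noteq> 0" "sinh y \<noteq> 0" "sinh (x + y) \<noteq> 0" .
  have "coth x * coth y + 1 = cosh (x + y) / (sinh x * sinh y)"
    using nz by (simp add: coth_def cosh_add add_divide_distrib)
  moreover have "coth x + coth y = sinh (x + y) / (sinh x * sinh y)"
    using nz by (simp add: coth_def sinh_add add_divide_distrib)
  ultimately show ?thesis
    using nz by (simp add: coth_def)
qed

text \<open>Away from frequency 0 the symbol is n (C n + 1) with C n = coth(\<delta> n), or sgn n at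
  infinite depth: the term 1/\<delta> of L0 cancels the correction 1/(\<delta> n) in G. The claim is
  then the addition theorem for C. If a, c or a + c vanishes, oddness suffices.\<close>

lemma lsym_addition:
  assumes \<delta>: "0 < \<delta>"
  shows "lsym \<delta> a * lsym \<delta> c * (of_int a + of_int c) =
      lsym \<delta> (a + c) * (of_int a * (of_int c * of_real (gsym \<delta> c)) + of_int c * (of_int a * of_real (gsym \<delta> a))
        + of_real (inv_depth \<delta>) * (of_int a + of_int c))"
proof -
  let ?g = "gsym \<delta>" and ?i = "inv_depth \<delta>"
  define r where "r = (\<lambda>n. of_int n * ?g n + of_int n + ?i)"
  have l: "lsym \<delta> n = of_real (r n)" for n by (simp add: lsym_def r_def)
  have "r a * r c * (of_int a + of_int c) = r (a + c) * (of_int a * (of_int c * ?g c) + of_int c * (of_int a * ?g a) + ?i * (of_int a + of_int c))"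
  proof (cases "a = 0 \<or> c = 0 \<or> a + c = 0")
    case True
    then consider "a = 0" | "c = 0" | "c = - a" by linarith
    then show ?thesis
      by cases (simp_all add: r_def gsym_odd algebra_simps)
  next
    case False
    then have nz: "a \<noteq> 0" "c \<noteq> 0" "a + c \<noteq> 0" by auto
    \<comment> \<open>C stands for the hyperbolic cotangent or the sign, so that the algebra is done
      once for both kinds of depth.\<close>
    have "\<exists>C. (\<forall>n. n \<noteq> 0 \<longrightarrow> of_int n * ?g n = of_int n * C n - ?i) \<and> C a * C c + 1 = C (a + c) * (C a + C c)"
    proof (cases rule: depth_cases[OF \<delta>])
      case 1
      have "sgn a * sgn c + 1 = sgn (a + c) * (sgn a + sgn c)"
        using nz by (auto simp: sgn_if)
      then have "real_of_int (sgn a * sgn c + 1) = real_of_int (sgn (a + c) * (sgn a + sgn c))" by simp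
      then show ?thesis
        by (intro exI[of _ "\<lambda>n. of_int (sgn n)"]) (simp add: 1(1) gsym_def inv_depth_def)
    next
      case (2 d)
      have "coth (d * of_int a) * coth (d * of_int c) + 1 = coth (d * of_int (a + c)) * (coth (d * of_int a) + coth (d * of_int c))"
        using coth_add[of "d * of_int a" "d * of_int c"] nz 2 by (simp add: distrib_left[symmetric] flip: of_int_add)
      then show ?thesis
        using 2 by (intro exI[of _ "\<lambda>n. coth (d * of_int n)"]) (auto simp: gsym_def field_simps)
    qed
    then obtain C where C: "\<And>n. n \<noteq> 0 \<Longrightarrow> of_int n * ?g n = of_int n * C n - ?i"
      "C a * C c + 1 = C (a + c) * (C a + C c)" by blast
    have r: "r n = of_int n * (C n + 1)" if "n \<noteq> 0" for n
      using C(1)[OF that] by (simp add: r_def algebra_simps)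
    have "r (a + c) * (of_int a * (of_int c * ?g c) + of_int c * (of_int a * ?g a) + ?i * (of_int a + of_int c))
      = of_int (a + c) * (C (a + c) + 1) * (of_int a * of_int c * (C a + C c))"
      unfolding C(1)[OF nz(1)] C(1)[OF nz(2)] r[OF nz(3)] by (simp add: algebra_simps)
    also have "\<dots> = of_int (a + c) * of_int a * of_int c * (C (a + c) * (C a + C c) + (C a + C c))"
      by (simp add: algebra_simps)
    also have "\<dots> = r a * r c * (of_int a + of_int c)"
      unfolding C(2)[symmetric] r[OF nz(1)] r[OF nz(2)] by (simp add: algebra_simps)
    finally show ?thesis by simp
  qed
  then have "complex_of_real (r a * r c * (of_int a + of_int c)) = complex_of_real (r (a + c) * (of_int a * (of_int c * ?g c) + of_int c * (of_int a * ?g a) + ?i * (of_int a + of_int c)))"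
    by (rule arg_cong)
  then show ?thesis unfolding l by simp
qed

text \<open>One order is lost to the derivative and one to G, whose bounded symbol is treated as one
  of linear growth. The loss is harmless because smooth data are approximated in every
  order.\<close>

lemma approx_L0:
  assumes \<delta>: "0 < \<delta>" and f: "approx (Suc (Suc s)) f p"
  shows "approx s (L0 \<delta> f) (\<lambda>N. mult_op (lsym \<delta>) (p N))"
proof -
  have "approx s (\<lambda>x. G \<delta> (Dx f) x - \<i> * Dx f x + of_real (inv_depth \<delta>) * f x)
     (\<lambda>N. mult_op (G_symbol \<delta>) (ddx (p N)) - cst \<i> * ddx (p N) + cst (of_real (inv_depth \<delta>)) * p N)"
    unfolding G_def
    by (intro approx_add approx_diff approx_cst approx_fourier_multiplier[OF _ G_symbol_in_symbols[OF \<delta>]] approx_Dx f approx_mono[OF f])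
      auto
  moreover have "mult_op (G_symbol \<delta>) (ddx q) - cst \<i> * ddx q + cst (of_real (inv_depth \<delta>)) * q = mult_op (lsym \<delta>) q" for q
    by (rule poly_mapping_eqI) (simp add: lookup_add lookup_minus G_symbol_eq lsym_def algebra_simps)
  moreover have "L0 \<delta> f = (\<lambda>x. G \<delta> (Dx f) x - \<i> * Dx f x + of_real (inv_depth \<delta>) * f x)"
    by (simp add: L0_def fun_eq_iff)
  ultimately show ?thesis by simp
qed

text \<open>The hypothesis and the induction both range over all orders s, so no derivatives need to
  be counted along the recursion.\<close>

lemma approx_chi:
  assumes \<delta>: "0 < \<delta>" and u: "\<And>s. approx s (\<lambda>x. of_real (u x)) p"
  shows "approx s (chi \<delta> u n) (\<lambda>N. chiL (lsym \<delta>) (p N) n)"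
proof (induction n arbitrary: s rule: less_induct)
  case (less n)
  consider "n = 0" | "n = 1" | "n \<ge> 2" by linarith
  then show ?case
  proof cases
    case 1
    then show ?thesis using approx_const[of s 0] by (simp add: chi.simps)
  next
    case 2
    have "approx s (\<lambda>x. of_real (u x) + of_real (u x)) (\<lambda>N. p N + p N)"
      by (intro approx_add u)
    then show ?thesis using 2 by (simp only: mult_2[symmetric] chi.simps[of _ _ 1] chiL.simps[of _ _ 1]) simp
  next
    case 3
    have "approx s (\<lambda>x. - (\<Sum>j=2..n. 1 / fact j * (\<Sum>ns\<in>compositions n j. \<Prod>m\<leftarrow>ns. chi \<delta> u m x))
                - L0 \<delta> (chi \<delta> u (n - 1)) x)
       (\<lambda>N. - (\<Sum>j=2..n. cst (1 / fact j) * (\<Sum>ns\<in>compositions n j. \<Prod>m\<leftarrow>ns. chiL (lsym \<delta>) (p N) m))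
           - mult_op (lsym \<delta>) (chiL (lsym \<delta>) (p N) (n - 1)))"
      by (intro approx_diff approx_uminus approx_sum approx_cst approx_prod_list approx_L0[OF \<delta>] less)
        (use 3 compositions_less in auto)
    then show ?thesis using 3 by (simp only: chi.simps[of _ _ n] chiL.simps[of _ _ n]) simp
  qed
qed

text \<open>Mirrors \<open>smooth_energy\<close>. The factor 2 pi appears because Fourier
  coefficients are normalised averages while the energy uses the plain integral.\<close>

fun lenergy :: "ereal \<Rightarrow> laurent \<Rightarrow> nat \<Rightarrow> real" where
  "lenergy \<delta> p k =
     (- 1) ^ (k + 1) / (4 * b k) *
       (Re (2 * pi * lookup (chiL (lsym \<delta>) p (k + 2)) 0)
        - 4 * (- 1) ^ (k + 1) *
            (\<Sum>j<k. inv_depth \<delta> ^ (k - j) * of_nat ((k + 2) choose (j + 2)) * b j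
                     * lenergy \<delta> p j))"

declare lenergy.simps [simp del]

lemma smooth_energy_limit:
  assumes \<delta>: "0 < \<delta>" and u: "\<And>s. approx s (\<lambda>x. of_real (u x)) p"
  shows "(\<lambda>N. lenergy \<delta> (p N) k) \<longlonglongrightarrow> smooth_energy \<delta> u k"
proof (induction k rule: less_induct)
  case (less k)
  have "(\<lambda>N. 2 * pi * lookup (chiL (lsym \<delta>) (p N) (k + 2)) 0) \<longlonglongrightarrow> 2 * pi * fourier_coeff (chi \<delta> u (k + 2)) 0"
    by (intro tendsto_intros approx_fourier_coeff[where s = 0] approx_chi assms)
  moreover have "2 * pi * fourier_coeff (chi \<delta> u (k + 2)) 0 = integral\<^sup>L torus (chi \<delta> u (k + 2))"
    by (simp add: fourier_coeff_def)
  ultimately have "(\<lambda>N. 2 * pi * lookup (chiL (lsym \<delta>) (p N) (k + 2)) 0) \<longlonglongrightarrow> integral\<^sup>L torus (chi \<delta> u (k + 2))"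
    by (simp only:)
  then show ?case
    unfolding lenergy.simps[of _ _ k] smooth_energy.simps[of _ _ k]
    by (intro tendsto_intros less) auto
qed

subsection \<open>Fourier inversion and decay of coefficients\<close>

definition trunc :: "(int \<Rightarrow> complex) \<Rightarrow> nat \<Rightarrow> laurent" where
  "trunc c N = Abs_poly_mapping (\<lambda>n. if \<bar>n\<bar> \<le> int N then c n else 0)"

lemma lookup_trunc: "lookup (trunc c N) n = (if \<bar>n\<bar> \<le> int N then c n else 0)"
proof -
  have "finite {n. (if \<bar>n\<bar> \<le> int N then c n else 0) \<noteq> 0}"
    by (rule finite_subset[of _ "{- int N..int N}"]) auto
  then show ?thesis by (simp add: trunc_def)
qed

lemma keys_trunc: "keys (trunc c N) \<subseteq> {- int N..int N}"
  by (auto simp: in_keys_iff lookup_trunc split: if_splits)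

text \<open>Of the three surplus powers of the weight, two make the sum over frequencies converge
  and the third gives the rate in N0.\<close>

lemma wnorm_trunc_diff:
  assumes c: "\<And>n. jb n ^ (s + 3) * cmod (c n) \<le> C"
    and Z: "\<And>A. finite A \<Longrightarrow> (\<Sum>a\<in>A. 1 / (jb a)\<^sup>2) \<le> Z"
    and MN: "N0 \<le> M" "N0 \<le> N"
  shows "wnorm s (trunc c M - trunc c N) \<le> C * Z / (1 + real N0)"
proof -
  have "jb 0 ^ (s + 3) * cmod (c 0) \<ge> 0" by simp
  then have C: "0 \<le> C" using c[of 0] by linarith
  let ?d = "trunc c M - trunc c N"
  have "wnorm s ?d \<le> (\<Sum>n\<in>keys ?d. C / (1 + real N0) * (1 / (jb n)\<^sup>2))"
    unfolding wnorm_def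
  proof (rule sum_mono)
    fix n assume "n \<in> keys ?d"
    then have d: "lookup ?d n \<noteq> 0" by (simp add: in_keys_iff)
    then have n: "int N0 \<le> \<bar>n\<bar>"
      using MN by (auto simp: lookup_minus lookup_trunc split: if_splits)
    have le: "cmod (lookup ?d n) \<le> cmod (c n)"
      by (simp add: lookup_minus lookup_trunc)
    let ?w = "jb n"
    have w: "0 < ?w" "1 + real N0 \<le> ?w" using n by auto
    have "?w ^ s * cmod (lookup ?d n) * ?w ^ 2 * (1 + real N0) \<le> ?w ^ s * cmod (c n) * ?w ^ 2 * ?w"
      using le w by (intro mult_mono) auto
    also have "\<dots> = ?w ^ (s + 3) * cmod (c n)"
      by (simp add: power_add power2_eq_square power3_eq_cube)
    also have "\<dots> \<le> C" by (rule c)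
    finally have "?w ^ s * cmod (lookup ?d n) * (?w\<^sup>2 * (1 + real N0)) \<le> C" by (simp only: mult.assoc)
    moreover have "0 < ?w\<^sup>2 * (1 + real N0)" using w by simp
    ultimately have "?w ^ s * cmod (lookup ?d n) \<le> C / (?w\<^sup>2 * (1 + real N0))"
      by (simp only: pos_le_divide_eq)
    then show "?w ^ s * cmod (lookup ?d n) \<le> C / (1 + real N0) * (1 / ?w\<^sup>2)"
      by (simp add: mult.commute)
  qed
  also have "\<dots> = C / (1 + real N0) * (\<Sum>n\<in>keys ?d. 1 / (jb n)\<^sup>2)"
    by (rule sum_distrib_left[symmetric])
  also have "\<dots> \<le> C / (1 + real N0) * Z"
    using C by (intro mult_left_mono Z) auto
  finally show ?thesis by simp
qed

lemma approx_trunc: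
  assumes c: "\<And>n. jb n ^ (s + 3) * cmod (c n) \<le> C"
  shows "approx s (\<lambda>x. lim (\<lambda>N. leval (trunc c N) x)) (trunc c)"
proof (rule approx_exists)
  obtain Z where Z: "0 \<le> Z" "\<And>A. finite A \<Longrightarrow> (\<Sum>a\<in>A. 1 / (jb a)\<^sup>2) \<le> Z"
    using inverse_square_sum by metis
  fix \<epsilon> :: real assume \<epsilon>: "0 < \<epsilon>"
  obtain N0 where N0: "C * Z / \<epsilon> < real N0" using reals_Archimedean2 by blast
  then have N0: "C * Z / (1 + real N0) < \<epsilon>"
    using \<epsilon> by (simp add: field_simps)
  show "\<exists>N0. \<forall>M\<ge>N0. \<forall>N\<ge>N0. wnorm s (trunc c M - trunc c N) < \<epsilon>"
    by (intro exI[of _ N0] allI impI le_less_trans[OF wnorm_trunc_diff[OF c Z(2)] N0])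
qed

section \<open>Bessel's inequality and uniqueness of Fourier coefficients\<close>

lemma torus_pairing:
  assumes "continuous_on {0..2*pi} h"
  shows "integral\<^sup>L torus (\<lambda>x. h x * cnj (leval p x)) = 2 * pi * (\<Sum>n\<in>keys p. fourier_coeff h n * cnj (lookup p n))"
proof -
  have "h x * cnj (leval p x) = (\<Sum>n\<in>keys p. cnj (lookup p n) * (h x * cis (- (of_int n * x))))" for x
    by (simp add: leval_def sum_distrib_left cis_cnj mult_ac)
  then have "integral\<^sup>L torus (\<lambda>x. h x * cnj (leval p x)) =
     (\<Sum>n\<in>keys p. cnj (lookup p n) * integral\<^sup>L torus (\<lambda>x. h x * cis (- (of_int n * x))))"
    using assms by (simp add: Bochner_Integration.integral_sum torus_integral continuous_times_cis)
  then show ?thesis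
    by (simp add: fourier_coeff_def sum_distrib_left mult_ac)
qed

lemma bessel:
  assumes g: "continuous_on {0..2*pi} g" and F: "finite F"
  shows "(\<Sum>n\<in>F. (cmod (fourier_coeff g n))\<^sup>2) \<le> integral\<^sup>L torus (\<lambda>x. (cmod (g x))\<^sup>2) / (2 * pi)"
proof -
  define p where "p = (\<Sum>n\<in>F. Poly_Mapping.single n (fourier_coeff g n))"
  have lp: "lookup p n = (if n \<in> F then fourier_coeff g n else 0)" for n
    using F by (simp add: p_def lookup_sum lookup_single when_def)
  have keys: "keys p \<subseteq> F" by (auto simp: in_keys_iff lp split: if_splits)
  define \<Sigma> where "\<Sigma> = (\<Sum>n\<in>F. (cmod (fourier_coeff g n))\<^sup>2)"
  have sum: "(\<Sum>n\<in>keys p. fourier_coeff g n * cnj (lookup p n)) = of_real \<Sigma>"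
    unfolding \<Sigma>_def of_real_sum
    by (rule sum.mono_neutral_cong_left) (use F keys in \<open>auto simp: in_keys_iff lp complex_norm_square[symmetric] split: if_splits\<close>)
  have sum': "(\<Sum>n\<in>keys p. fourier_coeff (leval p) n * cnj (lookup p n)) = of_real \<Sigma>"
    unfolding sum[symmetric] fourier_coeff_leval by (rule sum.cong) (auto simp: lp in_keys_iff split: if_splits)
  note lc = continuous_leval[of "{0..2*pi}" p]
  \<comment> \<open>Since p is the projection of g onto the frequencies in F, the cross term and the
    square of p have the same integral.\<close>
  have I1: "integral\<^sup>L torus (\<lambda>x. Re (g x * cnj (leval p x))) = 2 * pi * \<Sigma>"
    using torus_pairing[OF g, of p] g lc unfolding sum
    by (subst integral_Re) (auto intro!: torus_integral continuous_intros)
  have I2: "integral\<^sup>L torus (\<lambda>x. Re (leval p x * cnj (leval p x))) = 2 * pi * \<Sigma>"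
    using torus_pairing[OF lc, of p] lc unfolding sum'
    by (subst integral_Re) (auto intro!: torus_integral continuous_intros)
  have "0 \<le> integral\<^sup>L torus (\<lambda>x. (cmod (g x - leval p x))\<^sup>2)"
    by (rule Bochner_Integration.integral_nonneg) auto
  also have "(\<lambda>x. (cmod (g x - leval p x))\<^sup>2) =
      (\<lambda>x. (cmod (g x))\<^sup>2 - 2 * Re (g x * cnj (leval p x)) + Re (leval p x * cnj (leval p x)))"
    by (simp only: fun_eq_iff cmod_power2) (simp add: power2_eq_square algebra_simps)
  also have "integral\<^sup>L torus \<dots> = integral\<^sup>L torus (\<lambda>x. (cmod (g x))\<^sup>2) - 2 * (2 * pi * \<Sigma>) + 2 * pi * \<Sigma>"
  proof -
    have gen: "integral\<^sup>L torus (\<lambda>x. A x - 2 * B x + D x) = integral\<^sup>L torus A - 2 * integral\<^sup>L torus B + integral\<^sup>L torus D"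
      if "integrable torus A" "integrable torus B" "integrable torus D" for A B D :: "real \<Rightarrow> real"
      using that by simp
    have i: "integrable torus (\<lambda>x. (cmod (g x))\<^sup>2)"
      using g by (intro torus_integral continuous_intros)
    have i': "integrable torus (\<lambda>x. Re (h x * cnj (leval p x)))" if "continuous_on {0..2*pi} h" for h
      by (intro torus_integral continuous_intros that lc)
    show ?thesis
      unfolding gen[OF i i'[OF g] i'[OF lc]] I1 I2 ..
  qed
  finally show ?thesis by (simp add: \<Sigma>_def field_simps)
qed

text \<open>Infinitely many coefficients of equal positive modulus would exceed the bound in
  Bessel's inequality.\<close>

lemma constant_modulus_coeffs:
  assumes g: "continuous_on {0..2*pi} g" and inj: "inj j" and c: "\<And>m::nat. cmod (fourier_coeff g (j m)) = c"
  shows "c = 0"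
proof (rule ccontr)
  assume "c \<noteq> 0"
  let ?B = "integral\<^sup>L torus (\<lambda>x. (cmod (g x))\<^sup>2) / (2 * pi)"
  obtain M :: nat where "?B / c\<^sup>2 < real M" using reals_Archimedean2 by blast
  then have "?B < real M * c\<^sup>2" using \<open>c \<noteq> 0\<close> by (simp add: field_simps)
  moreover have "(\<Sum>n\<in>j ` {..<M}. (cmod (fourier_coeff g n))\<^sup>2) = real M * c\<^sup>2"
    using inj by (subst sum.reindex) (auto simp: c inj_on_def)
  ultimately show False using bessel[OF g, of "j ` {..<M}"] by simp
qed

lemma fourier_coeff_cong:
  "(\<And>x. x \<in> {0..2*pi} \<Longrightarrow> f x = g x) \<Longrightarrow> fourier_coeff f n = fourier_coeff g n"
  unfolding fourier_coeff_def by (intro arg_cong2[where f = "(/)"] refl Bochner_Integration.integral_cong) auto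

text \<open>With \<open>h - h x0 = (cis (x - x0) - 1) * g\<close> the coefficients of \<open>g\<close> have constant modulus
  on each side of zero, so they vanish by Bessel's inequality.\<close>

lemma vanishing_coeffs:
  assumes h: "continuous_on {0..2*pi} h" and x0: "0 < x0" "x0 < 2 * pi"
    and d: "(h has_vector_derivative d) (at x0)" and zero: "\<And>n. fourier_coeff h n = 0"
  shows "h x0 = 0"
proof -
  let ?I = "{0..2*pi}"
  define e where "e = (\<lambda>x. cis (x - x0) - 1)"
  define g where "g = (\<lambda>x. if x = x0 then d / \<i> else (h x - h x0) / e x)"
  have e0: "e x \<noteq> 0" if "x \<in> ?I" "x \<noteq> x0" for x
  proof
    assume "e x = 0"
    then have "cos (x - x0) = 1" by (simp add: e_def complex_eq_iff)
    then obtain k :: int where k: "x - x0 = of_int k * 2 * pi"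
      unfolding cos_one_2pi_int by blast
    have "\<bar>x - x0\<bar> < 2 * pi" using that x0 by auto
    then have "\<bar>real_of_int k\<bar> * (2 * pi) < 1 * (2 * pi)" using k by (simp add: abs_mult)
    then have "\<bar>real_of_int k\<bar> < 1" by (subst (asm) mult_less_cancel_right) auto
    then have "k = 0" by linarith
    then show False using k that by simp
  qed
  have eg: "h x - h x0 = e x * g x" if "x \<in> ?I" for x
    using e0[OF that] by (auto simp: g_def e_def)
  have quot: "((\<lambda>x. (f x - f x0) / of_real (x - x0)) \<longlongrightarrow> f') (at x0)" if "(f has_vector_derivative f') (at x0)" for f :: "real \<Rightarrow> complex" and f'
  proof -
    have "((\<lambda>x. cmod (f x - f x0 - (x - x0) *\<^sub>R f') / norm (x - x0)) \<longlongrightarrow> 0) (at x0)"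
      using that by (simp add: has_vector_derivative_def has_derivative_iff_norm)
    then have "((\<lambda>x. norm ((f x - f x0) / of_real (x - x0) - f')) \<longlongrightarrow> 0) (at x0)"
    proof (rule Lim_transform_eventually)
      show "\<forall>\<^sub>F x in at x0. cmod (f x - f x0 - (x - x0) *\<^sub>R f') / norm (x - x0) = norm ((f x - f x0) / of_real (x - x0) - f')"
        using eventually_neq_at_within[of x0 x0 UNIV]
      proof (rule eventually_mono)
        fix x assume "x \<noteq> x0"
        then have "(f x - f x0) / of_real (x - x0) - f' = (f x - f x0 - (x - x0) *\<^sub>R f') / of_real (x - x0)"
          by (simp add: scaleR_conv_of_real field_simps del: of_real_diff)
        then show "cmod (f x - f x0 - (x - x0) *\<^sub>R f') / norm (x - x0) = norm ((f x - f x0) / of_real (x - x0) - f')"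
          by (simp add: norm_divide del: of_real_diff)
      qed
    qed
    then show ?thesis
      by (rule LIM_zero_cancel[OF tendsto_norm_zero_cancel])
  qed
  have ed: "(e has_vector_derivative \<i>) (at x0)"
  proof -
    have "(e has_derivative (\<lambda>t. t *\<^sub>R (\<i> * cis (x0 - x0)))) (at x0)"
      unfolding e_def by (rule derivative_eq_intros refl)+ auto
    then show ?thesis by (simp add: has_vector_derivative_def)
  qed
  \<comment> \<open>This is where differentiability of h enters: e has derivative
    \<open>\<i>\<close> at x0, so the quotient of the difference quotients converges and g is
    continuous across x0.\<close>
  have glim: "(g \<longlongrightarrow> d / \<i>) (at x0)"
  proof (rule Lim_transform_eventually)
    have "e x0 = 0" by (simp add: e_def)
    then have "((\<lambda>x. ((h x - h x0) / of_real (x - x0)) / ((e x) / of_real (x - x0))) \<longlongrightarrow> d / \<i>) (at x0)"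
      using tendsto_divide[OF quot[OF d] quot[OF ed]] by simp
    then show "((\<lambda>x. ((h x - h x0) / of_real (x - x0)) / ((e x) / of_real (x - x0))) \<longlongrightarrow> d / \<i>) (at x0)" .
    show "\<forall>\<^sub>F x in at x0. ((h x - h x0) / of_real (x - x0)) / ((e x) / of_real (x - x0)) = g x"
      using eventually_neq_at_within[of x0 x0 UNIV] by (rule eventually_mono) (simp add: g_def flip: of_real_diff)
  qed
  have g: "continuous_on ?I g"
    unfolding continuous_on_def
  proof
    fix x assume x: "x \<in> ?I"
    show "(g \<longlongrightarrow> g x) (at x within ?I)"
    proof (cases "x = x0")
      case True
      moreover have "g x0 = d / \<i>" by (simp add: g_def)
      ultimately show ?thesis using tendsto_within_subset[OF glim subset_UNIV] by (simp only:)
    next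
      case False
      show ?thesis
      proof (rule Lim_transform_eventually)
        have "(h \<longlongrightarrow> h x) (at x within ?I)" using h x by (simp add: continuous_on_def)
        moreover have "(e \<longlongrightarrow> e x) (at x within ?I)"
          unfolding e_def by (intro tendsto_intros)
        ultimately show "((\<lambda>x. (h x - h x0) / e x) \<longlongrightarrow> g x) (at x within ?I)"
          using e0[OF x False] False by (auto simp: g_def intro!: tendsto_intros)
        show "\<forall>\<^sub>F y in at x within ?I. (h y - h x0) / e y = g y"
          using eventually_neq_at_within[of x0 x ?I] by (rule eventually_mono) (simp add: g_def)
      qed
    qed
  qed
  \<comment> \<open>Multiplication by \<open>cis x\<close> shifts the coefficients by one, and
    subtracting the constant h x0 disturbs only n = 0.\<close>
  have rec: "(if n = 0 then - h x0 else 0) = cis (- x0) * fourier_coeff g (n - 1) - fourier_coeff g n" for n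
  proof -
    have "fourier_coeff (\<lambda>x. h x - h x0) n = fourier_coeff h n - fourier_coeff (\<lambda>x. h x0) n"
      using h by (intro fourier_coeff_diff) auto
    also have "fourier_coeff (\<lambda>x. h x0) n = (if n = 0 then h x0 else 0)"
    proof -
      have "(\<lambda>x. h x0) = leval (cst (h x0))" by (simp add: fun_eq_iff)
      then show ?thesis by (simp add: fourier_coeff_leval lookup_single when_def)
    qed
    finally have "(if n = 0 then - h x0 else 0) = fourier_coeff (\<lambda>x. h x - h x0) n" by (simp add: zero)
    also have "\<dots> = fourier_coeff (\<lambda>x. cis (x - x0) * g x - g x) n"
      by (rule fourier_coeff_cong) (simp add: eg e_def left_diff_distrib)
    also have "\<dots> = fourier_coeff (\<lambda>x. cis (x - x0) * g x) n - fourier_coeff g n"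
      using g by (intro fourier_coeff_diff) (auto intro!: continuous_intros)
    also have "fourier_coeff (\<lambda>x. cis (x - x0) * g x) n = cis (- x0) * fourier_coeff g (n - 1)"
    proof -
      have eq: "cis (x - x0) * g x * cis (- (of_int n * x)) = cis (- x0) * (g x * cis (- (of_int (n - 1) * x)))" for x
      proof -
        have ee: "cis (x - x0) * cis (- (of_int n * x)) = cis (- x0) * cis (- (of_int (n - 1) * x))"
          by (simp add: cis_mult algebra_simps)
        have "cis (x - x0) * g x * cis (- (of_int n * x)) = g x * (cis (x - x0) * cis (- (of_int n * x)))"
          by (simp only: mult_ac)
        also have "\<dots> = cis (- x0) * (g x * cis (- (of_int (n - 1) * x)))"
          unfolding ee by (simp only: mult_ac)
        finally show ?thesis .
      qed
      show ?thesis by (simp only: fourier_coeff_def eq integral_mult_right_zero times_divide_eq_right)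
    qed
    finally show ?thesis .
  qed
  have step: "cmod (fourier_coeff g n) = cmod (fourier_coeff g (n - 1))" if "n \<noteq> 0" for n
  proof -
    have "fourier_coeff g n = cis (- x0) * fourier_coeff g (n - 1)" using rec[of n] that by simp
    then show ?thesis by (simp add: norm_mult)
  qed
  have "cmod (fourier_coeff g (int m)) = cmod (fourier_coeff g 0)" for m
  proof (induction m)
    case (Suc m)
    then show ?case using step[of "int (Suc m)"] by simp
  qed simp
  then have z0: "cmod (fourier_coeff g 0) = 0"
    by (rule constant_modulus_coeffs[OF g, of int, rotated]) (simp add: inj_on_def)
  have "cmod (fourier_coeff g (- 1 - int m)) = cmod (fourier_coeff g (- 1))" for m
  proof (induction m)
    case (Suc m)
    then show ?case using step[of "- 1 - int m"] by (simp add: algebra_simps)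
  qed simp
  then have z1: "cmod (fourier_coeff g (- 1)) = 0"
    by (rule constant_modulus_coeffs[OF g, of "\<lambda>m. - 1 - int m", rotated]) (simp add: inj_on_def)
  \<comment> \<open>The indices 0 and -1 head the two half-lines on which the modulus is constant;
    both coefficients vanish, and the recursion at n = 0 isolates h x0.\<close>
  have "fourier_coeff g 0 = 0" "fourier_coeff g (0 - 1) = 0"
    using z0 z1 by simp_all
  then have "- h x0 = 0"
    using rec[of 0] unfolding if_P[OF refl] by (simp only: mult_zero_right diff_zero)
  then show ?thesis by simp
qed

lemma periodic_int:
  assumes "\<And>x. f (x + 2 * pi) = f x"
  shows "f (x + of_int k * (2 * pi)) = f x"
proof (induction k)
  case (nonneg n)
  then show ?case
  proof (induction n)
    case (Suc n)
    then show ?case using assms[of "x + of_nat n * (2 * pi)"] by (simp add: algebra_simps)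
  qed simp
next
  case (neg n)
  then show ?case
  proof (induction n)
    case 0
    then show ?case using assms[of "x - 2 * pi"] by simp
  next
    case (Suc n)
    then show ?case using assms[of "x + of_int (- int (Suc (Suc n))) * (2 * pi)"] by (simp add: algebra_simps)
  qed
qed

text \<open>The sum f of the Fourier series has the same coefficients as u, and
  \<open>vanishing_coeffs\<close> applies to u - f. That lemma needs a derivative at the point,
  which is why the series is controlled in an order \<open>Suc s\<close> of at least one.\<close>

lemma fourier_inversion:
  fixes u :: "real \<Rightarrow> complex"
  assumes per: "\<And>x. u (x + 2 * pi) = u x" and d: "\<And>x. (u has_vector_derivative u' x) (at x)"
    and C: "\<And>n. jb n ^ (Suc s + 3) * cmod (fourier_coeff u n) \<le> C"
  shows "approx (Suc s) u (trunc (fourier_coeff u))"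
proof -
  let ?p = "trunc (fourier_coeff u)"
  define f where "f = (\<lambda>x. lim (\<lambda>N. leval (?p N) x))"
  have f: "approx (Suc s) f ?p"
    unfolding f_def by (rule approx_trunc[OF C])
  have cu: "continuous_on S u" for S
    using d by (meson continuous_on_eq_continuous_within has_vector_derivative_continuous continuous_at_imp_continuous_at_within)
  have cf: "continuous_on S f" for S by (rule approx_continuous[OF f])
  have coef: "fourier_coeff f n = fourier_coeff u n" for n
  proof (rule LIMSEQ_unique[OF approx_fourier_coeff[OF f]])
    have "\<forall>\<^sub>F N in sequentially. lookup (?p N) n = fourier_coeff u n"
      by (rule eventually_sequentiallyI[of "nat \<bar>n\<bar>"]) (auto simp: lookup_trunc)
    then show "(\<lambda>N. lookup (?p N) n) \<longlonglongrightarrow> fourier_coeff u n"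
      by (rule tendsto_eventually)
  qed
  define h where "h = (\<lambda>x. u x - f x)"
  have ch: "continuous_on S h" for S unfolding h_def by (intro continuous_intros cu cf)
  have h0: "h x = 0" if "x \<in> {0<..<2*pi}" for x
  proof (rule vanishing_coeffs[OF ch])
    show "(h has_vector_derivative u' x - Dx f x) (at x)"
      unfolding h_def by (intro has_vector_derivative_diff d approx_Dx(2)[OF f])
    show "fourier_coeff h n = 0" for n
      unfolding h_def using cu cf by (simp add: fourier_coeff_diff coef)
  qed (use that in auto)
  \<comment> \<open>\<open>vanishing_coeffs\<close> only reaches interior points; the endpoints
    follow by continuity.\<close>
  have "h x = 0" if "x \<in> {0..2*pi}" for x
  proof (rule continuous_constant_on_closure[of "{0<..<2*pi}"])
    show "continuous_on (closure {0<..<2 * pi}) h" by (rule ch)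
    show "x \<in> closure {0<..<2*pi}" using that by simp
  qed (use h0 in auto)
  moreover have "h (x + 2 * pi) = h x" for x
    unfolding h_def per f_def leval_periodic ..
  ultimately have "h x = 0" for x
  proof -
    assume *: "\<And>x. x \<in> {0..2*pi} \<Longrightarrow> h x = 0" and per: "\<And>x. h (x + 2 * pi) = h x"
    \<comment> \<open>The number of periods that brings x back to the fundamental interval.\<close>
    define k where "k = - \<lfloor>x / (2 * pi)\<rfloor>"
    have "0 \<le> x / (2 * pi) - \<lfloor>x / (2 * pi)\<rfloor>" "x / (2 * pi) - \<lfloor>x / (2 * pi)\<rfloor> \<le> 1"
      by linarith+
    then have "0 \<le> (x / (2 * pi) + of_int k) * (2 * pi)" "(x / (2 * pi) + of_int k) * (2 * pi) \<le> 1 * (2 * pi)"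
      by (intro mult_nonneg_nonneg mult_right_mono; simp add: k_def)+
    then have "x + of_int k * (2 * pi) \<in> {0..2*pi}" by (simp add: distrib_right)
    then show "h x = 0" using *[of "x + of_int k * (2 * pi)"] periodic_int[of h, OF per] by simp
  qed
  then have "f = u" by (auto simp: h_def fun_eq_iff)
  then show ?thesis using f by simp
qed

section \<open>Decay of Fourier coefficients\<close>

lemma fourier_coeff_deriv:
  assumes d: "\<And>x. (f has_vector_derivative f' x) (at x)" and c: "continuous_on {0..2*pi} f'" and per: "f (2 * pi) = f 0"
  shows "fourier_coeff f' n = \<i> * of_int n * fourier_coeff f n"
proof -
  have cf: "continuous_on S f" for S
    using d by (meson continuous_on_eq_continuous_within has_vector_derivative_continuous continuous_at_imp_continuous_at_within)
  have cis: "((\<lambda>x. cis (- (of_int n * x))) has_vector_derivative (- (\<i> * of_int n) * cis (- (of_int n * x)))) (at x)" for x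
    using cis_has_vector_derivative[of "- of_int n" x] by simp
  have "integral\<^sup>L torus (\<lambda>x. f x * (- (\<i> * of_int n) * cis (- (of_int n * x))) + f' x * cis (- (of_int n * x)))
      = f (2 * pi) * cis (- (of_int n * (2 * pi))) - f 0 * cis (- (of_int n * 0))"
    by (rule torus_FTC[OF has_vector_derivative_mult[OF d cis]]) (intro continuous_intros c cf)
  also have "\<dots> = 0"
    using cis_int_2pi[of "- n"] per by simp
  also have "integral\<^sup>L torus (\<lambda>x. f x * (- (\<i> * of_int n) * cis (- (of_int n * x))) + f' x * cis (- (of_int n * x)))
      = integral\<^sup>L torus (\<lambda>x. (- (\<i> * of_int n)) * (f x * cis (- (of_int n * x)))) + integral\<^sup>L torus (\<lambda>x. f' x * cis (- (of_int n * x)))"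
  proof -
    have eq: "f x * (- (\<i> * of_int n) * cis (- (of_int n * x))) = (- (\<i> * of_int n)) * (f x * cis (- (of_int n * x)))" for x
      by simp
    show ?thesis unfolding eq
      by (intro Bochner_Integration.integral_add torus_integral continuous_intros c cf)
  qed
  finally have "integral\<^sup>L torus (\<lambda>x. f' x * cis (- (of_int n * x))) = \<i> * of_int n * integral\<^sup>L torus (\<lambda>x. f x * cis (- (of_int n * x)))"
    by (simp add: add_eq_0_iff)
  then show ?thesis by (simp add: fourier_coeff_def)
qed

abbreviation fc :: "(real \<Rightarrow> real) \<Rightarrow> int \<Rightarrow> complex" where
  "fc u \<equiv> fourier_coeff (\<lambda>x. complex_of_real (u x))"

text \<open>Repeated integration by parts. For n \<noteq> 0 the weight is at most 2 |n|, whence the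
  factor 2^s. The derivatives are an explicit sequence D so that smooth functions and time slices of
  finitely differentiable solutions are treated alike.\<close>

lemma coeff_decay:
  fixes D :: "nat \<Rightarrow> real \<Rightarrow> real"
  assumes d: "\<And>j x. j < s \<Longrightarrow> (D j has_real_derivative D (Suc j) x) (at x)"
    and cont: "continuous_on UNIV (D s)"
    and per: "\<And>x. D 0 (x + 2 * pi) = D 0 x"
    and B: "\<And>j x. j \<le> s \<Longrightarrow> x \<in> {0..2*pi} \<Longrightarrow> \<bar>D j x\<bar> \<le> B"
  shows "jb n ^ s * cmod (fc (D 0) n) \<le> 2 ^ s * B"
proof -
  have cD: "continuous_on S (D j)" if "j \<le> s" for j S
  proof (cases "j = s")
    case True
    then show ?thesis using cont continuous_on_subset by blast
  next
    case False
    with that have "j < s" by simp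
    then show ?thesis
      by (intro DERIV_continuous_on[OF has_field_derivative_at_within[OF d]])
  qed
  have perD: "D j (x + 2 * pi) = D j x" if "j \<le> s" for j x
    using that
  proof (induction j arbitrary: x)
    case (Suc j)
    have "((\<lambda>x. D j (x + 2 * pi)) has_real_derivative D (Suc j) (x + 2 * pi)) (at x)"
      using d[of j "x + 2 * pi"] Suc.prems by (simp add: DERIV_shift)
    moreover have "(\<lambda>x. D j (x + 2 * pi)) = D j" using Suc by auto
    ultimately have "(D j has_real_derivative D (Suc j) (x + 2 * pi)) (at x)" by simp
    from DERIV_unique[OF this d[of j x]] show ?case using Suc.prems by simp
  qed (rule per)
  have pow: "fc (D j) n = (\<i> * of_int n) ^ j * fc (D 0) n" if "j \<le> s" for j
    using that
  proof (induction j)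
    case (Suc j)
    have "fc (D (Suc j)) n = \<i> * of_int n * fc (D j) n"
    proof (rule fourier_coeff_deriv)
      fix x
      show "((\<lambda>x. complex_of_real (D j x)) has_vector_derivative complex_of_real (D (Suc j) x)) (at x)"
        using d[of j x] Suc.prems by (intro has_vector_derivative_of_real) simp
      show "continuous_on {0..2 * pi} (\<lambda>x. complex_of_real (D (Suc j) x))"
        using cD[of "Suc j"] Suc.prems by (intro continuous_intros)
      show "complex_of_real (D j (2 * pi)) = complex_of_real (D j 0)"
        using perD[of j 0] Suc.prems by simp
    qed
    then show ?case using Suc by simp
  qed simp
  have bound: "cmod (fc (D j) n) \<le> B" if "j \<le> s" for j
    by (rule fourier_coeff_bound) (use that cD B in \<open>auto intro!: continuous_intros\<close>)
  have "cmod (\<i> * complex_of_int n) = \<bar>real_of_int n\<bar>" by (simp add: norm_mult)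
  then have s: "\<bar>real_of_int n\<bar> ^ s * cmod (fc (D 0) n) \<le> B"
    using bound[OF order_refl] unfolding pow[OF order_refl] norm_mult[of "_ ^ _"] norm_power by (simp only:)
  show ?thesis
  proof (cases "n = 0")
    case True
    have "0 \<le> B" using bound[of 0] norm_ge_zero order_trans by blast
    then have "B \<le> 2 ^ s * B" by (simp add: mult_le_cancel_right1)
    then show ?thesis using bound[of 0] True by simp
  next
    case False
    then have "1 \<le> \<bar>real_of_int n\<bar>" by simp
    then have "jb n ^ s \<le> (2 * \<bar>real_of_int n\<bar>) ^ s" by (intro power_mono) auto
    then have "jb n ^ s * cmod (fc (D 0) n) \<le> (2 * \<bar>real_of_int n\<bar>) ^ s * cmod (fc (D 0) n)"
      by (rule mult_right_mono) simp
    also have "\<dots> = 2 ^ s * (\<bar>real_of_int n\<bar> ^ s * cmod (fc (D 0) n))" by (simp add: power_mult_distrib)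
    also have "\<dots> \<le> 2 ^ s * B" using s by (intro mult_left_mono) auto
    finally show ?thesis .
  qed
qed

lemma smooth_coeff_decay:
  assumes v: "v \<in> smooth_mean_zero"
  obtains C where "\<And>n. jb n ^ s * cmod (fc v n) \<le> C"
proof -
  have d: "((deriv ^^ j) v has_real_derivative (deriv ^^ Suc j) v x) (at x)" for j x
    using v by (simp add: smooth_mean_zero_def DERIV_deriv_iff_field_differentiable)
  have c: "continuous_on S ((deriv ^^ j) v)" for j S
    by (rule DERIV_continuous_on[OF has_field_derivative_at_within[OF d]])
  have "\<exists>B. \<forall>x\<in>{0..2*pi}. \<bar>(deriv ^^ j) v x\<bar> \<le> B" for j
  proof -
    have "compact ((deriv ^^ j) v ` {0..2*pi})" by (intro compact_continuous_image c) auto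
    then have "bounded ((deriv ^^ j) v ` {0..2*pi})" by (rule compact_imp_bounded)
    then show ?thesis by (auto simp: bounded_iff)
  qed
  then obtain B where B: "\<And>j x. x \<in> {0..2*pi} \<Longrightarrow> \<bar>(deriv ^^ j) v x\<bar> \<le> B j" by metis
  have pos: "0 \<le> B j" for j using B[of 0 j] by simp
  have "\<bar>(deriv ^^ j) v x\<bar> \<le> (\<Sum>i\<le>s. B i)" if "j \<le> s" "x \<in> {0..2*pi}" for j x
    using B[OF that(2), of j] member_le_sum[of j "{..s}" B] pos that by auto
  then have "jb n ^ s * cmod (fc ((deriv ^^ 0) v) n) \<le> 2 ^ s * (\<Sum>i\<le>s. B i)" for n
    by (intro coeff_decay d c) (use v in \<open>auto simp: smooth_mean_zero_def periodic_mean_zero_def\<close>)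
  then show ?thesis using that[of "2 ^ s * (\<Sum>i\<le>s. B i)"] by simp
qed

lemma smooth_approx_trunc:
  assumes v: "v \<in> smooth_mean_zero"
  shows "approx s (\<lambda>x. complex_of_real (v x)) (trunc (fc v))"
proof -
  obtain C where C: "\<And>n. jb n ^ (Suc s + 3) * cmod (fc v n) \<le> C"
    using smooth_coeff_decay[OF v] by metis
  have d: "(v has_real_derivative deriv v x) (at x)" for x
  proof -
    have "(deriv ^^ 0) v field_differentiable at x"
      using v unfolding smooth_mean_zero_def by blast
    then show ?thesis by (simp add: DERIV_deriv_iff_field_differentiable)
  qed
  have "approx (Suc s) (\<lambda>x. complex_of_real (v x)) (trunc (fc v))"
  proof (rule fourier_inversion[OF _ _ C])
    show "((\<lambda>x. complex_of_real (v x)) has_vector_derivative complex_of_real (deriv v x)) (at x)" for x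
      using d[of x] by (intro has_vector_derivative_of_real) (simp add: has_real_derivative_iff_has_vector_derivative)
  qed (use v in \<open>auto simp: smooth_mean_zero_def periodic_mean_zero_def\<close>)
  then show ?thesis by (rule approx_mono) simp
qed

subsection \<open>Energies of trigonometric polynomials\<close>

text \<open>The bound for the zero mode handles the leading term, and the induction handles the
  lower energies, whose hypotheses follow because their norms are weaker. The depth enters only
  through the bound \<kappa> for its inverse, both in the symbol class and in the powers, so C
  serves all depths at once.\<close>

lemma lenergy_lipschitz:
  assumes \<kappa>: "0 \<le> \<kappa>" and B: "0 \<le> B"
  shows "\<exists>C\<ge>0. \<forall>\<delta>\<in>depths \<kappa>. \<forall>p q \<theta>. lookup p 0 = 0 \<longrightarrow> lookup q 0 = 0 \<longrightarrow> hnorm2 k q \<le> B \<longrightarrow>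
     hnorm2 k (p - q) \<le> \<theta>\<^sup>2 \<longrightarrow> 0 < \<theta> \<longrightarrow> \<theta> \<le> 1 \<longrightarrow> \<bar>lenergy \<delta> p k - lenergy \<delta> q k\<bar> \<le> C * \<theta>"
proof (induction k rule: less_induct)
  case (less k)
  define P where "P = (\<lambda>j C. \<forall>\<delta>\<in>depths \<kappa>. \<forall>p q \<theta>. lookup p 0 = 0 \<longrightarrow> lookup q 0 = 0 \<longrightarrow> hnorm2 j q \<le> B \<longrightarrow>
     hnorm2 j (p - q) \<le> \<theta>\<^sup>2 \<longrightarrow> 0 < \<theta> \<longrightarrow> \<theta> \<le> 1 \<longrightarrow> \<bar>lenergy \<delta> p j - lenergy \<delta> q j\<bar> \<le> C * \<theta>)"
  have "\<forall>j\<in>{..<k}. \<exists>C. 0 \<le> C \<and> P j C"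
    unfolding P_def using less by auto
  from bchoice[OF this] obtain C where "\<forall>j\<in>{..<k}. 0 \<le> C j \<and> P j (C j)" ..
  then have C: "0 \<le> C j" "P j (C j)" if "j < k" for j using that by auto
  have "form (2 + 3 * \<kappa>) (k + 2) (\<lambda>l p. chiL l p (k + 2))"
    using \<kappa> by (intro form_chiL) auto
  from form_lipschitz[OF this B] obtain C0 where C0: "0 \<le> C0" "\<And>l p q \<theta>. l \<in> symbols (2 + 3 * \<kappa>) \<Longrightarrow> lookup p 0 = 0 \<Longrightarrow> lookup q 0 = 0 \<Longrightarrow> hnorm2 k q \<le> B \<Longrightarrow>
     hnorm2 k (p - q) \<le> \<theta>\<^sup>2 \<Longrightarrow> 0 < \<theta> \<Longrightarrow> \<theta> \<le> 1 \<Longrightarrow> cmod (lookup (chiL l p (k + 2)) 0 - lookup (chiL l q (k + 2)) 0) \<le> C0 * \<theta>"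
    by blast
  define a where "a = (\<lambda>j. of_nat ((k + 2) choose (j + 2)) * b j)"
  define K where "K = \<bar>(- 1) ^ (k + 1) / (4 * b k)\<bar> * (2 * pi * C0 + 4 * (\<Sum>j<k. \<kappa> ^ (k - j) * \<bar>a j\<bar> * C j))"
  have K: "0 \<le> K"
    unfolding K_def using C0(1) C(1) \<kappa> by (intro mult_nonneg_nonneg add_nonneg_nonneg sum_nonneg) auto
  have "\<bar>lenergy \<delta> p k - lenergy \<delta> q k\<bar> \<le> K * \<theta>"
    if \<delta>: "\<delta> \<in> depths \<kappa>" and pq: "lookup p 0 = 0" "lookup q 0 = 0" "hnorm2 k q \<le> B" "hnorm2 k (p - q) \<le> \<theta>\<^sup>2" "0 < \<theta>" "\<theta> \<le> 1"
    for \<delta> p q \<theta>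
  proof -
    let ?X = "\<lambda>p. lookup (chiL (lsym \<delta>) p (k + 2)) 0" and ?\<iota> = "inv_depth \<delta>"
    have \<iota>: "0 \<le> ?\<iota>" "?\<iota> \<le> \<kappa>" using \<delta> inv_depth_nonneg by (auto simp: depths_def)
    have X: "cmod (?X p - ?X q) \<le> C0 * \<theta>"
      by (rule C0(2)[OF lsym_in_symbols[OF \<delta>] pq])
    have eq: "lenergy \<delta> r k = (- 1) ^ (k + 1) / (4 * b k) *
       (2 * pi * Re (?X r) - 4 * (- 1) ^ (k + 1) * (\<Sum>j<k. ?\<iota> ^ (k - j) * a j * lenergy \<delta> r j))" for r
      by (simp add: lenergy.simps[of _ _ k] a_def mult.assoc)
    have "lenergy \<delta> p k - lenergy \<delta> q k = (- 1) ^ (k + 1) / (4 * b k) *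
       (2 * pi * Re (?X p - ?X q) - 4 * (- 1) ^ (k + 1) * (\<Sum>j<k. ?\<iota> ^ (k - j) * a j * (lenergy \<delta> p j - lenergy \<delta> q j)))"
    proof -
      have gen: "c * (x - e * s) - c * (y - e * t) = c * ((x - y) - e * (s - t))" for c e s t x y :: real
        by (simp add: algebra_simps)
      show ?thesis
        unfolding eq gen by (simp only: right_diff_distrib sum_subtractf minus_complex.sel)
    qed
    then have "\<bar>lenergy \<delta> p k - lenergy \<delta> q k\<bar> = \<bar>(- 1) ^ (k + 1) / (4 * b k)\<bar> *
       \<bar>2 * pi * Re (?X p - ?X q) - 4 * (- 1) ^ (k + 1) * (\<Sum>j<k. ?\<iota> ^ (k - j) * a j * (lenergy \<delta> p j - lenergy \<delta> q j))\<bar>"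
      by (simp only: abs_mult)
    also have "\<dots> \<le> \<bar>(- 1) ^ (k + 1) / (4 * b k)\<bar> * ((2 * pi * C0 + 4 * (\<Sum>j<k. \<kappa> ^ (k - j) * \<bar>a j\<bar> * C j)) * \<theta>)"
    proof (rule mult_left_mono)
      have 1: "\<bar>2 * pi * Re (?X p - ?X q)\<bar> \<le> 2 * pi * (C0 * \<theta>)"
        using X abs_Re_le_cmod[of "?X p - ?X q"] by (simp add: abs_mult)
      have "\<bar>\<Sum>j<k. ?\<iota> ^ (k - j) * a j * (lenergy \<delta> p j - lenergy \<delta> q j)\<bar> \<le> (\<Sum>j<k. \<kappa> ^ (k - j) * \<bar>a j\<bar> * (C j * \<theta>))"
      proof (rule order.trans[OF sum_abs sum_mono])
        fix j assume "j \<in> {..<k}"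
        then have j: "j < k" by simp
        have "\<bar>lenergy \<delta> p j - lenergy \<delta> q j\<bar> \<le> C j * \<theta>"
          using C(2)[OF j] \<delta> pq hnorm2_mono[of j k q] hnorm2_mono[of j k "p - q"] j by (simp add: P_def)
        then show "\<bar>?\<iota> ^ (k - j) * a j * (lenergy \<delta> p j - lenergy \<delta> q j)\<bar> \<le> \<kappa> ^ (k - j) * \<bar>a j\<bar> * (C j * \<theta>)"
          unfolding abs_mult using \<iota> \<kappa> C(1)[OF j] by (intro mult_mono power_mono) (auto intro!: power_mono simp: power_abs)
      qed
      then have 2: "\<bar>4 * (- 1) ^ (k + 1) * (\<Sum>j<k. ?\<iota> ^ (k - j) * a j * (lenergy \<delta> p j - lenergy \<delta> q j))\<bar> \<le> 4 * (\<Sum>j<k. \<kappa> ^ (k - j) * \<bar>a j\<bar> * (C j * \<theta>))"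
        by (simp add: abs_mult power_abs)
      have "\<bar>2 * pi * Re (?X p - ?X q) - 4 * (- 1) ^ (k + 1) * (\<Sum>j<k. ?\<iota> ^ (k - j) * a j * (lenergy \<delta> p j - lenergy \<delta> q j))\<bar>
         \<le> 2 * pi * (C0 * \<theta>) + 4 * (\<Sum>j<k. \<kappa> ^ (k - j) * \<bar>a j\<bar> * (C j * \<theta>))"
        using 1 2 by linarith
      also have "\<dots> = (2 * pi * C0 + 4 * (\<Sum>j<k. \<kappa> ^ (k - j) * \<bar>a j\<bar> * C j)) * \<theta>"
        by (simp add: distrib_right sum_distrib_right mult.assoc)
      finally show "\<bar>2 * pi * Re (?X p - ?X q) - 4 * (- 1) ^ (k + 1) * (\<Sum>j<k. ?\<iota> ^ (k - j) * a j * (lenergy \<delta> p j - lenergy \<delta> q j))\<bar>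
         \<le> (2 * pi * C0 + 4 * (\<Sum>j<k. \<kappa> ^ (k - j) * \<bar>a j\<bar> * C j)) * \<theta>" .
    qed simp
    also have "\<dots> = K * \<theta>" by (simp add: K_def mult.assoc)
    finally show ?thesis .
  qed
  then show ?case using K by blast
qed

text \<open>The analogue of \<open>lder\<close> for limits, again with a common finite support. Here
  the symbols may vary along the filter, for the limit of infinite depth at a fixed
  polynomial.\<close>

definition lconv :: "'a filter \<Rightarrow> ('a \<Rightarrow> laurent) \<Rightarrow> laurent \<Rightarrow> bool" where
  "lconv F f p \<longleftrightarrow> (\<exists>A. finite A \<and> keys p \<subseteq> A \<and> (\<forall>s. keys (f s) \<subseteq> A)) \<and> (\<forall>n. ((\<lambda>s. lookup (f s) n) \<longlongrightarrow> lookup p n) F)"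

lemma lconv_const: "lconv F (\<lambda>s. p) p"
  unfolding lconv_def by (intro conjI exI[of _ "keys p"] allI) auto

lemma lconv_add: "lconv F f p \<Longrightarrow> lconv F g q \<Longrightarrow> lconv F (\<lambda>s. f s + g s) (p + q)"
  unfolding lconv_def
proof (intro conjI allI; elim conjE exE)
  fix A B assume "finite A" "keys p \<subseteq> A" "\<forall>s. keys (f s) \<subseteq> A" "finite B" "keys q \<subseteq> B" "\<forall>s. keys (g s) \<subseteq> B"
  then show "\<exists>C. finite C \<and> keys (p + q) \<subseteq> C \<and> (\<forall>s. keys (f s + g s) \<subseteq> C)"
    by (intro exI[of _ "A \<union> B"] conjI allI finite_UnI order.trans[OF Poly_Mapping.keys_add]) auto
qed (auto simp: lookup_add intro: tendsto_add)

lemma lconv_mult_op: "lconv F f p \<Longrightarrow> (\<And>n. ((\<lambda>s. m s n) \<longlongrightarrow> m' n) F) \<Longrightarrow> lconv F (\<lambda>s. mult_op (m s) (f s)) (mult_op m' p)"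
  unfolding lconv_def
proof (intro conjI allI; elim conjE exE)
  fix A assume "finite A" "keys p \<subseteq> A" "\<forall>s. keys (f s) \<subseteq> A"
  then show "\<exists>A. finite A \<and> keys (mult_op m' p) \<subseteq> A \<and> (\<forall>s. keys (mult_op (m s) (f s)) \<subseteq> A)"
    using keys_mult_op by (intro exI[of _ A]) blast
qed (auto intro: tendsto_mult)

lemma lconv_times:
  assumes f: "lconv F f p" and g: "lconv F g q"
  shows "lconv F (\<lambda>s. f s * g s) (p * q)"
proof -
  obtain A where A: "finite A" "keys p \<subseteq> A" "\<And>s. keys (f s) \<subseteq> A"
    using f unfolding lconv_def by blast
  obtain B where B: "finite B" "keys q \<subseteq> B" "\<And>s. keys (g s) \<subseteq> B"
    using g unfolding lconv_def by blast
  let ?C = "(\<lambda>(a, c). a + c) ` (A \<times> B)"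
  have "keys (f s * g s) \<subseteq> ?C" for s
    using Poly_Mapping.keys_mult[of "f s" "g s"] A(3)[of s] B(3)[of s] by force
  moreover have "keys (p * q) \<subseteq> ?C"
    using Poly_Mapping.keys_mult[of p q] A(2) B(2) by force
  ultimately have "\<exists>C. finite C \<and> keys (p * q) \<subseteq> C \<and> (\<forall>s. keys (f s * g s) \<subseteq> C)"
    using A(1) B(1) by (intro exI[of _ ?C]) auto
  moreover have "((\<lambda>s. lookup (f s * g s) n) \<longlongrightarrow> lookup (p * q) n) F" for n
    unfolding lookup_times[OF A(1,2)] lookup_times[OF A(1,3)]
    using f g by (intro tendsto_sum tendsto_mult) (auto simp: lconv_def)
  ultimately show ?thesis by (simp add: lconv_def)
qed

lemma lconv_cst: "lconv F f p \<Longrightarrow> lconv F (\<lambda>s. cst c * f s) (cst c * p)"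
  by (intro lconv_times lconv_const)

lemma lconv_uminus: "lconv F f p \<Longrightarrow> lconv F (\<lambda>s. - f s) (- p)"
  using lconv_cst[of F f p "-1"] by (simp add: single_uminus)

lemma lconv_diff: "lconv F f p \<Longrightarrow> lconv F g q \<Longrightarrow> lconv F (\<lambda>s. f s - g s) (p - q)"
  using lconv_add[OF _ lconv_uminus, of F f p g q] by simp

lemma lconv_sum: "(\<And>i. i \<in> I \<Longrightarrow> lconv F (f i) (p i)) \<Longrightarrow> lconv F (\<lambda>s. \<Sum>i\<in>I. f i s) (\<Sum>i\<in>I. p i)"
  by (induction I rule: infinite_finite_induct) (auto intro: lconv_const lconv_add)

lemma lconv_prod_list: "(\<And>m. m \<in> set ms \<Longrightarrow> lconv F (f m) (p m)) \<Longrightarrow> lconv F (\<lambda>s. \<Prod>m\<leftarrow>ms. f m s) (\<Prod>m\<leftarrow>ms. p m)"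
  by (induction ms) (auto intro: lconv_const lconv_times)

lemma lconv_chiL:
  assumes l: "\<And>n. ((\<lambda>s. l s n) \<longlongrightarrow> l' n) F"
  shows "lconv F (\<lambda>s. chiL (l s) p n) (chiL l' p n)"
proof (induction n rule: less_induct)
  case (less n)
  consider "n = 0" | "n = 1" | "n \<ge> 2" by linarith
  then show ?case
  proof cases
    case 3
    have "lconv F (\<lambda>s. - (\<Sum>j=2..n. cst (1 / fact j) * (\<Sum>ns\<in>compositions n j. \<Prod>m\<leftarrow>ns. chiL (l s) p m))
           - mult_op (l s) (chiL (l s) p (n - 1)))
       (- (\<Sum>j=2..n. cst (1 / fact j) * (\<Sum>ns\<in>compositions n j. \<Prod>m\<leftarrow>ns. chiL l' p m)) - mult_op l' (chiL l' p (n - 1)))"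
      by (intro lconv_diff lconv_uminus lconv_sum lconv_cst lconv_prod_list lconv_mult_op less l)
        (use 3 compositions_less in auto)
    then show ?thesis using 3 by (simp only: chiL.simps[of _ _ n]) simp
  qed (auto intro: lconv_const)
qed

section \<open>The limit of infinite depth for a fixed Laurent polynomial\<close>

lemma inv_depth_limit: "((\<lambda>d. inv_depth (ereal d)) \<longlongrightarrow> inv_depth \<infinity>) at_top"
proof -
  have "((\<lambda>d::real. inverse d) \<longlongrightarrow> 0) at_top" by (rule tendsto_inverse_0_at_top) (rule filterlim_ident)
  then have "((\<lambda>d. inv_depth (ereal d)) \<longlongrightarrow> 0) at_top"
  proof (rule Lim_transform_eventually)
    show "\<forall>\<^sub>F d in at_top. inverse d = inv_depth (ereal d)"
      using eventually_gt_at_top[of 0] by (rule eventually_mono) (simp add: inv_depth_def)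
  qed
  then show ?thesis by (simp add: inv_depth_def)
qed

lemma lsym_limit: "((\<lambda>d. lsym (ereal d) n) \<longlongrightarrow> lsym \<infinity> n) at_top"
proof -
  have pos: "((\<lambda>d. gsym (ereal d) n) \<longlongrightarrow> 1) at_top" if n: "n > 0" for n
  proof -
    have inv: "((\<lambda>d. 1 / (d * real_of_int n)) \<longlongrightarrow> 0) at_top"
    proof -
      have "((\<lambda>d::real. inverse d) \<longlongrightarrow> 0) at_top" by (rule tendsto_inverse_0_at_top) (rule filterlim_ident)
      from tendsto_mult_left[OF this, of "1 / real_of_int n"] show ?thesis
        by (simp add: divide_inverse mult.commute)
    qed
    have "((\<lambda>d. coth (d * real_of_int n)) \<longlongrightarrow> 1) at_top"
    proof (rule tendsto_sandwich)
      show "\<forall>\<^sub>F d in at_top. 1 \<le> coth (d * real_of_int n)"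
        using eventually_gt_at_top[of 0] by (rule eventually_mono) (use n in \<open>auto intro: coth_bound\<close>)
      show "\<forall>\<^sub>F d in at_top. coth (d * real_of_int n) \<le> 1 + 1 / (d * real_of_int n)"
        using eventually_gt_at_top[of 0] by (rule eventually_mono) (use n in \<open>auto intro!: coth_bound(2)\<close>)
      show "((\<lambda>d. 1 + 1 / (d * real_of_int n)) \<longlongrightarrow> 1) at_top"
        using tendsto_add[OF tendsto_const inv, of 1] by simp
    qed simp
    from tendsto_diff[OF this inv] show ?thesis using n by (simp add: gsym_def)
  qed
  have "((\<lambda>d. gsym (ereal d) n) \<longlongrightarrow> gsym \<infinity> n) at_top"
  proof -
    consider "n > 0" | "n = 0" | "- n > 0" by linarith
    then show ?thesis
    proof cases
      case 3
      have "((\<lambda>d. - gsym (ereal d) (- n)) \<longlongrightarrow> - 1) at_top" using pos[OF 3] by (rule tendsto_minus)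
      then show ?thesis using 3 by (simp add: gsym_odd gsym_def[of \<infinity>])
    qed (use pos in \<open>auto simp: gsym_def\<close>)
  qed
  then show ?thesis unfolding lsym_def by (intro tendsto_intros inv_depth_limit)
qed

lemma lenergy_depth_limit: "((\<lambda>d. lenergy (ereal d) p k) \<longlongrightarrow> lenergy \<infinity> p k) at_top"
proof (induction k rule: less_induct)
  case (less k)
  have "((\<lambda>d. lookup (chiL (lsym (ereal d)) p (k + 2)) 0) \<longlongrightarrow> lookup (chiL (lsym \<infinity>) p (k + 2)) 0) at_top"
    using lconv_chiL[OF lsym_limit] by (simp only: lconv_def)
  then show ?case
    unfolding lenergy.simps[of _ _ k] by (intro tendsto_intros less inv_depth_limit) auto
qed

subsection \<open>Energies on the Sobolev space\<close>

lemma integrable_times_cis: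
  assumes "integrable torus f"
  shows "integrable torus (\<lambda>x. f x * cis (- (of_int n * x)))"
proof (rule Bochner_Integration.integrable_bound[OF assms])
  have "(\<lambda>x. cis (- (of_int n * x))) \<in> borel_measurable torus"
    by (rule continuous_imp_measurable_on_sets_lebesgue) (auto intro!: continuous_intros)
  then show "(\<lambda>x. f x * cis (- (of_int n * x))) \<in> borel_measurable torus"
    using assms by (intro borel_measurable_times) auto
qed (simp add: norm_mult)

lemma fc_diff:
  assumes "integrable torus u" "integrable torus v"
  shows "fc (\<lambda>x. v x - u x) n = fc v n - fc u n"
proof -
  have i: "integrable torus (\<lambda>x. complex_of_real (u x) * cis (- (of_int n * x)))" "integrable torus (\<lambda>x. complex_of_real (v x) * cis (- (of_int n * x)))"
    using assms by (auto intro!: integrable_times_cis)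
  show ?thesis
    unfolding fourier_coeff_def of_real_diff left_diff_distrib Bochner_Integration.integral_diff[OF i(2,1)]
    by (simp add: diff_divide_distrib)
qed

lemma fc_zero_mode: "periodic_mean_zero u \<Longrightarrow> fc u 0 = 0"
  by (simp add: fourier_coeff_def periodic_mean_zero_def)

lemma fc_cnj: "fc u (- n) = cnj (fc u n)"
proof -
  have "cnj (integral\<^sup>L torus (\<lambda>x. complex_of_real (u x) * cis (- (of_int n * x)))) =
     integral\<^sup>L torus (\<lambda>x. cnj (complex_of_real (u x) * cis (- (of_int n * x))))"
    by (rule Bochner_Integration.integral_cnj[symmetric])
  then show ?thesis by (simp add: fourier_coeff_def cis_cnj)
qed

lemma sobolev_terms_eq: "sobolev_terms (real k / 2) u n = wt k n * (cmod (fc u n))\<^sup>2"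
  by (simp add: sobolev_terms_def wt_def)

lemma summable_sobolev_terms:
  assumes C: "\<And>n. jb n ^ (k + 1) * cmod (fc v n) \<le> C"
  shows "sobolev_terms (real k / 2) v summable_on UNIV"
proof -
  obtain Z where Z: "\<And>A. finite A \<Longrightarrow> (\<Sum>a\<in>A. 1 / (jb a)\<^sup>2) \<le> Z"
    using inverse_square_sum by metis
  have C0: "0 \<le> C" using order.trans[OF _ C[of 0]] by simp
  have le: "sobolev_terms (real k / 2) v n \<le> C\<^sup>2 * (1 / (jb n)\<^sup>2)" for n
  proof -
    let ?w = "jb n"
    have "?w\<^sup>2 * (wt k n * (cmod (fc v n))\<^sup>2) \<le> ?w\<^sup>2 * (?w ^ k * (cmod (fc v n))\<^sup>2)"
      by (intro mult_left_mono mult_right_mono wt_le_abs_power) auto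
    also have "\<dots> \<le> ?w\<^sup>2 * ((?w ^ k)\<^sup>2 * (cmod (fc v n))\<^sup>2)"
    proof (intro mult_left_mono mult_right_mono)
      have "1 \<le> ?w ^ k" by (rule one_le_power) simp
      then show "?w ^ k \<le> (?w ^ k)\<^sup>2" by (rule self_le_power) simp
    qed auto
    also have "\<dots> = (?w ^ (k + 1) * cmod (fc v n))\<^sup>2" by (simp add: power_mult_distrib power_add mult_ac)
    also have "\<dots> \<le> C\<^sup>2" by (rule power_mono[OF C]) auto
    finally have "?w\<^sup>2 * sobolev_terms (real k / 2) v n \<le> C\<^sup>2" by (simp add: sobolev_terms_eq)
    moreover have "0 < ?w\<^sup>2" by (simp add: add_pos_nonneg)
    ultimately show ?thesis by (simp add: pos_le_divide_eq mult.commute)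
  qed
  have "(\<Sum>n\<in>F. sobolev_terms (real k / 2) v n) \<le> C\<^sup>2 * Z" if "finite F" for F
  proof -
    have "(\<Sum>n\<in>F. sobolev_terms (real k / 2) v n) \<le> (\<Sum>n\<in>F. C\<^sup>2 * (1 / (jb n)\<^sup>2))"
      by (intro sum_mono le)
    also have "\<dots> \<le> C\<^sup>2 * Z"
      unfolding sum_distrib_left[symmetric] by (intro mult_left_mono Z that) auto
    finally show ?thesis .
  qed
  then show ?thesis
    by (intro nonneg_bdd_above_summable_on bdd_aboveI2) (auto simp: sobolev_terms_def)
qed

lemma summable_sobolev_smooth:
  "v \<in> smooth_mean_zero \<Longrightarrow> sobolev_terms (real k / 2) v summable_on UNIV"
  by (meson smooth_coeff_decay summable_sobolev_terms)

text \<open>A function of Sobolev order k/2 is visible to the energies only through its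
  coefficients, so the limit along truncations is studied for the sequence alone.\<close>

locale sobolev_coeffs =
  fixes k :: nat and c :: "int \<Rightarrow> complex"
  assumes c0: "c 0 = 0" and summable: "(\<lambda>n. wt k n * (cmod (c n))\<^sup>2) summable_on UNIV"
begin

definition total :: real where
  "total = infsum (\<lambda>n. wt k n * (cmod (c n))\<^sup>2) UNIV"

lemma partial_le_total: "finite F \<Longrightarrow> (\<Sum>n\<in>F. wt k n * (cmod (c n))\<^sup>2) \<le> total"
  unfolding total_def by (intro finite_sum_le_infsum summable) (auto simp: wt_nonneg)

lemma total_nonneg: "0 \<le> total"
  using partial_le_total[of "{}"] by simp

lemma hnorm2_trunc: "hnorm2 k (trunc c N) \<le> total"
proof -
  have "hnorm2 k (trunc c N) \<le> (\<Sum>n\<in>{- int N..int N}. wt k n * (cmod (c n))\<^sup>2)"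
    unfolding hnorm2_eq[OF _ keys_trunc, simplified]
    by (intro sum_mono) (auto simp: lookup_trunc)
  also have "\<dots> \<le> total" by (rule partial_le_total) simp
  finally show ?thesis .
qed

lemma tail:
  assumes "0 < \<epsilon>"
  obtains N0 where "\<And>F. finite F \<Longrightarrow> (\<And>n. n \<in> F \<Longrightarrow> int N0 < \<bar>n\<bar>) \<Longrightarrow> (\<Sum>n\<in>F. wt k n * (cmod (c n))\<^sup>2) \<le> \<epsilon>"
proof -
  let ?f = "\<lambda>n. wt k n * (cmod (c n))\<^sup>2"
  obtain F0 where F0: "finite F0" "dist (sum ?f F0) (infsum ?f UNIV) \<le> \<epsilon>"
    using infsum_finite_approximation[OF summable assms] by blast
  \<comment> \<open>The sum of the moduli bounds each of them and avoids a maximum over a possibly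
    empty set.\<close>
  define N0 where "N0 = nat (\<Sum>n\<in>F0. \<bar>n\<bar>)"
  have N0: "\<bar>n\<bar> \<le> int N0" if "n \<in> F0" for n
    using member_le_sum[of n F0 abs] that F0(1) by (simp add: N0_def sum_nonneg)
  have "(\<Sum>n\<in>F. ?f n) \<le> \<epsilon>" if F: "finite F" "\<And>n. n \<in> F \<Longrightarrow> int N0 < \<bar>n\<bar>" for F
  proof -
    have "F0 \<inter> F = {}" using N0 F(2) by force
    then have "sum ?f F0 + sum ?f F = sum ?f (F0 \<union> F)"
      using F0(1) F(1) by (simp add: sum.union_disjoint)
    also have "\<dots> \<le> total" using F0(1) F(1) by (intro partial_le_total) auto
    finally show ?thesis using F0(2) by (simp add: total_def dist_real_def)
  qed
  then show ?thesis using that by blast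
qed

lemma hnorm2_trunc_tail:
  assumes "0 < \<epsilon>"
  obtains N0 where "\<And>M N. N0 \<le> M \<Longrightarrow> N0 \<le> N \<Longrightarrow> hnorm2 k (trunc c M - trunc c N) \<le> \<epsilon>"
proof -
  obtain N0 where N0: "\<And>F. finite F \<Longrightarrow> (\<And>n. n \<in> F \<Longrightarrow> int N0 < \<bar>n\<bar>) \<Longrightarrow> (\<Sum>n\<in>F. wt k n * (cmod (c n))\<^sup>2) \<le> \<epsilon>"
    using tail[OF assms] by metis
  have "hnorm2 k (trunc c M - trunc c N) \<le> \<epsilon>" if MN: "N0 \<le> M" "N0 \<le> N" for M N
  proof -
    have n: "int N0 < \<bar>n\<bar>" if "n \<in> keys (trunc c M - trunc c N)" for n
      using that MN by (auto simp: in_keys_iff lookup_minus lookup_trunc split: if_splits)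
    have "hnorm2 k (trunc c M - trunc c N) \<le> (\<Sum>n\<in>keys (trunc c M - trunc c N). wt k n * (cmod (c n))\<^sup>2)"
      unfolding hnorm2_def by (intro sum_mono mult_left_mono power_mono) (auto simp: lookup_minus lookup_trunc wt_nonneg)
    also have "\<dots> \<le> \<epsilon>" using n by (intro N0) auto
    finally show ?thesis .
  qed
  then show ?thesis using that by blast
qed

text \<open>The point is the order of quantifiers: N0 is chosen before \<delta>. Truncations are
  Cauchy in the Sobolev norm regardless of the depth, and the Lipschitz constant is common to all
  depths.\<close>

lemma lenergy_uniform_limit:
  assumes \<kappa>: "0 \<le> \<kappa>" and e: "0 < e"
  obtains N0 L where "\<And>\<delta>. \<delta> \<in> depths \<kappa> \<Longrightarrow> (\<lambda>N. lenergy \<delta> (trunc c N) k) \<longlonglongrightarrow> L \<delta>"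
    "\<And>\<delta> N. \<delta> \<in> depths \<kappa> \<Longrightarrow> N0 \<le> N \<Longrightarrow> \<bar>lenergy \<delta> (trunc c N) k - L \<delta>\<bar> \<le> e"
proof -
  obtain C where C: "0 \<le> C" "\<And>\<delta> p q \<theta>. \<delta> \<in> depths \<kappa> \<Longrightarrow> lookup p 0 = 0 \<Longrightarrow> lookup q 0 = 0 \<Longrightarrow> hnorm2 k q \<le> total \<Longrightarrow>
     hnorm2 k (p - q) \<le> \<theta>\<^sup>2 \<Longrightarrow> 0 < \<theta> \<Longrightarrow> \<theta> \<le> 1 \<Longrightarrow> \<bar>lenergy \<delta> p k - lenergy \<delta> q k\<bar> \<le> C * \<theta>"
    using lenergy_lipschitz[OF \<kappa> total_nonneg, of k] by blast
  have lt0: "lookup (trunc c N) 0 = 0" for N by (simp add: lookup_trunc c0)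
  have cauchy: "\<exists>N0. \<forall>M N \<delta>. \<delta> \<in> depths \<kappa> \<longrightarrow> N0 \<le> M \<longrightarrow> N0 \<le> N \<longrightarrow> \<bar>lenergy \<delta> (trunc c M) k - lenergy \<delta> (trunc c N) k\<bar> \<le> r"
    if r: "0 < r" for r
  proof -
    \<comment> \<open>The Lipschitz bound requires \<theta> \<le> 1; C + 1 in the denominator covers
      C = 0.\<close>
    define \<theta> where "\<theta> = min 1 (r / (C + 1))"
    have \<theta>: "0 < \<theta>" "\<theta> \<le> 1" "C * \<theta> \<le> r"
    proof -
      show "0 < \<theta>" "\<theta> \<le> 1" using r C(1) by (auto simp: \<theta>_def)
      have "C * \<theta> \<le> (C + 1) * (r / (C + 1))"
        using C(1) r \<open>0 < \<theta>\<close> by (intro mult_mono) (auto simp: \<theta>_def)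
      also have "\<dots> = r" using C(1) by simp
      finally show "C * \<theta> \<le> r" .
    qed
    obtain N0 where N0: "\<And>M N. N0 \<le> M \<Longrightarrow> N0 \<le> N \<Longrightarrow> hnorm2 k (trunc c M - trunc c N) \<le> \<theta>\<^sup>2"
      using hnorm2_trunc_tail[of "\<theta>\<^sup>2"] \<theta> by auto
    show ?thesis
    proof (intro exI[of _ N0] allI impI)
      fix M N \<delta> assume "\<delta> \<in> depths \<kappa>" "N0 \<le> M" "N0 \<le> N"
      then have "\<bar>lenergy \<delta> (trunc c M) k - lenergy \<delta> (trunc c N) k\<bar> \<le> C * \<theta>"
        using \<theta> by (intro C(2) lt0 hnorm2_trunc N0) auto
      then show "\<bar>lenergy \<delta> (trunc c M) k - lenergy \<delta> (trunc c N) k\<bar> \<le> r" using \<theta>(3) by linarith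
    qed
  qed
  define L where "L = (\<lambda>\<delta>. lim (\<lambda>N. lenergy \<delta> (trunc c N) k))"
  have L: "(\<lambda>N. lenergy \<delta> (trunc c N) k) \<longlonglongrightarrow> L \<delta>" if \<delta>: "\<delta> \<in> depths \<kappa>" for \<delta>
  proof -
    have "Cauchy (\<lambda>N. lenergy \<delta> (trunc c N) k)"
      unfolding Cauchy_def
    proof (intro allI impI)
      fix r :: real assume "0 < r"
      then have "0 < r / 2" by simp
      from cauchy[OF this] obtain N0 where N0: "\<And>M N. N0 \<le> M \<Longrightarrow> N0 \<le> N \<Longrightarrow> \<bar>lenergy \<delta> (trunc c M) k - lenergy \<delta> (trunc c N) k\<bar> \<le> r / 2"
        using \<delta> by blast
      show "\<exists>N0. \<forall>M\<ge>N0. \<forall>N\<ge>N0. dist (lenergy \<delta> (trunc c M) k) (lenergy \<delta> (trunc c N) k) < r"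
        by (intro exI[of _ N0] allI impI, rule le_less_trans[of _ "r / 2"]) (use N0 \<open>0 < r\<close> in \<open>auto simp: dist_real_def\<close>)
    qed
    then show ?thesis unfolding L_def by (simp add: Cauchy_convergent_iff convergent_LIMSEQ_iff)
  qed
  from cauchy[OF e] obtain N0 where N0: "\<And>M N \<delta>. \<delta> \<in> depths \<kappa> \<Longrightarrow> N0 \<le> M \<Longrightarrow> N0 \<le> N \<Longrightarrow> \<bar>lenergy \<delta> (trunc c M) k - lenergy \<delta> (trunc c N) k\<bar> \<le> e"
    by blast
  have "\<bar>lenergy \<delta> (trunc c N) k - L \<delta>\<bar> \<le> e" if \<delta>: "\<delta> \<in> depths \<kappa>" and N: "N0 \<le> N" for \<delta> N
  proof (rule tendsto_upperbound)
    show "(\<lambda>M. \<bar>lenergy \<delta> (trunc c N) k - lenergy \<delta> (trunc c M) k\<bar>) \<longlonglongrightarrow> \<bar>lenergy \<delta> (trunc c N) k - L \<delta>\<bar>"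
      by (intro tendsto_intros L \<delta>)
    show "\<forall>\<^sub>F M in sequentially. \<bar>lenergy \<delta> (trunc c N) k - lenergy \<delta> (trunc c M) k\<bar> \<le> e"
      by (rule eventually_sequentiallyI[of N0]) (use N0 \<delta> N in auto)
  qed simp
  then show ?thesis using that L by blast
qed

end

lemma sobolev_coeffs_fc: "u \<in> sobolev_mean_zero (real k / 2) \<Longrightarrow> sobolev_coeffs k (fc u)"
  by unfold_locales (auto simp: sobolev_mean_zero_def fc_zero_mode sobolev_terms_eq[abs_def])

section \<open>Smooth approximants and the continuous extension\<close>

lemma leval_smooth: "(deriv ^^ j) (\<lambda>x. Re (leval p x)) = (\<lambda>x. Re (leval ((ddx ^^ j) p) x))"
proof (induction j)
  case (Suc j)
  have "deriv (\<lambda>x. Re (leval q x)) = (\<lambda>x. Re (leval (ddx q) x))" for q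
    by (rule ext, rule DERIV_imp_deriv)
      (use bounded_linear.has_vector_derivative[OF bounded_linear_Re leval_has_vector_derivative] in \<open>simp add: has_real_derivative_iff_has_vector_derivative\<close>)
  then show ?case using Suc by simp
qed simp

lemma Re_leval_smooth_mean_zero:
  assumes "lookup p 0 = 0"
  shows "(\<lambda>x. Re (leval p x)) \<in> smooth_mean_zero"
proof -
  have c: "continuous_on {0..2*pi} (\<lambda>x. Re (leval p x))"
    by (intro continuous_intros continuous_leval)
  have "integral\<^sup>L torus (leval p) / (2 * pi) = fourier_coeff (leval p) 0"
    by (simp add: fourier_coeff_def)
  then have "integral\<^sup>L torus (leval p) = 0" using assms by (simp add: fourier_coeff_leval)
  then have "integral\<^sup>L torus (\<lambda>x. Re (leval p x)) = 0"
    by (simp add: integral_Re torus_integral(1) continuous_leval)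
  moreover have "(deriv ^^ n) (\<lambda>x. Re (leval p x)) field_differentiable at x" for n x
    unfolding leval_smooth
    using bounded_linear.has_vector_derivative[OF bounded_linear_Re leval_has_vector_derivative[of "(ddx ^^ n) p" x]]
    by (auto simp: field_differentiable_def has_real_derivative_iff_has_vector_derivative)
  ultimately show ?thesis
    using torus_integral(1)[OF c] by (simp add: smooth_mean_zero_def periodic_mean_zero_def leval_periodic)
qed

text \<open>The cutoff is symmetric, so the truncated coefficients keep the Hermitian symmetry of
  those of a real function.\<close>

lemma leval_trunc_real: "complex_of_real (Re (leval (trunc (fc u) N) x)) = leval (trunc (fc u) N) x"
proof -
  let ?A = "{- int N..int N}"
  have A: "leval (trunc (fc u) N) x = (\<Sum>n\<in>?A. lookup (trunc (fc u) N) n * cis (of_int n * x))"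
    by (rule leval_eq[OF _ keys_trunc]) simp
  have "cnj (leval (trunc (fc u) N) x) = (\<Sum>n\<in>?A. lookup (trunc (fc u) N) (- n) * cis (of_int (- n) * x))"
    unfolding A by (auto simp: cis_cnj lookup_trunc fc_cnj intro!: sum.cong)
  also have "\<dots> = leval (trunc (fc u) N) x"
    unfolding A by (rule sum.reindex_bij_witness[of _ uminus uminus]) auto
  finally show ?thesis by (simp add: complex_eq_iff)
qed

text \<open>A value of \<open>Lim\<close> is determined only along a proper filter. Every
  neighbourhood meets the smooth functions because the Fourier truncations of u are smooth and
  converge to u in the Sobolev norm.\<close>

lemma smooth_approx_nontrivial:
  assumes u: "u \<in> sobolev_mean_zero (real k / 2)"
  shows "smooth_approx (real k / 2) u \<noteq> bot"
proof
  assume "smooth_approx (real k / 2) u = bot"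
  then have "eventually (\<lambda>v. False) (smooth_approx (real k / 2) u)" by simp
  then have "eventually (\<lambda>v. v \<notin> smooth_mean_zero) (filtercomap (\<lambda>v. sobolev_norm (real k / 2) (\<lambda>x. v x - u x)) (nhds 0))"
    by (simp add: smooth_approx_def eventually_inf_principal)
  then obtain Q where Q: "eventually Q (nhds 0)" "\<And>v. Q (sobolev_norm (real k / 2) (\<lambda>x. v x - u x)) \<Longrightarrow> v \<notin> smooth_mean_zero"
    by (auto simp: eventually_filtercomap)
  obtain e where e: "0 < e" "\<And>x. \<bar>x\<bar> < e \<Longrightarrow> Q x"
    using Q(1) by (auto simp: eventually_nhds_metric dist_real_def)
  interpret sobolev_coeffs k "fc u" by (rule sobolev_coeffs_fc[OF u])
  obtain N where N: "\<And>F. finite F \<Longrightarrow> (\<And>n. n \<in> F \<Longrightarrow> int N < \<bar>n\<bar>) \<Longrightarrow> (\<Sum>n\<in>F. wt k n * (cmod (fc u n))\<^sup>2) \<le> (e / 2)\<^sup>2"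
    using tail[of "(e / 2)\<^sup>2"] e by auto
  define v where "v = (\<lambda>x. Re (leval (trunc (fc u) N) x))"
  have v: "v \<in> smooth_mean_zero"
    unfolding v_def by (rule Re_leval_smooth_mean_zero) (simp add: lookup_trunc c0)
  have "fc v n = lookup (trunc (fc u) N) n" for n
    unfolding v_def leval_trunc_real by (rule fourier_coeff_leval)
  then have fcd: "fc (\<lambda>x. v x - u x) n = (if int N < \<bar>n\<bar> then - fc u n else 0)" for n
    using u v by (subst fc_diff) (auto simp: sobolev_mean_zero_def smooth_mean_zero_def periodic_mean_zero_def lookup_trunc)
  let ?T = "sobolev_terms (real k / 2) (\<lambda>x. v x - u x)"
  have T: "?T n = (if int N < \<bar>n\<bar> then wt k n * (cmod (fc u n))\<^sup>2 else 0)" for n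
    unfolding sobolev_terms_eq fcd by simp
  have bound: "(\<Sum>n\<in>F. ?T n) \<le> (e / 2)\<^sup>2" if "finite F" for F
  proof -
    have "(\<Sum>n\<in>F. ?T n) = (\<Sum>n\<in>{n\<in>F. int N < \<bar>n\<bar>}. wt k n * (cmod (fc u n))\<^sup>2)"
      unfolding T using that by (simp add: sum.inter_filter)
    also have "\<dots> \<le> (e / 2)\<^sup>2" using that by (intro N) auto
    finally show ?thesis .
  qed
  have "?T summable_on UNIV"
    by (intro nonneg_bdd_above_summable_on bdd_aboveI2[OF bound]) (auto simp: sobolev_terms_def)
  then have "infsum ?T UNIV \<le> (e / 2)\<^sup>2"
    by (rule infsum_le_finite_sums) (use bound in auto)
  then have "sobolev_norm (real k / 2) (\<lambda>x. v x - u x) \<le> e / 2"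
    unfolding sobolev_norm_def using e by (intro real_le_lsqrt) auto
  moreover have "0 \<le> sobolev_norm (real k / 2) (\<lambda>x. v x - u x)"
    unfolding sobolev_norm_def by (intro real_sqrt_ge_zero infsum_nonneg) (simp add: sobolev_terms_def)
  ultimately show False using Q(2) e v by force
qed

text \<open>Let L be the limit along the truncations of u. For a smooth v near u, truncations of u
  and v at the same N are compared by the Lipschitz bound; letting N grow puts the energy of v near
  L. Hence the limit defining the extension exists and equals L.\<close>

theorem energy_eq_limit:
  assumes u: "u \<in> sobolev_mean_zero (real k / 2)" and \<delta>: "0 < \<delta>"
  shows "(\<lambda>N. lenergy \<delta> (trunc (fc u) N) k) \<longlonglongrightarrow> energy \<delta> k u"
proof -
  interpret sobolev_coeffs k "fc u" by (rule sobolev_coeffs_fc[OF u])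
  let ?\<kappa> = "inv_depth \<delta>"
  have d: "\<delta> \<in> depths ?\<kappa>" and \<kappa>: "0 \<le> ?\<kappa>" using \<delta> inv_depth_nonneg by (auto simp: depths_def)
  obtain L where L: "(\<lambda>N. lenergy \<delta> (trunc (fc u) N) k) \<longlonglongrightarrow> L"
    using lenergy_uniform_limit[OF \<kappa>, of 1] d by (metis zero_less_one)
  obtain C where C: "0 \<le> C" "\<And>p q \<theta>. lookup p 0 = 0 \<Longrightarrow> lookup q 0 = 0 \<Longrightarrow> hnorm2 k q \<le> total \<Longrightarrow>
     hnorm2 k (p - q) \<le> \<theta>\<^sup>2 \<Longrightarrow> 0 < \<theta> \<Longrightarrow> \<theta> \<le> 1 \<Longrightarrow> \<bar>lenergy \<delta> p k - lenergy \<delta> q k\<bar> \<le> C * \<theta>"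
    using lenergy_lipschitz[OF \<kappa> total_nonneg, of k] d by blast
  have near: "\<bar>smooth_energy \<delta> v k - L\<bar> \<le> C * \<theta>"
    if v: "v \<in> smooth_mean_zero" and vu: "sobolev_norm (real k / 2) (\<lambda>x. v x - u x) \<le> \<theta>" and \<theta>: "0 < \<theta>" "\<theta> \<le> 1" for v \<theta>
  proof (rule tendsto_upperbound)
    let ?T = "sobolev_terms (real k / 2) (\<lambda>x. v x - u x)"
    have fcd: "fc (\<lambda>x. v x - u x) n = fc v n - fc u n" for n
      using u v by (intro fc_diff) (auto simp: sobolev_mean_zero_def smooth_mean_zero_def periodic_mean_zero_def)
    \<comment> \<open>An infinite sum that does not converge is 0 by default, so without summability
      a small Sobolev norm would say nothing about v - u.\<close>
    have "?T summable_on UNIV"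
    proof (rule summable_on_comparison_test)
      show "(\<lambda>n. 2 * sobolev_terms (real k / 2) v n + 2 * sobolev_terms (real k / 2) u n) summable_on UNIV"
        using summable_sobolev_smooth[OF v, of k] u by (intro summable_on_add summable_on_cmult_right) (auto simp: sobolev_mean_zero_def)
      fix n
      have "cmod (fc v n - fc u n) \<le> cmod (fc v n) + cmod (fc u n)" by (rule norm_triangle_ineq4)
      then have "(cmod (fc v n - fc u n))\<^sup>2 \<le> (cmod (fc v n) + cmod (fc u n))\<^sup>2" by (intro power_mono) auto
      also have "\<dots> \<le> 2 * (cmod (fc v n))\<^sup>2 + 2 * (cmod (fc u n))\<^sup>2"
        using sum_squares_bound[of "cmod (fc v n)" "cmod (fc u n)"] by (simp add: power2_sum)
      finally show "?T n \<le> 2 * sobolev_terms (real k / 2) v n + 2 * sobolev_terms (real k / 2) u n"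
        unfolding sobolev_terms_eq fcd using mult_left_mono[OF _ wt_nonneg[of k n]] by (fastforce simp: algebra_simps)
    qed (simp_all add: sobolev_terms_def)
    then have fin: "(\<Sum>n\<in>F. ?T n) \<le> infsum ?T UNIV" if "finite F" for F
      by (rule finite_sum_le_infsum) (use that in \<open>auto simp: sobolev_terms_def\<close>)
    have "0 \<le> infsum ?T UNIV" using fin[of "{}"] by simp
    then have inf: "infsum ?T UNIV \<le> \<theta>\<^sup>2"
      using vu \<theta> unfolding sobolev_norm_def by (metis less_eq_real_def real_sqrt_le_iff real_sqrt_unique)
    have "hnorm2 k (trunc (fc v) N - trunc (fc u) N) \<le> \<theta>\<^sup>2" for N
    proof -
      have "hnorm2 k (trunc (fc v) N - trunc (fc u) N) \<le> (\<Sum>n\<in>keys (trunc (fc v) N - trunc (fc u) N). ?T n)"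
        unfolding hnorm2_def sobolev_terms_eq fcd
        by (intro sum_mono mult_left_mono) (auto simp: lookup_minus lookup_trunc wt_nonneg)
      also have "\<dots> \<le> \<theta>\<^sup>2" using fin inf by (meson finite_keys order_trans)
      finally show ?thesis .
    qed
    then have "\<bar>lenergy \<delta> (trunc (fc v) N) k - lenergy \<delta> (trunc (fc u) N) k\<bar> \<le> C * \<theta>" for N
      using v \<theta> by (intro C(2) hnorm2_trunc) (auto simp: lookup_trunc c0 smooth_mean_zero_def fc_zero_mode)
    then show "\<forall>\<^sub>F N in sequentially. \<bar>lenergy \<delta> (trunc (fc v) N) k - lenergy \<delta> (trunc (fc u) N) k\<bar> \<le> C * \<theta>"
      by simp
    show "(\<lambda>N. \<bar>lenergy \<delta> (trunc (fc v) N) k - lenergy \<delta> (trunc (fc u) N) k\<bar>) \<longlonglongrightarrow> \<bar>smooth_energy \<delta> v k - L\<bar>"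
      by (intro tendsto_intros L smooth_energy_limit[OF \<delta> smooth_approx_trunc[OF v]])
  qed simp
  have "((\<lambda>v. smooth_energy \<delta> v k) \<longlongrightarrow> L) (smooth_approx (real k / 2) u)"
  proof (rule tendstoI)
    fix e :: real assume e: "0 < e"
    define \<theta> where "\<theta> = min 1 (e / (2 * (C + 1)))"
    have \<theta>: "0 < \<theta>" "\<theta> \<le> 1" "C * \<theta> < e"
    proof -
      show "0 < \<theta>" "\<theta> \<le> 1" using e C(1) by (auto simp: \<theta>_def)
      have "C * \<theta> \<le> (C + 1) * (e / (2 * (C + 1)))"
        using C(1) e \<open>0 < \<theta>\<close> by (intro mult_mono) (auto simp: \<theta>_def)
      also have "\<dots> = e / 2" using C(1) by (simp add: divide_simps)
      finally show "C * \<theta> < e" using e by simp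
    qed
    have "\<forall>\<^sub>F x in nhds 0. x \<le> \<theta>"
      using \<theta>(1) by (auto simp: eventually_nhds_metric dist_real_def intro!: exI[of _ \<theta>])
    then show "\<forall>\<^sub>F v in smooth_approx (real k / 2) u. dist (smooth_energy \<delta> v k) L < e"
      unfolding smooth_approx_def eventually_inf_principal eventually_filtercomap
      using near[OF _ _ \<theta>(1,2)] \<theta>(3) by (intro exI[of _ "\<lambda>x. x \<le> \<theta>"]) (fastforce simp: dist_real_def)
  qed
  then have "energy \<delta> k u = L"
    unfolding energy_def using smooth_approx_nontrivial[OF u] by (intro tendsto_Lim) auto
  then show ?thesis using L by simp
qed

text \<open>With \<kappa> = 1 all depths from 1 to \<infinity> share one truncation level N. There
  the energy of a single Laurent polynomial converges in the depth, and three errors below e / 4 add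
  up.\<close>

theorem energy_depth_limit:
  assumes u: "u \<in> sobolev_mean_zero (real k / 2)"
  shows "((\<lambda>\<delta>::real. energy (ereal \<delta>) k u) \<longlongrightarrow> energy \<infinity> k u) at_top"
proof (rule tendstoI)
  fix e :: real assume e: "0 < e"
  interpret sobolev_coeffs k "fc u" by (rule sobolev_coeffs_fc[OF u])
  obtain N L where L: "\<And>\<delta>. \<delta> \<in> depths 1 \<Longrightarrow> (\<lambda>N. lenergy \<delta> (trunc (fc u) N) k) \<longlonglongrightarrow> L \<delta>"
    and N: "\<And>\<delta>. \<delta> \<in> depths 1 \<Longrightarrow> \<bar>lenergy \<delta> (trunc (fc u) N) k - L \<delta>\<bar> \<le> e / 4"
    using lenergy_uniform_limit[of 1 "e / 4"] e by (metis order_refl zero_le_one divide_pos_pos zero_less_numeral)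
  have E: "\<bar>lenergy \<delta> (trunc (fc u) N) k - energy \<delta> k u\<bar> \<le> e / 4" if "\<delta> \<in> depths 1" for \<delta>
    using LIMSEQ_unique[OF L[OF that] energy_eq_limit[OF u]] N[OF that] that by (auto simp: depths_def)
  have "\<forall>\<^sub>F d in at_top. dist (lenergy (ereal d) (trunc (fc u) N) k) (lenergy \<infinity> (trunc (fc u) N) k) < e / 4"
    using lenergy_depth_limit e by (intro tendstoD) auto
  then show "\<forall>\<^sub>F d in at_top. dist (energy (ereal d) k u) (energy \<infinity> k u) < e"
    using eventually_ge_at_top[of 1]
  proof eventually_elim
    case (elim d)
    have "ereal d \<in> depths 1" "\<infinity> \<in> depths 1"
      using elim(2) by (auto simp: depths_def inv_depth_def inverse_eq_divide)
    from E[OF this(1)] E[OF this(2)] elim(1) e show ?case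
      unfolding dist_real_def by linarith
  qed
qed

subsection \<open>Conservation\<close>

text \<open>At a fixed depth an energy is a fixed linear combination of real parts of zero modes, so
  two curves whose zero modes have equal derivatives also have equal energy derivatives. The base
  points t and t' differ because one curve will be the solution and the other a straight line
  started at 0.\<close>

lemma lenergy_derivative:
  assumes "\<And>n. \<exists>y. ((\<lambda>s. lookup (chiL (lsym \<delta>) (p s) n) 0) has_vector_derivative y) (at t) \<and>
     ((\<lambda>s. lookup (chiL (lsym \<delta>) (q s) n) 0) has_vector_derivative y) (at t')"
  shows "\<exists>Y. ((\<lambda>s. lenergy \<delta> (p s) k) has_real_derivative Y) (at t) \<and> ((\<lambda>s. lenergy \<delta> (q s) k) has_real_derivative Y) (at t')"
proof (induction k rule: less_induct)
  case (less k)
  have "\<forall>j\<in>{..<k}. \<exists>Y. ((\<lambda>s. lenergy \<delta> (p s) j) has_real_derivative Y) (at t) \<and> ((\<lambda>s. lenergy \<delta> (q s) j) has_real_derivative Y) (at t')"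
    using less by auto
  from bchoice[OF this] obtain Y where
    "\<forall>j\<in>{..<k}. ((\<lambda>s. lenergy \<delta> (p s) j) has_real_derivative Y j) (at t) \<and> ((\<lambda>s. lenergy \<delta> (q s) j) has_real_derivative Y j) (at t')" ..
  then have Y: "((\<lambda>s. lenergy \<delta> (p s) j) has_real_derivative Y j) (at t)" "((\<lambda>s. lenergy \<delta> (q s) j) has_real_derivative Y j) (at t')" if "j \<in> {..<k}" for j
    using that by auto
  obtain y where y: "((\<lambda>s. lookup (chiL (lsym \<delta>) (p s) (k + 2)) 0) has_vector_derivative y) (at t)"
    "((\<lambda>s. lookup (chiL (lsym \<delta>) (q s) (k + 2)) 0) has_vector_derivative y) (at t')"
    using assms by blast
  have Re: "((\<lambda>s. Re (2 * pi * f s)) has_real_derivative Re (2 * pi * y)) (at r)" if "(f has_vector_derivative y) (at r)" for f :: "real \<Rightarrow> complex" and r :: real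
    using bounded_linear.has_vector_derivative[OF bounded_linear_Re has_vector_derivative_mult_right[OF that, of "2 * pi"]]
    by (simp only: has_real_derivative_iff_has_vector_derivative)
  show ?case
    unfolding lenergy.simps[of _ _ k]
    by (rule exI, rule conjI) (rule DERIV_cmult DERIV_diff DERIV_sum Re y Y; assumption?)+
qed

lemma hnorm2_le_wnorm: "hnorm2 k p \<le> (wnorm k p)\<^sup>2"
proof -
  have "hnorm2 k p \<le> (\<Sum>n\<in>keys p. (jb n ^ k * cmod (lookup p n))\<^sup>2)"
    unfolding hnorm2_def
  proof (rule sum_mono)
    fix n
    let ?w = "jb n"
    have "1 \<le> ?w ^ k" by (rule one_le_power) simp
    then have "?w ^ k \<le> (?w ^ k)\<^sup>2" by (rule self_le_power) simp
    then have "wt k n \<le> (?w ^ k)\<^sup>2" using wt_le_abs_power[of k n] by linarith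
    then show "wt k n * (cmod (lookup p n))\<^sup>2 \<le> (?w ^ k * cmod (lookup p n))\<^sup>2"
      by (simp add: power_mult_distrib mult_right_mono)
  qed
  also have "\<dots> \<le> (\<Sum>n\<in>keys p. jb n ^ k * cmod (lookup p n))\<^sup>2"
  proof -
    have "(\<Sum>n\<in>A. (f n)\<^sup>2) \<le> (\<Sum>n\<in>A. f n)\<^sup>2" if "\<And>n. 0 \<le> f n" for A :: "int set" and f :: "int \<Rightarrow> real"
    proof (induction A rule: infinite_finite_induct)
      case (insert a A)
      have "0 \<le> 2 * f a * sum f A" using that by (intro mult_nonneg_nonneg sum_nonneg) auto
      then show ?case using insert by (simp add: power2_sum)
    qed auto
    then show ?thesis by simp
  qed
  finally show ?thesis by (simp add: wnorm_def)
qed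

lemma hnorm2_cst: "hnorm2 k (cst c * p) = (cmod c)\<^sup>2 * hnorm2 k p"
proof -
  have "keys (cst c * p) \<subseteq> keys p" by (auto simp: in_keys_iff)
  then show ?thesis
    by (simp add: hnorm2_eq[of "keys p"] hnorm2_def[of k p] norm_mult power_mult_distrib sum_distrib_left mult_ac)
qed

text \<open>The rate equals the derivative along the line in direction e. Moving by s along it
  changes the polynomial by at most |s| \<eta> in norm, so the Lipschitz bound limits every
  difference quotient by C \<eta>.\<close>

lemma lenergy_rate_bound:
  assumes \<delta>: "0 < \<delta>" and B: "0 \<le> B"
  obtains C where "0 \<le> C" "\<And>p t e \<eta>. lder p (ilw_rhs (\<lambda>n. of_real (gsym \<delta> n)) (p t) + e) t \<Longrightarrow>
     lookup (p t) 0 = 0 \<Longrightarrow> lookup e 0 = 0 \<Longrightarrow> hnorm2 k (p t) \<le> B \<Longrightarrow> hnorm2 k e \<le> \<eta>\<^sup>2 \<Longrightarrow> 0 < \<eta> \<Longrightarrow>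
     \<exists>Y. ((\<lambda>s. lenergy \<delta> (p s) k) has_real_derivative Y) (at t) \<and> \<bar>Y\<bar> \<le> C * \<eta>"
proof -
  have d: "\<delta> \<in> depths (inv_depth \<delta>)" and \<kappa>: "0 \<le> inv_depth \<delta>" using \<delta> inv_depth_nonneg by (auto simp: depths_def)
  obtain C where C: "0 \<le> C" "\<And>p q \<theta>. lookup p 0 = 0 \<Longrightarrow> lookup q 0 = 0 \<Longrightarrow> hnorm2 k q \<le> B \<Longrightarrow>
     hnorm2 k (p - q) \<le> \<theta>\<^sup>2 \<Longrightarrow> 0 < \<theta> \<Longrightarrow> \<theta> \<le> 1 \<Longrightarrow> \<bar>lenergy \<delta> p k - lenergy \<delta> q k\<bar> \<le> C * \<theta>"
    using lenergy_lipschitz[OF \<kappa> B, of k] d by blast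
  have "\<exists>Y. ((\<lambda>s. lenergy \<delta> (p s) k) has_real_derivative Y) (at t) \<and> \<bar>Y\<bar> \<le> C * \<eta>"
    if p: "lder p (ilw_rhs (\<lambda>n. of_real (gsym \<delta> n)) (p t) + e) t"
      and z: "lookup (p t) 0 = 0" "lookup e 0 = 0" and b: "hnorm2 k (p t) \<le> B" "hnorm2 k e \<le> \<eta>\<^sup>2" and \<eta>: "0 < \<eta>" for p t e \<eta>
  proof -
    let ?q = "\<lambda>s. p t + cst (complex_of_real s) * e"
    have "\<exists>Y. ((\<lambda>s. lenergy \<delta> (p s) k) has_real_derivative Y) (at t) \<and> ((\<lambda>s. lenergy \<delta> (?q s) k) has_real_derivative Y) (at 0)"
    proof (rule lenergy_derivative)
      fix n
      obtain y where "((\<lambda>s. lookup (chiL (lsym \<delta>) (p s) n) 0) has_vector_derivative y) (at t)"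
        "((\<lambda>s. lookup (chiL (lsym \<delta>) (?q s) n) 0) has_vector_derivative y) (at 0)"
        using chiL_zero_mode_derivative[OF lsym_addition[OF \<delta>] lsym_def _ p] gsym_odd by (metis of_real_minus)
      then show "\<exists>y. ((\<lambda>s. lookup (chiL (lsym \<delta>) (p s) n) 0) has_vector_derivative y) (at t) \<and>
        ((\<lambda>s. lookup (chiL (lsym \<delta>) (?q s) n) 0) has_vector_derivative y) (at 0)" by blast
    qed
    then obtain Y where Y: "((\<lambda>s. lenergy \<delta> (p s) k) has_real_derivative Y) (at t)" "((\<lambda>s. lenergy \<delta> (?q s) k) has_real_derivative Y) (at 0)"
      by blast
    have "((\<lambda>s. \<bar>(lenergy \<delta> (?q s) k - lenergy \<delta> (?q 0) k) / (s - 0)\<bar>) \<longlongrightarrow> \<bar>Y\<bar>) (at 0)"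
      using Y(2) unfolding has_field_derivative_iff by (intro tendsto_intros) simp
    then have "\<bar>Y\<bar> \<le> C * \<eta>"
    proof (rule tendsto_upperbound)
      \<comment> \<open>The Lipschitz bound is used with \<theta> = |s| \<eta>, which must be
        positive and at most 1.\<close>
      have "\<forall>\<^sub>F s in at (0::real). \<bar>s\<bar> * \<eta> < 1 \<and> s \<noteq> 0"
        unfolding eventually_at using \<eta> by (intro exI[of _ "1 / \<eta>"]) (auto simp: dist_real_def field_simps)
      then show "\<forall>\<^sub>F s in at 0. \<bar>(lenergy \<delta> (?q s) k - lenergy \<delta> (?q 0) k) / (s - 0)\<bar> \<le> C * \<eta>"
      proof (rule eventually_mono)
        fix s :: real assume s: "\<bar>s\<bar> * \<eta> < 1 \<and> s \<noteq> 0"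
        have "\<bar>lenergy \<delta> (?q s) k - lenergy \<delta> (p t) k\<bar> \<le> C * (\<bar>s\<bar> * \<eta>)"
        proof (rule C(2))
          have "hnorm2 k (?q s - p t) = s\<^sup>2 * hnorm2 k e" by (simp add: hnorm2_cst)
          also have "\<dots> \<le> s\<^sup>2 * \<eta>\<^sup>2" using b(2) by (intro mult_left_mono) auto
          finally show "hnorm2 k (?q s - p t) \<le> (\<bar>s\<bar> * \<eta>)\<^sup>2" by (simp add: power_mult_distrib)
        qed (use s z b \<eta> in \<open>auto simp: lookup_add\<close>)
        then have "\<bar>lenergy \<delta> (?q s) k - lenergy \<delta> (p t) k\<bar> / \<bar>s\<bar> \<le> C * \<eta>"
          using s by (simp add: pos_divide_le_eq mult_ac)
        then show "\<bar>(lenergy \<delta> (?q s) k - lenergy \<delta> (?q 0) k) / (s - 0)\<bar> \<le> C * \<eta>"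
          by simp
      qed
    qed simp
    then show ?thesis using Y(1) by blast
  qed
  then show ?thesis using that C(1) by blast
qed

lemma ilw_rhs_eq: "ilw_rhs (\<lambda>n. of_real (gsym \<delta> n)) p = mult_op (G_symbol \<delta>) (ddx (ddx p)) + ddx (p * p)"
proof -
  have "G_symbol \<delta> = (\<lambda>n. - \<i> * of_real (gsym \<delta> n))" by (simp add: G_symbol_eq fun_eq_iff)
  moreover have "2 * p * ddx p = ddx (p * p)"
    unfolding ddx_times by (simp add: algebra_simps)
  ultimately show ?thesis by (simp add: ilw_rhs_def)
qed

lemma ilw_rhs_lookup_0: "lookup (ilw_rhs (\<lambda>n. of_real (gsym \<delta> n)) p) 0 = 0"
  by (simp add: ilw_rhs_eq lookup_add)

text \<open>Three orders are lost: two derivatives and G, counted as order one. The quadratic part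
  is handled by p^2 - q^2 = (p - q) (p + q).\<close>

lemma wnorm_ilw_rhs_diff:
  assumes \<delta>: "0 < \<delta>"
  shows "wnorm s (ilw_rhs (\<lambda>n. of_real (gsym \<delta> n)) p - ilw_rhs (\<lambda>n. of_real (gsym \<delta> n)) q)
     \<le> (1 + 2 * inv_depth \<delta> + wnorm (s + 3) p + wnorm (s + 3) q) * wnorm (s + 3) (p - q)"
proof -
  let ?K = "1 + 2 * inv_depth \<delta>"
  have K: "0 \<le> ?K" using inv_depth_nonneg[OF \<delta>] by simp
  have "ilw_rhs (\<lambda>n. of_real (gsym \<delta> n)) p - ilw_rhs (\<lambda>n. of_real (gsym \<delta> n)) q =
     mult_op (G_symbol \<delta>) (ddx (ddx (p - q))) + ddx ((p - q) * (p + q))"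
    unfolding ilw_rhs_eq by (simp add: mult_op_diff mult_op_add algebra_simps)
  then have "wnorm s (ilw_rhs (\<lambda>n. of_real (gsym \<delta> n)) p - ilw_rhs (\<lambda>n. of_real (gsym \<delta> n)) q)
     \<le> wnorm s (mult_op (G_symbol \<delta>) (ddx (ddx (p - q)))) + wnorm s (ddx ((p - q) * (p + q)))"
    by (simp only: wnorm_add)
  also have "\<dots> \<le> ?K * wnorm (s + 3) (p - q) + wnorm (s + 3) (p - q) * (wnorm (s + 3) p + wnorm (s + 3) q)"
  proof (rule add_mono)
    have "wnorm s (mult_op (G_symbol \<delta>) (ddx (ddx (p - q)))) \<le> ?K * wnorm (Suc s) (ddx (ddx (p - q)))"
      by (rule wnorm_mult_op[OF G_symbol_in_symbols[OF \<delta>]])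
    also have "\<dots> \<le> ?K * wnorm (s + 3) (p - q)"
      using wnorm_mult_op[OF symbols_ddx, of "Suc s" "ddx (p - q)"] wnorm_mult_op[OF symbols_ddx, of "Suc (Suc s)" "p - q"] K
      by (intro mult_left_mono) (auto simp: numeral_3_eq_3)
    finally show "wnorm s (mult_op (G_symbol \<delta>) (ddx (ddx (p - q)))) \<le> ?K * wnorm (s + 3) (p - q)" .
    have "wnorm s (ddx ((p - q) * (p + q))) \<le> wnorm (s + 3) ((p - q) * (p + q))"
      using wnorm_mult_op[OF symbols_ddx, of s "(p - q) * (p + q)"] wnorm_mono[of "Suc s" "s + 3" "(p - q) * (p + q)"] by simp
    also have "\<dots> \<le> wnorm (s + 3) (p - q) * wnorm (s + 3) (p + q)" by (rule wnorm_times)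
    also have "\<dots> \<le> wnorm (s + 3) (p - q) * (wnorm (s + 3) p + wnorm (s + 3) q)"
      by (intro mult_left_mono wnorm_add wnorm_nonneg)
    finally show "wnorm s (ddx ((p - q) * (p + q))) \<le> wnorm (s + 3) (p - q) * (wnorm (s + 3) p + wnorm (s + 3) q)" .
  qed
  finally show ?thesis by (simp add: algebra_simps)
qed

section \<open>Regularity of a solution in space and time\<close>

lemma C_class_derivatives:
  "C_class m u \<Longrightarrow> \<exists>D. D 0 = u \<and> (\<forall>j<m. \<forall>t x. (D j t has_real_derivative D (Suc j) t x) (at x)) \<and>
     (\<forall>j\<le>m. continuous_on UNIV (\<lambda>(t, x). D j t x))"
proof (induction m arbitrary: u)
  case 0
  then show ?case by (intro exI[of _ "\<lambda>_. u"]) simp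
next
  case (Suc m)
  then obtain ux where ux: "\<And>t x. (u t has_real_derivative ux t x) (at x)" "C_class m ux" and c: "continuous_on UNIV (\<lambda>(t, x). u t x)"
    by auto
  from Suc.IH[OF ux(2)] obtain D where D: "D 0 = ux" "\<And>j t x. j < m \<Longrightarrow> (D j t has_real_derivative D (Suc j) t x) (at x)"
    "\<And>j. j \<le> m \<Longrightarrow> continuous_on UNIV (\<lambda>(t, x). D j t x)" by blast
  show ?case
  proof (intro exI[of _ "\<lambda>j. case j of 0 \<Rightarrow> u | Suc i \<Rightarrow> D i"] conjI allI impI)
    fix j t x assume "j < Suc m"
    then show "((case j of 0 \<Rightarrow> u | Suc i \<Rightarrow> D i) t has_real_derivative (case Suc j of 0 \<Rightarrow> u | Suc i \<Rightarrow> D i) t x) (at x)"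
      using ux(1) D(1,2) by (cases j) auto
  next
    fix j assume "j \<le> Suc m"
    then show "continuous_on UNIV (\<lambda>(t, x). (case j of 0 \<Rightarrow> u | Suc i \<Rightarrow> D i) t x)"
      using c D(3) by (cases j) auto
  qed simp
qed

lemma continuous_slice:
  fixes f :: "real \<Rightarrow> real \<Rightarrow> 'a::topological_space"
  assumes "continuous_on UNIV (\<lambda>(t, x). f t x)"
  shows "continuous_on S (f t)"
proof -
  have "continuous_on S (\<lambda>x. (t, x))" by (intro continuous_intros)
  from continuous_on_compose2[OF assms this] show ?thesis by simp
qed

lemma C_class_continuous: "C_class m u \<Longrightarrow> continuous_on UNIV (\<lambda>(t, x). u t x)"
  by (cases m) auto

lemma bounded_slab:
  fixes f :: "real \<Rightarrow> real \<Rightarrow> real"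
  assumes "continuous_on UNIV (\<lambda>(t, x). f t x)"
  shows "\<exists>B. \<forall>t\<in>{- T..T}. \<forall>x\<in>{0..2*pi}. \<bar>f t x\<bar> \<le> B"
proof -
  have "compact ((\<lambda>(t, x). f t x) ` ({- T..T} \<times> {0..2*pi}))"
    by (intro compact_continuous_image compact_Times continuous_on_subset[OF assms]) auto
  then have "bounded ((\<lambda>(t, x). f t x) ` ({- T..T} \<times> {0..2*pi}))" by (rule compact_imp_bounded)
  then obtain B where "\<forall>y\<in>(\<lambda>(t, x). f t x) ` ({- T..T} \<times> {0..2*pi}). norm y \<le> B"
    unfolding bounded_iff by blast
  then show ?thesis by (intro exI[of _ B]) auto
qed

lemma fc_time_derivative:
  assumes d: "\<And>t x. ((\<lambda>s. u s x) has_real_derivative ut t x) (at t)"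
    and cu: "continuous_on UNIV (\<lambda>(t, x). u t x)" and cut: "continuous_on UNIV (\<lambda>(t, x). ut t x)"
  shows "((\<lambda>s. fc (u s) n) has_vector_derivative fc (ut t) n) (at t)"
proof -
  let ?f = "\<lambda>t x. complex_of_real (u t x) * cis (- (of_int n * x))"
  let ?f' = "\<lambda>t x. complex_of_real (ut t x) * cis (- (of_int n * x))"
  have cf: "continuous_on {0..2*pi} (?f t)" "continuous_on {0..2*pi} (?f' t)" for t
    by (intro continuous_intros continuous_slice[OF cu] continuous_slice[OF cut])+
  have "((\<lambda>t. integral (cbox 0 (2*pi)) (?f t)) has_vector_derivative integral (cbox 0 (2*pi)) (?f' t)) (at t within UNIV)"
  proof (rule leibniz_rule_vector_derivative)
    fix s x
    have "((\<lambda>s. complex_of_real (u s x)) has_vector_derivative complex_of_real (ut s x)) (at s)"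
      by (rule has_vector_derivative_of_real[OF d])
    from has_vector_derivative_mult_left[OF this]
    show "((\<lambda>s. ?f s x) has_vector_derivative ?f' s x) (at s within UNIV)" .
    show "?f s integrable_on cbox 0 (2*pi)"
      using cf(1)[of s] by (intro integrable_continuous) simp
  next
    have "continuous_on (UNIV \<times> cbox 0 (2*pi)) (\<lambda>z. complex_of_real ((\<lambda>(t, x). ut t x) z) * cis (- (of_int n * snd z)))"
      by (intro continuous_intros continuous_on_subset[OF cut]) auto
    then show "continuous_on (UNIV \<times> cbox 0 (2*pi)) (\<lambda>(t, x). ?f' t x)"
      by (simp add: case_prod_unfold)
  qed auto
  from has_vector_derivative_divide[OF this, of "2 * pi"]
  show ?thesis
    unfolding fourier_coeff_def torus_integral(2)[OF cf(1)] torus_integral(2)[OF cf(2)] by simp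
qed

lemma trunc_0: "c 0 = 0 \<Longrightarrow> trunc c 0 = 0"
  by (rule poly_mapping_eqI) (auto simp: lookup_trunc)

lemma lder_trunc:
  assumes "\<And>n. ((\<lambda>s. c s n) has_vector_derivative w n) (at t)"
  shows "lder (\<lambda>s. trunc (c s) N) (trunc w N) t"
  unfolding lder_def
proof (intro conjI allI)
  show "\<exists>A. finite A \<and> (\<forall>s. keys (trunc (c s) N) \<subseteq> A)"
    using keys_trunc by (intro exI[of _ "{- int N..int N}"]) auto
  show "((\<lambda>s. lookup (trunc (c s) N) n) has_vector_derivative lookup (trunc w N) n) (at t)" for n
    using assms by (simp add: lookup_trunc)
qed

text \<open>In the application r M is the right-hand side of ILW at the truncation of level M, and w
  its limit. Frequencies up to N see only the difference of w and r N. Beyond N the truncated w is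
  zero while r N need not be, and the tail of w is added; the additional order in
  \<open>size\<close> turns this tail into 1/N.\<close>

lemma truncation_defect:
  fixes g :: "int \<Rightarrow> complex"
  assumes lim: "\<And>n. (\<lambda>M. lookup (r M) n) \<longlonglongrightarrow> w n"
    and close: "\<And>M. N \<le> M \<Longrightarrow> wnorm s (r M - r N) \<le> \<eta>"
    and size: "\<And>M. wnorm (Suc s) (r M) \<le> A"
  shows "wnorm s (trunc w N - r N) \<le> \<eta> + A / (1 + real N)"
proof -
  let ?h = "\<lambda>n. jb n"
  define F where "F = keys (trunc w N - r N) \<union> keys (r N)"
  have F: "finite F" by (simp add: F_def)
  have sum_le: "(\<Sum>n\<in>F. ?h n ^ j * cmod (lookup p n)) \<le> wnorm j p" for j p
  proof -
    have "(\<Sum>n\<in>F. ?h n ^ j * cmod (lookup p n)) \<le> (\<Sum>n\<in>F \<union> keys p. ?h n ^ j * cmod (lookup p n))"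
      using F by (intro sum_mono2) auto
    also have "\<dots> = wnorm j p" using F by (subst wnorm_eq[of "F \<union> keys p"]) auto
    finally show ?thesis .
  qed
  have 1: "(\<Sum>n\<in>F. ?h n ^ s * cmod (w n - lookup (r N) n)) \<le> \<eta>"
  proof (rule tendsto_upperbound)
    show "(\<lambda>M. \<Sum>n\<in>F. ?h n ^ s * cmod (lookup (r M) n - lookup (r N) n)) \<longlonglongrightarrow> (\<Sum>n\<in>F. ?h n ^ s * cmod (w n - lookup (r N) n))"
      by (intro tendsto_intros lim)
    show "\<forall>\<^sub>F M in sequentially. (\<Sum>n\<in>F. ?h n ^ s * cmod (lookup (r M) n - lookup (r N) n)) \<le> \<eta>"
    proof (rule eventually_sequentiallyI)
      fix M assume "N \<le> M"
      then show "(\<Sum>n\<in>F. ?h n ^ s * cmod (lookup (r M) n - lookup (r N) n)) \<le> \<eta>"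
        using order.trans[OF sum_le[of s "r M - r N"] close] by (simp add: lookup_minus)
    qed
  qed simp
  have 2: "(\<Sum>n\<in>F. ?h n ^ Suc s * cmod (w n)) \<le> A"
  proof (rule tendsto_upperbound)
    show "(\<lambda>M. \<Sum>n\<in>F. ?h n ^ Suc s * cmod (lookup (r M) n)) \<longlonglongrightarrow> (\<Sum>n\<in>F. ?h n ^ Suc s * cmod (w n))"
      by (intro tendsto_intros lim)
    show "\<forall>\<^sub>F M in sequentially. (\<Sum>n\<in>F. ?h n ^ Suc s * cmod (lookup (r M) n)) \<le> A"
      by (intro always_eventually allI order.trans[OF sum_le size])
  qed simp
  have "wnorm s (trunc w N - r N) = (\<Sum>n\<in>F. ?h n ^ s * cmod (lookup (trunc w N - r N) n))"
    using F by (intro wnorm_eq) (auto simp: F_def)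
  also have "\<dots> \<le> (\<Sum>n\<in>F. ?h n ^ s * cmod (w n - lookup (r N) n) + 1 / (1 + real N) * (?h n ^ Suc s * cmod (w n)))"
  proof (rule sum_mono)
    fix n
    show "?h n ^ s * cmod (lookup (trunc w N - r N) n) \<le> ?h n ^ s * cmod (w n - lookup (r N) n) + 1 / (1 + real N) * (?h n ^ Suc s * cmod (w n))"
    proof (cases "\<bar>n\<bar> \<le> int N")
      case True
      then show ?thesis by (simp add: lookup_minus lookup_trunc)
    next
      case False
      then have "1 + real N \<le> ?h n" by linarith
      then have "?h n ^ s * cmod (w n) * (1 + real N) \<le> ?h n ^ s * cmod (w n) * ?h n"
        by (intro mult_left_mono) auto
      then have tail: "?h n ^ s * cmod (w n) \<le> 1 / (1 + real N) * (?h n ^ Suc s * cmod (w n))"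
        by (simp add: pos_le_divide_eq mult_ac)
      have "cmod (lookup (trunc w N - r N) n) \<le> cmod (w n - lookup (r N) n) + cmod (w n)"
        using False norm_triangle_ineq4[of "w n - lookup (r N) n" "w n"] by (simp add: lookup_minus lookup_trunc)
      then have "?h n ^ s * cmod (lookup (trunc w N - r N) n) \<le> ?h n ^ s * (cmod (w n - lookup (r N) n) + cmod (w n))"
        by (rule mult_left_mono) simp
      then show ?thesis using tail by (simp only: distrib_left)
    qed
  qed
  also have "\<dots> = (\<Sum>n\<in>F. ?h n ^ s * cmod (w n - lookup (r N) n)) + 1 / (1 + real N) * (\<Sum>n\<in>F. ?h n ^ Suc s * cmod (w n))"
    by (simp only: sum.distrib sum_distrib_left)
  also have "\<dots> \<le> \<eta> + 1 / (1 + real N) * A"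
    using 1 2 by (intro add_mono mult_left_mono) auto
  finally show ?thesis by simp
qed

lemma energy_conserved:
  assumes \<delta>: "0 < \<delta>"
  shows "conserved \<delta> (energy \<delta> k)"
  unfolding conserved_def
\<comment> \<open>k + 7 = k + 1 + 3 + 3: order k for the energy, one for the rate 1/N of the defect,
  three lost in the right-hand side of ILW, and three for passing from bounds on coefficients to
  \<open>wnorm\<close>.\<close>
proof (intro exI[of _ "Suc (k + 7)"] allI impI)
  fix u :: "real \<Rightarrow> real \<Rightarrow> real" and t0 :: real
  assume "C_class (Suc (k + 7)) u \<and> solves_ILW \<delta> u"
  then have C: "C_class (Suc (k + 7)) u" and sol: "solves_ILW \<delta> u" by auto
  obtain D where D: "D 0 = u" "\<And>j t x. j < Suc (k + 7) \<Longrightarrow> (D j t has_real_derivative D (Suc j) t x) (at x)"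
    "\<And>j. j \<le> Suc (k + 7) \<Longrightarrow> continuous_on UNIV (\<lambda>(t, x). D j t x)"
    using C_class_derivatives[OF C] by blast
  obtain ut where ut: "\<And>t x. ((\<lambda>s. u s x) has_real_derivative ut t x) (at t)" "C_class (k + 7) ut"
    using C unfolding C_class.simps by blast
  have cut: "continuous_on UNIV (\<lambda>(t, x). ut t x)" by (rule C_class_continuous[OF ut(2)])
  have cu: "continuous_on UNIV (\<lambda>(t, x). u t x)" by (rule C_class_continuous[OF C])
  have mean: "periodic_mean_zero (u t)" for t using sol by (simp add: solves_ILW_def)
  define g where "g = (\<lambda>n. complex_of_real (gsym \<delta> n))"
  let ?p = "\<lambda>t. trunc (fc (u t))"
  let ?r = "\<lambda>t N. ilw_rhs g (?p t N)"
  \<comment> \<open>Uniform for t in a bounded interval, because the rate of change will be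
    integrated from 0 to t0.\<close>
  have decay: "\<exists>B. \<forall>t\<in>{- T..T}. \<forall>n. jb n ^ (k + 7) * cmod (fc (u t) n) \<le> B" for T
  proof -
    have "\<forall>j. \<exists>B. j \<le> k + 7 \<longrightarrow> (\<forall>t\<in>{- T..T}. \<forall>x\<in>{0..2*pi}. \<bar>D j t x\<bar> \<le> B)"
      using bounded_slab[OF D(3)] by (metis le_SucI)
    from choice[OF this] obtain B where B: "\<And>j t x. j \<le> k + 7 \<Longrightarrow> t \<in> {- T..T} \<Longrightarrow> x \<in> {0..2*pi} \<Longrightarrow> \<bar>D j t x\<bar> \<le> B j"
      by blast
    have "jb n ^ (k + 7) * cmod (fc (D 0 t) n) \<le> 2 ^ (k + 7) * (\<Sum>j\<le>k + 7. \<bar>B j\<bar>)" if t: "t \<in> {- T..T}" for t n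
    proof (rule coeff_decay[of _ "\<lambda>j. D j t"])
      fix j x assume j: "j \<le> k + 7" and x: "x \<in> {0..2*pi}"
      have "\<bar>D j t x\<bar> \<le> \<bar>B j\<bar>" using B[OF j t x] by linarith
      also have "\<dots> \<le> (\<Sum>j\<le>k + 7. \<bar>B j\<bar>)" using j by (intro member_le_sum) auto
      finally show "\<bar>D j t x\<bar> \<le> (\<Sum>j\<le>k + 7. \<bar>B j\<bar>)" .
    qed (use D mean in \<open>auto simp: periodic_mean_zero_def intro: continuous_slice\<close>)
    then show ?thesis unfolding D(1) by blast
  qed
  have decay': "\<exists>B. \<forall>n. jb n ^ i * cmod (fc (u t) n) \<le> B" if i: "i \<le> k + 7" for i t
  proof -
    obtain B where B: "\<And>n. jb n ^ (k + 7) * cmod (fc (u t) n) \<le> B"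
    proof -
      have "t \<in> {- \<bar>t\<bar>..\<bar>t\<bar>}" by auto
      then show ?thesis using that decay[of "\<bar>t\<bar>"] by blast
    qed
    have "jb n ^ i * cmod (fc (u t) n) \<le> B" for n
      using i by (intro order.trans[OF mult_right_mono B] power_increasing) auto
    then show ?thesis by blast
  qed
  have sob: "u t \<in> sobolev_mean_zero (real k / 2)" for t
  proof -
    obtain B where "\<And>n. jb n ^ (k + 1) * cmod (fc (u t) n) \<le> B" using decay'[of "k + 1" t] by auto
    then have "sobolev_terms (real k / 2) (u t) summable_on UNIV" by (rule summable_sobolev_terms)
    moreover have "integrable torus (\<lambda>x. (u t x)\<^sup>2)"
      by (intro torus_integral continuous_intros continuous_slice[OF cu])
    ultimately show ?thesis using mean by (simp add: sobolev_mean_zero_def)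
  qed
  \<comment> \<open>The equation enters here: the right-hand side evaluated at the truncations
    tends, coefficient by coefficient, to the time derivative of the solution.\<close>
  have w: "(\<lambda>N. lookup (?r t N) n) \<longlonglongrightarrow> fc (ut t) n" for t n
  proof (rule approx_fourier_coeff)
    let ?f = "\<lambda>x. complex_of_real (u t x)"
    have dx: "(u t has_real_derivative D 1 t x) (at x)" "(D 1 t has_real_derivative D 2 t x) (at x)" for x
      using D(2)[of 0 t x] D(2)[of 1 t x] D(1) by (simp_all add: numeral_2_eq_2)
    have cdx: "((\<lambda>x. complex_of_real (u t x)) has_vector_derivative complex_of_real (D 1 t x)) (at x)"
      "((\<lambda>x. complex_of_real (D 1 t x)) has_vector_derivative complex_of_real (D 2 t x)) (at x)" for x
      by (intro has_vector_derivative_of_real dx)+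
    obtain B where B: "\<And>n. jb n ^ (Suc 2 + 3) * cmod (fc (u t) n) \<le> B" using decay'[of "Suc 2 + 3" t] by auto
    have f: "approx (Suc 2) ?f (?p t)"
      by (rule fourier_inversion[OF _ cdx(1) B]) (use mean[of t] in \<open>simp add: periodic_mean_zero_def\<close>)
    have Dxu: "Dx (u t) = D 1 t" "Dx (D 1 t) = D 2 t"
      using dx by (auto simp: Dx_def fun_eq_iff has_real_derivative_iff_has_vector_derivative simp del: One_nat_def intro: vector_derivative_at)
    have Dxf: "Dx ?f = (\<lambda>x. complex_of_real (D 1 t x))" "Dx (\<lambda>x. complex_of_real (D 1 t x)) = (\<lambda>x. complex_of_real (D 2 t x))"
      using cdx by (auto simp: Dx_def fun_eq_iff simp del: One_nat_def intro: vector_derivative_at)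
    have "(\<lambda>y. complex_of_real (Dx (Dx (u t)) y)) = Dx (Dx ?f)" by (simp only: Dxu Dxf)
    moreover have "complex_of_real (Dx (\<lambda>y. (u t y)\<^sup>2) x) = Dx (\<lambda>y. ?f y * ?f y) x" for x
    proof -
      have sq: "((\<lambda>y. (u t y)\<^sup>2) has_real_derivative 2 * u t x * D 1 t x) (at x)"
        using dx(1)[of x] by (auto intro!: derivative_eq_intros)
      have "((\<lambda>y. ?f y * ?f y) has_vector_derivative complex_of_real (2 * u t x * D 1 t x)) (at x)"
        using has_vector_derivative_of_real[OF sq] by (simp add: power2_eq_square)
      then show ?thesis
        using sq by (simp add: Dx_def vector_derivative_at has_real_derivative_iff_has_vector_derivative)
    qed
    moreover have "Dx (\<lambda>s. u s x) t = ut t x" for x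
      unfolding Dx_def using ut(1)[of x t] by (intro vector_derivative_at) (simp add: has_real_derivative_iff_has_vector_derivative)
    moreover have "complex_of_real (Dx (\<lambda>s. u s x) t) - G \<delta> (\<lambda>y. complex_of_real (Dx (Dx (u t)) y)) x = complex_of_real (Dx (\<lambda>y. (u t y)\<^sup>2) x)" for x
      using sol by (simp add: solves_ILW_def)
    ultimately have eq: "(\<lambda>x. complex_of_real (ut t x)) = (\<lambda>x. fourier_multiplier (G_symbol \<delta>) (Dx (Dx ?f)) x + Dx (\<lambda>y. ?f y * ?f y) x)"
      by (simp add: fun_eq_iff G_def diff_eq_eq add.commute)
    have "approx 0 (\<lambda>x. fourier_multiplier (G_symbol \<delta>) (Dx (Dx ?f)) x + Dx (\<lambda>y. ?f y * ?f y) x)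
       (\<lambda>N. mult_op (G_symbol \<delta>) (ddx (ddx (?p t N))) + ddx (?p t N * ?p t N))"
      by (intro approx_add approx_fourier_multiplier[OF _ G_symbol_in_symbols[OF \<delta>]] approx_Dx(1) approx_times
          approx_mono[OF f]) auto
    then show "approx 0 (\<lambda>x. complex_of_real (ut t x)) (?r t)"
      unfolding eq g_def ilw_rhs_eq .
  qed
  define T where "T = \<bar>t0\<bar>"
  obtain B where B: "\<And>t n. t \<in> {- T..T} \<Longrightarrow> jb n ^ ((k + 4) + 3) * cmod (fc (u t) n) \<le> B"
  proof -
    have eq: "(k + 4) + 3 = k + 7" by simp
    show ?thesis using that decay[of T] unfolding eq by blast
  qed
  obtain Z where Z: "0 \<le> Z" "\<And>A. finite A \<Longrightarrow> (\<Sum>a\<in>A. 1 / (jb a)\<^sup>2) \<le> Z"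
    using inverse_square_sum by metis
  have B0: "0 \<le> B" using order.trans[OF _ B[of 0 0]] by (simp add: T_def)
  define A where "A = B * Z"
  have A0: "0 \<le> A" using B0 Z(1) by (simp add: A_def)
  have pdiff: "wnorm (k + 4) (?p t M - ?p t N) \<le> A / (1 + real N)" if "t \<in> {- T..T}" "N \<le> M" for t M N
    unfolding A_def by (rule wnorm_trunc_diff[OF B[OF that(1)] Z(2)]) (use that in auto)
  \<comment> \<open>Comparison with the truncation at level 0, which is the zero polynomial because
    the mean vanishes.\<close>
  have psize: "wnorm (k + 4) (?p t M) \<le> A" if "t \<in> {- T..T}" for t M
    using pdiff[OF that, of 0 M] mean[of t] by (simp add: trunc_0 fc_zero_mode)
  let ?K = "1 + 2 * inv_depth \<delta> + A + A"
  have K0: "0 \<le> ?K" using inv_depth_nonneg[OF \<delta>] A0 by simp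
  have rdiff: "wnorm k (?r t M - ?r t N) \<le> ?K * (A / (1 + real N))" if t: "t \<in> {- T..T}" and "N \<le> M" for t M N
  proof -
    have m: "wnorm (k + 3) p \<le> wnorm (k + 4) p" for p by (rule wnorm_mono) simp
    have "wnorm k (?r t M - ?r t N) \<le> (1 + 2 * inv_depth \<delta> + wnorm (k + 3) (?p t M) + wnorm (k + 3) (?p t N)) * wnorm (k + 3) (?p t M - ?p t N)"
      unfolding g_def by (rule wnorm_ilw_rhs_diff[OF \<delta>])
    also have "\<dots> \<le> ?K * (A / (1 + real N))"
      using K0 inv_depth_nonneg[OF \<delta>] pdiff[OF that] psize[OF t]
      by (intro mult_mono add_mono order.trans[OF m]) (auto simp: wnorm_nonneg)
    finally show ?thesis .
  qed
  have rsize: "wnorm (Suc k) (?r t M) \<le> ?K * A" if t: "t \<in> {- T..T}" for t M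
  proof -
    have z: "ilw_rhs g 0 = 0" by (simp add: ilw_rhs_def)
    have "wnorm (Suc k) (?r t M - ilw_rhs g 0) \<le> (1 + 2 * inv_depth \<delta> + wnorm (Suc k + 3) (?p t M) + wnorm (Suc k + 3) 0) * wnorm (Suc k + 3) (?p t M - 0)"
      unfolding g_def by (rule wnorm_ilw_rhs_diff[OF \<delta>])
    also have "\<dots> \<le> ?K * A"
      using K0 A0 inv_depth_nonneg[OF \<delta>] psize[OF t, of M]
      by (intro mult_mono add_mono) (auto simp: wnorm_nonneg numeral_eq_Suc)
    finally show ?thesis by (simp add: z)
  qed
  obtain C where C: "0 \<le> C" "\<And>p t e \<eta>. lder p (ilw_rhs g (p t) + e) t \<Longrightarrow>
     lookup (p t) 0 = 0 \<Longrightarrow> lookup e 0 = 0 \<Longrightarrow> hnorm2 k (p t) \<le> A\<^sup>2 \<Longrightarrow> hnorm2 k e \<le> \<eta>\<^sup>2 \<Longrightarrow> 0 < \<eta> \<Longrightarrow>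
     \<exists>Y. ((\<lambda>s. lenergy \<delta> (p s) k) has_real_derivative Y) (at t) \<and> \<bar>Y\<bar> \<le> C * \<eta>"
    using lenergy_rate_bound[OF \<delta>, of "A\<^sup>2" k] unfolding g_def by auto
  \<comment> \<open>Twice \<open>?K * A\<close>: one share from the difference of right-hand sides,
    one from the tail. The summand 1 makes the defect bound strictly positive, as the rate estimate
    demands.\<close>
  define K where "K = 2 * (?K * A) + 1"
  have Kpos: "0 < K" using K0 A0 by (simp add: K_def add_nonneg_pos)
  have rate: "\<exists>Y. ((\<lambda>s. lenergy \<delta> (?p s N) k) has_real_derivative Y) (at t) \<and> \<bar>Y\<bar> \<le> C * (K / (1 + real N))"
    if t: "t \<in> {- T..T}" for t N
  proof (rule C(2))
    let ?e = "trunc (fc (ut t)) N - ?r t N"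
    show "lder (\<lambda>s. ?p s N) (ilw_rhs g (?p t N) + ?e) t"
      using lder_trunc[OF fc_time_derivative[OF ut(1) cu cut]] by simp
    show "lookup (?p t N) 0 = 0" by (simp add: lookup_trunc fc_zero_mode mean)
    have "fc (ut t) 0 = 0"
      using LIMSEQ_unique[OF w[of t 0]] by (simp add: g_def ilw_rhs_lookup_0)
    then show "lookup ?e 0 = 0"
      by (simp add: lookup_minus lookup_trunc g_def ilw_rhs_lookup_0)
    have "hnorm2 k (?p t N) \<le> (wnorm k (?p t N))\<^sup>2" by (rule hnorm2_le_wnorm)
    also have "\<dots> \<le> A\<^sup>2"
      using order.trans[OF wnorm_mono psize[OF t]] by (intro power_mono) (auto simp: wnorm_nonneg)
    finally show "hnorm2 k (?p t N) \<le> A\<^sup>2" .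
    have "wnorm k ?e \<le> ?K * (A / (1 + real N)) + ?K * A / (1 + real N)"
      by (rule truncation_defect[OF w]) (use rdiff[OF t] rsize[OF t] in auto)
    also have "\<dots> = 2 * (?K * A) / (1 + real N)" by (simp add: add_divide_distrib[symmetric])
    also have "\<dots> \<le> K / (1 + real N)" by (intro divide_right_mono) (auto simp: K_def)
    finally have "(wnorm k ?e)\<^sup>2 \<le> (K / (1 + real N))\<^sup>2" by (intro power_mono) (auto simp: wnorm_nonneg)
    then show "hnorm2 k ?e \<le> (K / (1 + real N))\<^sup>2" using hnorm2_le_wnorm order_trans by blast
    show "0 < K / (1 + real N)" using Kpos by simp
  qed
  \<comment> \<open>By the mean value inequality the energy of the truncation at level N drifts by
    O(1/N) up to time t0; in the limit the drift disappears.\<close>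
  have drift: "\<bar>lenergy \<delta> (?p t0 N) k - lenergy \<delta> (?p 0 N) k\<bar> \<le> C * K * T * inverse (real (Suc N))" for N
  proof -
    have "\<forall>t\<in>{- T..T}. \<exists>Y. ((\<lambda>s. lenergy \<delta> (?p s N) k) has_real_derivative Y) (at t) \<and> \<bar>Y\<bar> \<le> C * (K / (1 + real N))"
      using rate by blast
    from bchoice[OF this] obtain Y where Y: "\<forall>t\<in>{- T..T}. ((\<lambda>s. lenergy \<delta> (?p s N) k) has_real_derivative Y t) (at t) \<and> \<bar>Y t\<bar> \<le> C * (K / (1 + real N))" ..
    have "norm (lenergy \<delta> (?p t0 N) k - lenergy \<delta> (?p 0 N) k) \<le> C * (K / (1 + real N)) * norm (t0 - 0)"
    proof (rule field_differentiable_bound[of "{- T..T}" _ Y])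
      show "((\<lambda>s. lenergy \<delta> (?p s N) k) has_field_derivative Y t) (at t within {- T..T})" if "t \<in> {- T..T}" for t
        using Y that by (blast intro: has_field_derivative_at_within)
    qed (use Y in \<open>auto simp: T_def\<close>)
    then show ?thesis by (simp add: T_def divide_inverse mult_ac)
  qed
  have lim: "(\<lambda>N. lenergy \<delta> (?p t N) k) \<longlonglongrightarrow> energy \<delta> k (u t)" for t
    by (rule energy_eq_limit[OF sob \<delta>])
  have "(\<lambda>N. lenergy \<delta> (?p t0 N) k - lenergy \<delta> (?p 0 N) k) \<longlonglongrightarrow> 0"
  proof (rule Lim_null_comparison)
    show "\<forall>\<^sub>F N in sequentially. norm (lenergy \<delta> (?p t0 N) k - lenergy \<delta> (?p 0 N) k) \<le> C * K * T * inverse (real (Suc N))"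
      using drift by (intro always_eventually allI) simp
    show "(\<lambda>N. C * K * T * inverse (real (Suc N))) \<longlonglongrightarrow> 0"
      using tendsto_mult_right_zero[OF LIMSEQ_inverse_real_of_nat] by blast
  qed
  from LIMSEQ_unique[OF this tendsto_diff[OF lim lim]]
  show "energy \<delta> k (u t0) = energy \<delta> k (u 0)" by simp
qed

theorem theorem1p3:
  fixes k :: nat
  shows "(\<forall>\<delta>::real. 0 < \<delta> \<longrightarrow> conserved (ereal \<delta>) (energy (ereal \<delta>) k))
       \<and> conserved \<infinity> (energy \<infinity> k)
       \<and> (\<forall>u \<in> sobolev_mean_zero (real k / 2).
            ((\<lambda>\<delta>::real. energy (ereal \<delta>) k u) \<longlongrightarrow> energy \<infinity> k u) at_top)"
  using energy_conserved energy_depth_limit by simp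

end
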